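(* Let $\mathcal{D}\subseteq\mathbb{R}^d$ be a nonempty convex compact set of diameter $D$ and let $\phi$ be an $L$-smooth (possibly nonconvex) function on $\mathcal{D}$, with $x_\star\in\arg\min_{x\in\mathcal{D}}\phi(x)$. Apply the DC-FW algorithm with target accuracy $\epsilon>0$ and initial point $x_0\in\mathcal{D}$, using the decomposition $\phi=f-g$ with $$f(x)=\tfrac{L}{2}\|x\|^2,\qquad g(x)=\tfrac{L}{2}\|x\|^2-\phi(x).$$ Then the generated sequence $\{x_t\}$ satisfies, for every $t\ge0$, $$\min_{0\le\tau\le t}\mathrm{gap}_{\mathrm{DC}}(x_\tau)\le\frac{\phi(x_0)-\phi(x_\star)}{t+1}+\frac{\epsilon}{2},$$ and the inner loop terminates after at most $K\le 4LD^2/\epsilon$ iterations. As a consequence, the method finds an $\epsilon$-suboptimal stationary point (a point $x_\tau$ with $\mathrm{gap}_{\mathrm{DC}}(x_\tau)\le\epsilon$) after $\mathcal{O}(1/\epsilon)$ evaluations of $\nabla\phi$ and $\mathcal{O}(1/\epsilon^2)$ linear minimization oracle calls. Moreover, if $\mathcal{D}$ is a strongly convex set, the linear minimization oracle complexity improves to $\mathcal{O}(1/\epsilon^{3/2})$, provided that the Demyanov–Rubinov step-size is used. The constants hidden in $\mathcal{O}(\cdot)$ do not depend on $\epsilon$.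
   Context: Conventions: $\|\cdot\|$ is the Euclidean norm. $\phi$ is $L$-smooth on $\mathcal{D}$ if it is differentiable and $\nabla\phi$ is $L$-Lipschitz on $\mathcal{D}$. With this decomposition $f$ and $g$ are convex and differentiable, and $\nabla g(x)=Lx-\nabla\phi(x)$. Gap: for $y\in\mathcal{D}$, $$\mathrm{gap}_{\mathrm{DC}}(y):=\max_{x\in\mathcal{D}}\big\{f(y)-f(x)-\langle\nabla g(y),y-x\rangle\big\}.$$ Strongly convex set: $\mathcal{D}$ is $\alpha$-strongly convex ($\alpha>0$) with respect to a norm $\|\cdot\|$ if for all $x,y\in\mathcal{D}$, $\eta\in[0,1]$ and all $z\in\mathbb{R}^d$ with $\|z\|\le1$, one has $x+\eta(y-x)+\eta(1-\eta)\frac{\alpha}{2}\|x-y\|^2z\in\mathcal{D}$; it is strongly convex if this holds for some $\alpha>0$. DC-FW algorithm (target accuracy $\epsilon>0$, initial point $x_0\in\mathcal{D}$). For $t=0,1,2,\dots$: set $X_{t,1}=x_t$. Then (inner loop) for $k=1,2,\dots$: compute $S_{t,k}\in\arg\min_{x\in\mathcal{D}}\langle\nabla f(X_{t,k})-\nabla g(x_t),x\rangle$ (one call to the linear minimization oracle) and $D_{t,k}=S_{t,k}-X_{t,k}$; if $-\langle\nabla f(X_{t,k})-\nabla g(x_t),D_{t,k}\rangle\le\epsilon/2$, set $x_{t+1}=X_{t,k}$ and leave the inner loop; otherwise set $X_{t,k+1}=X_{t,k}+\eta_{t,k}D_{t,k}$. Since $\nabla f(x)=Lx$, $\nabla\phi$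 is evaluated only once per outer iteration, at $x_t$. Step-size rules, with $\hat\phi_t(x)=f(x)-g(x_t)-\langle\nabla g(x_t),x-x_t\rangle$: $\eta_{t,k}=2/(k+1)$; or exact line search $\eta_{t,k}\in\arg\min_{\eta\in[0,1]}\hat\phi_t(X_{t,k}+\eta D_{t,k})$; or Demyanov–Rubinov $\eta_{t,k}=\min\Big\{\frac{-\langle\nabla\hat\phi_t(X_{t,k}),D_{t,k}\rangle}{L\|D_{t,k}\|^2},1\Big\}$.
   Formalization: The inner-loop bound is proved as K ≤ max(1, 4LD²/ε), where K counts update steps (the final stopping test is not counted); the printed bound fails when 4LD²/ε < 1, e.g. D=[0,1], L=1, φ(x)=100x, x_0=1, ε=8. L>0 is assumed. *)

theory Defs
  imports "HOL-Analysis.Analysis" "HOL-Library.Landau_Symbols"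
begin

definition gradient :: "('a::real_inner \<Rightarrow> real) \<Rightarrow> 'a \<Rightarrow> 'a" where
  "gradient f x = (THE v. GDERIV f x :> v)"

definition L_smooth_on :: "real \<Rightarrow> 'a::real_inner set \<Rightarrow> ('a \<Rightarrow> real) \<Rightarrow> bool" where
  "L_smooth_on L D \<phi> \<longleftrightarrow>
     (\<forall>x\<in>D. \<phi> differentiable (at x)) \<and> L-lipschitz_on D (gradient \<phi>)"

text \<open>For compact \<open>D\<close> and continuous \<open>f\<close> the supremum below is attained, so it is the
  maximum over \<open>D\<close>.\<close>

definition gap_DC ::
  "('a::real_inner \<Rightarrow> real) \<Rightarrow> ('a \<Rightarrow> real) \<Rightarrow> 'a set \<Rightarrow> 'a \<Rightarrow> real" where
  "gap_DC f g D y = (SUP x\<in>D. f y - f x - gradient g y \<bullet> (y - x))"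

definition strongly_convex_set_with :: "real \<Rightarrow> 'a::real_inner set \<Rightarrow> bool" where
  "strongly_convex_set_with \<alpha> D \<longleftrightarrow>
     (\<forall>x\<in>D. \<forall>y\<in>D. \<forall>\<eta>\<in>{0..1}. \<forall>z. norm z \<le> 1 \<longrightarrow>
        x + \<eta> *\<^sub>R (y - x) + (\<eta> * (1 - \<eta>) * (\<alpha> / 2) * (norm (x - y))\<^sup>2) *\<^sub>R z \<in> D)"

definition strongly_convex_set :: "'a::real_inner set \<Rightarrow> bool" where
  "strongly_convex_set D \<longleftrightarrow> (\<exists>\<alpha>>0. strongly_convex_set_with \<alpha> D)"

definition surrogate ::
  "('a::real_inner \<Rightarrow> real) \<Rightarrow> ('a \<Rightarrow> real) \<Rightarrow> 'a \<Rightarrow> 'a \<Rightarrow> real" where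
  "surrogate f g y x = f x - g y - gradient g y \<bullet> (x - y)"

datatype step_rule = Open_Loop | Exact_Line_Search | Demyanov_Rubinov

text \<open>\<open>admissible_step rule L f g y k X d \<eta>\<close>: the rule allows the step size \<open>\<eta>\<close> at inner
  iteration \<open>k\<close>, at the inner iterate \<open>X\<close> with direction \<open>d\<close>, the outer iterate being \<open>y\<close>.\<close>

fun admissible_step ::
  "step_rule \<Rightarrow> real \<Rightarrow> ('a::real_inner \<Rightarrow> real) \<Rightarrow> ('a \<Rightarrow> real) \<Rightarrow>
   'a \<Rightarrow> nat \<Rightarrow> 'a \<Rightarrow> 'a \<Rightarrow> real \<Rightarrow> bool" where
  "admissible_step Open_Loop L f g y k X d \<eta> \<longleftrightarrow> \<eta> = 2 / (real k + 1)"
| "admissible_step Exact_Line_Search L f g y k X d \<eta> \<longleftrightarrow>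
     is_arg_min (\<lambda>s. surrogate f g y (X + s *\<^sub>R d)) (\<lambda>s. s \<in> {0..1}) \<eta>"
| "admissible_step Demyanov_Rubinov L f g y k X d \<eta> \<longleftrightarrow>
     \<eta> = min (- (gradient (surrogate f g y) X \<bullet> d) / (L * (norm d)\<^sup>2)) 1"

text \<open>A run of the algorithm records \<open>x\<^sub>t\<close> (outer), \<open>X\<^sub>t\<^sub>,\<^sub>k\<close> (inner), the answers \<open>S\<^sub>t\<^sub>,\<^sub>k\<close> of the
  linear minimization oracle and the step sizes \<open>\<eta>\<^sub>t\<^sub>,\<^sub>k\<close>; the inner index starts at \<open>1\<close>.\<close>

record 'a dcfw_trace =
  outer :: "nat \<Rightarrow> 'a"
  inner_it :: "nat \<Rightarrow> nat \<Rightarrow> 'a"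
  oracle_ans :: "nat \<Rightarrow> nat \<Rightarrow> 'a"
  step_size :: "nat \<Rightarrow> nat \<Rightarrow> real"

definition direction :: "'a::real_inner dcfw_trace \<Rightarrow> nat \<Rightarrow> nat \<Rightarrow> 'a" where
  "direction R t k = oracle_ans R t k - inner_it R t k"

definition lin_grad ::
  "('a::real_inner \<Rightarrow> real) \<Rightarrow> ('a \<Rightarrow> real) \<Rightarrow> 'a dcfw_trace \<Rightarrow> nat \<Rightarrow> nat \<Rightarrow> 'a" where
  "lin_grad f g R t k = gradient f (inner_it R t k) - gradient g (outer R t)"

definition inner_stop ::
  "('a::real_inner \<Rightarrow> real) \<Rightarrow> ('a \<Rightarrow> real) \<Rightarrow> real \<Rightarrow> 'a dcfw_trace \<Rightarrow> nat \<Rightarrow> nat \<Rightarrow> bool" where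
  "inner_stop f g \<epsilon> R t k \<longleftrightarrow> - (lin_grad f g R t k \<bullet> direction R t k) \<le> \<epsilon> / 2"

text \<open>Only the inner iterations that are really executed are constrained, i.e. those \<open>k\<close> for which
  no earlier \<open>j\<close> passes the stopping test. Termination of the inner loops is not built in: if the
  loop \<open>t\<close> never stops, nothing is required of \<open>outer R (Suc t)\<close>.\<close>

definition dcfw_run ::
  "('a::real_inner \<Rightarrow> real) \<Rightarrow> ('a \<Rightarrow> real) \<Rightarrow> real \<Rightarrow> 'a set \<Rightarrow> step_rule \<Rightarrow> real \<Rightarrow> 'a \<Rightarrow>
   'a dcfw_trace \<Rightarrow> bool" where
  "dcfw_run f g L D rule \<epsilon> x0 R \<longleftrightarrow>
     outer R 0 = x0 \<and>
     (\<forall>t. inner_it R t 1 = outer R t) \<and>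
     (\<forall>t k. 1 \<le> k \<and> (\<forall>j\<in>{1..<k}. \<not> inner_stop f g \<epsilon> R t j) \<longrightarrow>
        is_arg_min (\<lambda>x. lin_grad f g R t k \<bullet> x) (\<lambda>x. x \<in> D) (oracle_ans R t k) \<and>
        (if inner_stop f g \<epsilon> R t k
         then outer R (Suc t) = inner_it R t k
         else admissible_step rule L f g (outer R t) k (inner_it R t k) (direction R t k)
                (step_size R t k) \<and>
              inner_it R t (Suc k) = inner_it R t k + step_size R t k *\<^sub>R direction R t k))"

definition inner_terminates ::
  "('a::real_inner \<Rightarrow> real) \<Rightarrow> ('a \<Rightarrow> real) \<Rightarrow> real \<Rightarrow> 'a dcfw_trace \<Rightarrow> nat \<Rightarrow> bool" where
  "inner_terminates f g \<epsilon> R t \<longleftrightarrow> (\<exists>k\<ge>1. inner_stop f g \<epsilon> R t k)"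

text \<open>The number of oracle calls of the inner loop \<open>t\<close>. The last call only serves the stopping test that
  succeeds, so the number of Frank--Wolfe iterations (updates of \<open>X\<close>) is one less.\<close>

definition inner_oracle_calls ::
  "('a::real_inner \<Rightarrow> real) \<Rightarrow> ('a \<Rightarrow> real) \<Rightarrow> real \<Rightarrow> 'a dcfw_trace \<Rightarrow> nat \<Rightarrow> nat" where
  "inner_oracle_calls f g \<epsilon> R t = (LEAST k. 1 \<le> k \<and> inner_stop f g \<epsilon> R t k)"

definition inner_iterations ::
  "('a::real_inner \<Rightarrow> real) \<Rightarrow> ('a \<Rightarrow> real) \<Rightarrow> real \<Rightarrow> 'a dcfw_trace \<Rightarrow> nat \<Rightarrow> nat" where
  "inner_iterations f g \<epsilon> R t = inner_oracle_calls f g \<epsilon> R t - 1"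

definition first_stationary ::
  "('a::real_inner \<Rightarrow> real) \<Rightarrow> ('a \<Rightarrow> real) \<Rightarrow> 'a set \<Rightarrow> real \<Rightarrow> 'a dcfw_trace \<Rightarrow> nat" where
  "first_stationary f g D \<epsilon> R = (LEAST \<tau>. gap_DC f g D (outer R \<tau>) \<le> \<epsilon>)"

text \<open>Costs are counted up to and including the outer iteration that starts at the first
  \<open>\<epsilon>\<close>-suboptimal stationary point \<open>x\<^sub>\<tau>\<close>: one evaluation of the gradient of the nonconvex objective
  at each of \<open>x\<^sub>0, \<dots>, x\<^sub>\<tau>\<close>, and all oracle calls of the inner loops \<open>0, \<dots>, \<tau>\<close>.\<close>

definition gradient_evaluations ::
  "('a::real_inner \<Rightarrow> real) \<Rightarrow> ('a \<Rightarrow> real) \<Rightarrow> 'a set \<Rightarrow> real \<Rightarrow> 'a dcfw_trace \<Rightarrow> nat" where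
  "gradient_evaluations f g D \<epsilon> R = first_stationary f g D \<epsilon> R + 1"

definition oracle_calls ::
  "('a::real_inner \<Rightarrow> real) \<Rightarrow> ('a \<Rightarrow> real) \<Rightarrow> 'a set \<Rightarrow> real \<Rightarrow> 'a dcfw_trace \<Rightarrow> nat" where
  "oracle_calls f g D \<epsilon> R = (\<Sum>t\<le>first_stationary f g D \<epsilon> R. inner_oracle_calls f g \<epsilon> R t)"

end

(*
  The surrogate minimized in the inner loop is, up to scaling, the squared distance to a point, and
  its primal gap at x_t is gap_DC(x_t). Since the surrogate majorizes phi, the stopping test gives
  gap_DC(x_t) <= phi(x_t) - phi(x_{t+1}) + epsilon/2, and the outer bound follows by telescoping.

  The bound 4 L D^2 / epsilon on the inner loop needs min_{k<=K} G_k <= 2 L D^2 / K for the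
  Frank-Wolfe gaps G_k of a quadratic, about half of what the usual analysis yields. The factor
  comes from comparing S_k with S_{k+1}: as long as the gap stays away from 0, the squared
  lengths of two successive directions sum up to about D^2 instead of 2 D^2. For short steps this
  leads to a potential that grows by 1 in each iteration. For the open-loop steps the
  distance to the minimizer must be tracked as well, in a duality argument for a linear
  program in the scalar quantities of the run.

  On a strongly convex set the gap dominates |S - X|^2 |gradient|, so a short step decreases the
  primal gap h by at least a multiple of G sqrt(h); hence G <= epsilon/2 after O(epsilon^(-1/2)) steps.
*)
theory Submission
  imports Defs
begin

text \<open>The gap bound \<open>2 / K\<close> is needed without any loss in the constant, and for
  some \<open>K\<close> the margin of the estimates is below one percent. Losses at the two ends of
  a telescoping sum are therefore not affordable for small \<open>K\<close>, which is why finitely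
  many run lengths get certificates of their own. The gap bounds are proved by contradiction: while
  the loop runs, every gap exceeds a threshold d. For short steps, 1/h can then be continued below d
  by its tangent, whose value 2/d at 0 is exactly \<open>K\<close> for d = 2 / \<open>K\<close>, so
  a potential that gains 1 per iteration is just enough. Open-loop steps may increase h; no such
  monotone quantity is at hand, and duality supplies the weights instead. The count starts at
  \<open>K\<close> = 2. The first Frank-Wolfe gap is governed by the gradient of phi at x_t, which L
  D^2 does not bound; hence the \<open>max 1\<close> in the theorem. On a quadratic, exact line
  search and the Demyanov-Rubinov step coincide, so two recursions cover the three rules.\<close>

section \<open>Open-loop steps: weighted gap sums by linear programming duality\<close>

text \<open>The scalars of a Frank--Wolfe run on a squared distance with step sizes \<open>2 / (k + 1)\<close> on a set
  of diameter 1. With \<open>x*\<close> the minimizer and \<open>p*\<close> the gradient there, \<open>rho\<close> is half the squared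
  distance to \<open>x*\<close>, \<open>lin\<close> and \<open>off\<close> are \<open>\<langle>p*, X - x*\<rangle>\<close> and \<open>\<langle>p*, S - x*\<rangle>\<close>, \<open>x\<close> is
  \<open>\<parallel>S - X\<parallel>\<^sup>2\<close>, and \<open>G\<close> is the Frank--Wolfe gap. The last condition combines the optimality of \<open>S\<^sub>k\<close> against
  \<open>S\<^sub>k\<^sub>+\<^sub>1\<close> with \<open>\<parallel>S\<^sub>k - S\<^sub>k\<^sub>+\<^sub>1\<parallel> \<le> 1\<close>; it makes \<open>x\<close> about \<open>1 / 2\<close> on average.\<close>

locale open_loop_recursion =
  fixes K :: nat and rho lin slack off x G :: "nat \<Rightarrow> real"
  assumes rho_nonneg: "\<lbrakk>1 \<le> k; k \<le> Suc K\<rbrakk> \<Longrightarrow> 0 \<le> rho k"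
    and lin_nonneg: "\<lbrakk>1 \<le> k; k \<le> Suc K\<rbrakk> \<Longrightarrow> 0 \<le> lin k"
    and slack_nonneg: "\<lbrakk>1 \<le> k; k \<le> K\<rbrakk> \<Longrightarrow> 0 \<le> slack k"
    and off_nonneg: "\<lbrakk>1 \<le> k; k \<le> K\<rbrakk> \<Longrightarrow> 0 \<le> off k"
    and x_nonneg: "\<lbrakk>1 \<le> k; k \<le> K\<rbrakk> \<Longrightarrow> 0 \<le> x k"
    and x_le_1: "\<lbrakk>1 \<le> k; k \<le> K\<rbrakk> \<Longrightarrow> x k \<le> 1"
    and G_eq: "\<lbrakk>1 \<le> k; k \<le> K\<rbrakk> \<Longrightarrow> G k = lin k + 2 * rho k + slack k"
    and rho_step: "\<lbrakk>1 \<le> k; k \<le> K\<rbrakk> \<Longrightarrow>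
      rho (Suc k) = (1 - 2 * (2 / (real k + 1))) * rho k - 2 / (real k + 1) * (slack k + off k)
        + (2 / (real k + 1))\<^sup>2 / 2 * x k"
    and lin_step: "\<lbrakk>1 \<le> k; k \<le> K\<rbrakk> \<Longrightarrow>
      lin (Suc k) = (1 - 2 / (real k + 1)) * lin k + 2 / (real k + 1) * off k"
    and consecutive: "\<lbrakk>2 \<le> k; k < K\<rbrakk> \<Longrightarrow>
      (real k - 1) * (G (Suc k) - (real k - 1) / (real k + 1) * G k) + x (Suc k)
        + ((real k - 1) / (real k + 1))\<^sup>2 * x k \<le> 1"
begin

text \<open>Once the recursions and \<open>G_eq\<close> are inserted, the four conditions compare
  the coefficients of \<open>rho k\<close>, \<open>lin k\<close>, \<open>slack k\<close> and
  \<open>off k\<close>, all of which are nonnegative. \<open>x k\<close> is kept as it is, because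
  bounding it by 1 here would forfeit the factor 2. The net weight \<open>t\<close> of
  \<open>G k\<close> may be negative.\<close>

lemma linear_combination_step:
  assumes k: "2 \<le> k" "k \<le> K"
    and rho: "a' * (1 - 2 * (2 / (real k + 1))) + 2 * t \<le> a"
    and lin: "b' * (1 - 2 / (real k + 1)) + t \<le> b"
    and slack: "t \<le> 2 / (real k + 1) * a'"
    and off: "b' \<le> a'"
  shows "a' * rho (Suc k) + b' * lin (Suc k)
    \<le> a * rho k + b * lin k + a' * (2 / (real k + 1))\<^sup>2 / 2 * x k - t * G k"
proof -
  define e where "e = 2 / (real k + 1)"
  have e: "e \<ge> 0" unfolding e_def by simp
  have k': "1 \<le> k" using k by simp
  have nn: "0 \<le> rho k" "0 \<le> lin k" "0 \<le> slack k" "0 \<le> off k"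
    using rho_nonneg lin_nonneg slack_nonneg off_nonneg k k' by auto
  have 1: "(a' * (1 - 2 * e) + 2 * t) * rho k \<le> a * rho k"
    using rho nn unfolding e_def by (intro mult_right_mono) auto
  have 2: "(b' * (1 - e) + t) * lin k \<le> b * lin k"
    using lin nn unfolding e_def by (intro mult_right_mono) auto
  have 3: "t * slack k \<le> e * a' * slack k"
    using slack nn unfolding e_def by (intro mult_right_mono) auto
  have 4: "e * b' * off k \<le> e * a' * off k"
    using off nn e by (intro mult_right_mono mult_left_mono) auto
  have "a' * rho (Suc k) + b' * lin (Suc k) + t * G k
     = (a' * (1 - 2 * e) + 2 * t) * rho k + (b' * (1 - e) + t) * lin k
       + (t * slack k - e * a' * slack k) + (e * b' * off k - e * a' * off k)
       + a' * e\<^sup>2 / 2 * x k"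
    unfolding rho_step[OF k' k(2)] lin_step[OF k' k(2)] G_eq[OF k' k(2)] e_def[symmetric]
    by (simp add: algebra_simps)
  also have "\<dots> \<le> a * rho k + b * lin k + a' * e\<^sup>2 / 2 * x k"
    using 1 2 3 4 by linarith
  finally show ?thesis unfolding e_def by linarith
qed

text \<open>One step of a linear programming duality argument: nonnegative combinations of the
  conditions bound a weighted sum \<open>\<Sum> g\<^sub>k G\<^sub>k\<close>; \<open>t\<close> is the net weight of \<open>G\<^sub>k\<close>.\<close>

lemma dual_step:
  assumes k: "2 \<le> k" "k < K"
    and "a' * (1 - 2 * (2 / (real k + 1))) + 2 * t \<le> a"
    and "b' * (1 - 2 / (real k + 1)) + t \<le> b"
    and "t \<le> 2 / (real k + 1) * a'"
    and "b' \<le> a'"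
    and x: "a' * (2 / (real k + 1))\<^sup>2 / 2 \<le> l' * ((real k - 1) / (real k + 1))\<^sup>2 + l"
    and t: "t = g - l * (real k - 2) + l' * (real k - 1) * ((real k - 1) / (real k + 1))"
    and l: "0 \<le> l'"
  shows "a' * rho (Suc k) + b' * lin (Suc k) + l' * (x (Suc k) + (real k - 1) * G (Suc k))
    \<le> a * rho k + b * lin k + l * (x k + (real k - 2) * G k) + l' - g * G k"
proof -
  define q where "q = (real k - 1) / (real k + 1)"
  have kk: "k \<le> K" "1 \<le> k" using k by auto
  have "l' * ((real k - 1) * (G (Suc k) - q * G k) + x (Suc k) + q\<^sup>2 * x k) \<le> l' * 1"
    using consecutive[OF k] l unfolding q_def by (intro mult_left_mono) auto
  moreover have "a' * (2 / (real k + 1))\<^sup>2 / 2 * x k \<le> (l' * q\<^sup>2 + l) * x k"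
    using x x_nonneg[OF kk(2,1)] unfolding q_def by (intro mult_right_mono) auto
  moreover have "a' * rho (Suc k) + b' * lin (Suc k)
    \<le> a * rho k + b * lin k + a' * (2 / (real k + 1))\<^sup>2 / 2 * x k - t * G k"
    by (rule linear_combination_step) (use assms kk in auto)
  ultimately show ?thesis
    unfolding t q_def[symmetric] by (simp add: algebra_simps)
qed

text \<open>What comes after the last gap is discarded through \<open>rho (Suc K) \<ge> 0\<close>,
  with weight 0 on \<open>lin\<close>. No later oracle answer is left to pair \<open>x K\<close>
  with, so \<open>l'\<close> is the multiplier of the crude bound
  \<open>x K \<le> 1\<close>.\<close>

lemma dual_last:
  assumes K: "2 \<le> K"
    and "a' * (1 - 2 * (2 / (real K + 1))) + 2 * (g - l * (real K - 2)) \<le> a"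
    and "g - l * (real K - 2) \<le> b"
    and "g - l * (real K - 2) \<le> 2 / (real K + 1) * a'"
    and a': "0 \<le> a'"
    and x: "a' * (2 / (real K + 1))\<^sup>2 / 2 \<le> l' + l"
    and l': "0 \<le> l'"
  shows "g * G K \<le> a * rho K + b * lin K + l * (x K + (real K - 2) * G K) + l'"
proof -
  define t where "t = g - l * (real K - 2)"
  have "a' * rho (Suc K) + 0 * lin (Suc K)
    \<le> a * rho K + b * lin K + a' * (2 / (real K + 1))\<^sup>2 / 2 * x K - t * G K"
    by (rule linear_combination_step) (use assms in \<open>auto simp: t_def\<close>)
  moreover have "0 \<le> a' * rho (Suc K)" using a' rho_nonneg[of "Suc K"] by simp
  moreover have "a' * (2 / (real K + 1))\<^sup>2 / 2 * x K \<le> (l' + l) * x K"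
    using x x_nonneg[of K] K by (intro mult_right_mono) auto
  moreover have "l' * x K \<le> l' * 1"
    using x_le_1[of K] K l' by (intro mult_left_mono) auto
  ultimately show ?thesis unfolding t_def by (simp add: algebra_simps)
qed

text \<open>The first open-loop step has size 1 and replaces the start by the oracle answer:
  \<open>lin 1\<close> drops out and \<open>rho 1\<close> enters only with a negative sign. So the
  primal gap after it is at most 1/2, whatever the start is.\<close>

lemma dual_first:
  assumes "2 \<le> K" "b \<le> a" "0 \<le> a" "0 \<le> l"
  shows "a * rho 2 + b * lin 2 + l * x 2 \<le> a / 2 + l"
proof -
  have "rho 2 + lin 2 = x 1 / 2 - rho 1 - slack 1"
    using rho_step[of 1] lin_step[of 1] assms(1) by (simp add: numeral_2_eq_2)
  then have "rho 2 + lin 2 \<le> 1 / 2"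
    using x_le_1[of 1] rho_nonneg[of 1] slack_nonneg[of 1] assms(1) by simp
  then have "a * (rho 2 + lin 2) \<le> a * (1 / 2)" using assms(3) by (rule mult_left_mono)
  moreover have "b * lin 2 \<le> a * lin 2"
    using assms lin_nonneg[of 2] by (intro mult_right_mono) auto
  moreover have "l * x 2 \<le> l * 1" using assms x_le_1[of 2] by (intro mult_left_mono) auto
  ultimately show ?thesis by (simp add: algebra_simps)
qed

lemma G_nonneg: "\<lbrakk>1 \<le> k; k \<le> K\<rbrakk> \<Longrightarrow> 0 \<le> G k"
  using G_eq[of k] lin_nonneg[of k] rho_nonneg[of k] slack_nonneg[of k] by simp

text \<open>The weights of the three phases solve the conditions of \<open>dual_step\<close> (almost) with equality. The
  first controls the primal gap, the second lets the weight of \<open>rho\<close> grow faster than that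
  of \<open>lin\<close>, and in the third the gaps themselves are collected.\<close>

lemma phase_one:
  assumes "2 \<le> k" "k \<le> K"
  shows "((real k - 1)\<^sup>2 + 1) * (rho k + lin k) + x k + (real k - 2) * G k \<le> real k"
  using assms
proof (induction k rule: nat_induct_at_least)
  case base
  show ?case using dual_first[of 2 2 1] base by simp
next
  case (Suc k)
  define s where "s = real k - 2"
  have k: "real k = s + 2" and s: "0 \<le> s" using Suc.hyps unfolding s_def by auto
  have pos: "0 \<le> s * s" "0 \<le> s * (s * s)" using s by auto
  have "((real k)\<^sup>2 + 1) * rho (Suc k) + ((real k)\<^sup>2 + 1) * lin (Suc k)
      + 1 * (x (Suc k) + (real k - 1) * G (Suc k))
    \<le> ((real k - 1)\<^sup>2 + 1) * rho k + ((real k - 1)\<^sup>2 + 1) * lin k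
      + 1 * (x k + (real k - 2) * G k) + 1 - 0 * G k"
  proof (rule dual_step[where t = "(3 - real k) / (real k + 1)"])
    have "((real k)\<^sup>2 + 1) * (1 - 2 * (2 / (real k + 1))) + 2 * ((3 - real k) / (real k + 1))
        = (((real k)\<^sup>2 + 1) * (real k - 3) + 2 * (3 - real k)) / (real k + 1)"
      by (simp add: divide_simps)
    also have "\<dots> \<le> (real k - 1)\<^sup>2 + 1"
      using s pos unfolding k by (simp add: pos_divide_le_eq power2_eq_square algebra_simps)
    finally show "((real k)\<^sup>2 + 1) * (1 - 2 * (2 / (real k + 1))) + 2 * ((3 - real k) / (real k + 1))
        \<le> (real k - 1)\<^sup>2 + 1" .
    have "((real k)\<^sup>2 + 1) * (1 - 2 / (real k + 1)) + (3 - real k) / (real k + 1)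
        = (real k - 1)\<^sup>2 + 1"
      by (simp add: divide_simps power2_eq_square) (simp add: algebra_simps)
    then show "((real k)\<^sup>2 + 1) * (1 - 2 / (real k + 1)) + (3 - real k) / (real k + 1)
        \<le> (real k - 1)\<^sup>2 + 1" by simp
    show "(3 - real k) / (real k + 1) \<le> 2 / (real k + 1) * ((real k)\<^sup>2 + 1)"
      using s pos unfolding k by (simp add: field_simps power2_eq_square)
    show "((real k)\<^sup>2 + 1) * (2 / (real k + 1))\<^sup>2 / 2
        \<le> 1 * ((real k - 1) / (real k + 1))\<^sup>2 + 1"
      using s pos unfolding k by (simp add: divide_simps power2_eq_square) (simp add: algebra_simps)
    show "(3 - real k) / (real k + 1)
      = 0 - 1 * (real k - 2) + 1 * (real k - 1) * ((real k - 1) / (real k + 1))"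
      by (simp add: divide_simps) (simp add: algebra_simps)
  qed (use Suc in auto)
  with Suc show ?case by (simp add: algebra_simps)
qed

text \<open>\<open>rho\<close> contracts by 1 - 4/(k+1) per step and \<open>lin\<close> only by 1 -
  2/(k+1); weights of order k^4 for \<open>rho\<close> against k^2 (B - k) for \<open>lin\<close>
  exploit the difference. \<open>B\<close> is still free and is fitted to the third phase later. The
  bound on it keeps the weight of \<open>lin\<close> below that of \<open>rho\<close>, as the
  coefficient of \<open>off\<close> demands. The cubic terms are the sum of the multipliers k (k +
  1).\<close>

lemma phase_two:
  assumes "q \<le> k" "k \<le> K" "2 \<le> q" and B: "B \<le> (real q)\<^sup>2 + 1"
  defines "Q \<equiv> \<lambda>k. (real k - 2) * (real k - 1)\<^sup>2 * real k * rho k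
    + real k * (real k - 1) * (B - real k) * lin k
    + real k * (real k - 1) * (x k + (real k - 2) * G k)"
  shows "Q k \<le> Q q + ((real k - 1) * real k * (real k + 1)
    - (real q - 1) * real q * (real q + 1)) / 3"
  using assms(1,2)
proof (induction k rule: nat_induct_at_least)
  case (Suc k)
  have k: "2 \<le> real k" "real q \<le> real k" using Suc.hyps assms(3) by auto
  have "(real q)\<^sup>2 \<le> (real k)\<^sup>2" using k by (intro power_mono) auto
  then have B': "B - real k - 1 \<le> real k * (real k - 1)"
    using B by (simp add: power2_eq_square algebra_simps)
  have "((real k - 1) * (real k)\<^sup>2 * (real k + 1)) * rho (Suc k)
      + (real k + 1) * real k * (B - real k - 1) * lin (Suc k)
      + (real k + 1) * real k * (x (Suc k) + (real k - 1) * G (Suc k))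
    \<le> (real k - 2) * (real k - 1)\<^sup>2 * real k * rho k
      + real k * (real k - 1) * (B - real k) * lin k
      + real k * (real k - 1) * (x k + (real k - 2) * G k) + (real k + 1) * real k - 0 * G k"
  proof (rule dual_step[where t = "real k * (real k - 1)"])
    show "(real k - 1) * (real k)\<^sup>2 * (real k + 1) * (1 - 2 * (2 / (real k + 1)))
        + 2 * (real k * (real k - 1)) \<le> (real k - 2) * (real k - 1)\<^sup>2 * real k"
      by (simp add: divide_simps power2_eq_square) (simp add: algebra_simps)
    show "(real k + 1) * real k * (B - real k - 1) * (1 - 2 / (real k + 1)) + real k * (real k - 1)
        \<le> real k * (real k - 1) * (B - real k)"
      by (simp add: divide_simps power2_eq_square) (simp add: algebra_simps)
    have "real k * (real k - 1) * 1 \<le> real k * (real k - 1) * (2 * real k)"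
      using k by (intro mult_left_mono) auto
    also have "\<dots> = 2 / (real k + 1) * ((real k - 1) * (real k)\<^sup>2 * (real k + 1))"
      by (simp add: divide_simps power2_eq_square)
    finally show "real k * (real k - 1)
        \<le> 2 / (real k + 1) * ((real k - 1) * (real k)\<^sup>2 * (real k + 1))" by simp
    have "(real k + 1) * real k * (B - real k - 1)
        \<le> (real k + 1) * real k * (real k * (real k - 1))"
      using B' k by (intro mult_left_mono) auto
    then show "(real k + 1) * real k * (B - real k - 1)
        \<le> (real k - 1) * (real k)\<^sup>2 * (real k + 1)"
      by (simp add: power2_eq_square algebra_simps)
    show "(real k - 1) * (real k)\<^sup>2 * (real k + 1) * (2 / (real k + 1))\<^sup>2 / 2
        \<le> (real k + 1) * real k * ((real k - 1) / (real k + 1))\<^sup>2 + real k * (real k - 1)"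
      by (simp add: divide_simps power2_eq_square) (simp add: algebra_simps)
    show "real k * (real k - 1) = 0 - real k * (real k - 1) * (real k - 2)
        + (real k + 1) * real k * (real k - 1) * ((real k - 1) / (real k + 1))"
      by (simp add: divide_simps) (simp add: algebra_simps)
  qed (use Suc assms(3) in auto)
  then have 2: "Q (Suc k) \<le> Q k + (real k + 1) * real k"
    unfolding Q_def by (simp add: algebra_simps)
  have 3: "((real (Suc k) - 1) * real (Suc k) * (real (Suc k) + 1) - w) / 3
      = ((real k - 1) * real k * (real k + 1) - w) / 3 + (real k + 1) * real k" for w
    by (simp add: field_simps)
  have 4: "Q k \<le> Q q + ((real k - 1) * real k * (real k + 1)
      - (real q - 1) * real q * (real q + 1)) / 3" using Suc by simp
  show ?case
    unfolding 3 using order_trans[OF 2 add_right_mono[OF 4]] by (simp only: add.assoc)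
qed simp

text \<open>With weight 1 on \<open>rho\<close>, each step can pay for a net weight of the gap up to
  2 / (k + 1); the two conditions on consecutive steps raise this to 2 / k. The weight of
  \<open>lin\<close> has to shrink meanwhile, and \<open>N\<close> decides where it ends.\<close>

lemma phase_three:
  assumes "m \<le> k" "k \<le> K" "6 \<le> m" "0 \<le> N"
  defines "Q \<equiv> \<lambda>k. rho k + (1 - real k * (real k - 1) / N) * lin k
    + 1 / (real k * (real k - 1)) * (x k + (real k - 2) * G k)"
  shows "Q k + (\<Sum>j=m..<k. 2 / real j * G j) \<le> Q m + 1 / real m - 1 / real k"
  using assms(1,2)
proof (induction k rule: nat_induct_at_least)
  case (Suc k)
  define s where "s = real k - 6"
  have k: "real k = s + 6" and s: "0 \<le> s" using Suc.hyps assms(3) unfolding s_def by auto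
  have pos: "0 \<le> s * s" "0 \<le> s * (s * s)" "0 \<le> s * (s * (s * s))" using s by auto
  define t where "t = 2 / real k - 1 / (real k * (real k - 1)) * (real k - 2)
    + 1 / (real (Suc k) * real k) * (real k - 1) * ((real k - 1) / (real k + 1))"
  have t: "t \<le> 2 / (real k + 1)"
  proof -
    \<comment> \<open>The numerator k^2 - 6 k + 1 is nonnegative from k = 6 on; this is the origin
      of \<open>6 \<le> m\<close>.\<close>
    have "2 / (real k + 1) - t
      = (real k * real k - 6 * real k + 1) / (real k * (real k - 1) * (real k + 1)\<^sup>2)"
      using s unfolding t_def of_nat_Suc k
      by (simp add: divide_simps power2_eq_square) (simp add: algebra_simps)
    also have "\<dots> \<ge> 0"
    proof (rule divide_nonneg_pos)
      show "0 \<le> real k * real k - 6 * real k + 1"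
        using s pos unfolding k by (simp add: algebra_simps)
      show "0 < real k * (real k - 1) * (real k + 1)\<^sup>2"
        using s unfolding k by (intro mult_pos_pos) auto
    qed
    finally show ?thesis by simp
  qed
  have "1 * rho (Suc k) + (1 - real (Suc k) * real k / N) * lin (Suc k)
      + 1 / (real (Suc k) * real k) * (x (Suc k) + (real k - 1) * G (Suc k))
    \<le> 1 * rho k + (1 - real k * (real k - 1) / N) * lin k
      + 1 / (real k * (real k - 1)) * (x k + (real k - 2) * G k)
      + 1 / (real (Suc k) * real k) - 2 / real k * G k"
  proof (rule dual_step[where t = t])
    show "1 * (1 - 2 * (2 / (real k + 1))) + 2 * t \<le> 1" using t by simp
    show "t \<le> 2 / (real k + 1) * 1" using t by simp
    have "real (Suc k) * (1 - 2 / (real k + 1)) = real k - 1" by (simp add: field_simps)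
    then have "real (Suc k) * real k / N * (1 - 2 / (real k + 1)) = real k * (real k - 1) / N"
      by (metis mult.assoc mult.commute times_divide_eq_left)
    moreover have "(1 - p) * (1 - c) + t \<le> 1 - p'" if "p * (1 - c) = p'" "t \<le> c" for p c p' :: real
      using that by (simp add: algebra_simps)
    ultimately show "(1 - real (Suc k) * real k / N) * (1 - 2 / (real k + 1)) + t
        \<le> 1 - real k * (real k - 1) / N"
      using t by blast
    show "1 - real (Suc k) * real k / N \<le> 1" using assms(4) by simp
    show "1 * (2 / (real k + 1))\<^sup>2 / 2
      \<le> 1 / (real (Suc k) * real k) * ((real k - 1) / (real k + 1))\<^sup>2 + 1 / (real k * (real k - 1))"
    proof -
      have "1 / (real (Suc k) * real k) * ((real k - 1) / (real k + 1))\<^sup>2 + 1 / (real k * (real k - 1))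
          - 1 * (2 / (real k + 1))\<^sup>2 / 2
        = 8 / ((real k - 1) * (real k + 1) ^ 3)"
        using s unfolding of_nat_Suc k
        by (simp add: divide_simps power2_eq_square power3_eq_cube) (simp add: algebra_simps)
      also have "\<dots> \<ge> 0" using s unfolding k by (intro divide_nonneg_pos) auto
      finally show ?thesis by simp
    qed
    show "t = 2 / real k - 1 / (real k * (real k - 1)) * (real k - 2)
      + 1 / (real (Suc k) * real k) * (real k - 1) * ((real k - 1) / (real k + 1))"
      by (rule t_def)
  qed (use Suc assms(3) in auto)
  moreover have "1 / (real (Suc k) * real k) = 1 / real k - 1 / real (Suc k)"
    using Suc assms(3) by (simp add: divide_simps)
  moreover have "(\<Sum>j=m..<Suc k. 2 / real j * G j) = (\<Sum>j=m..<k. 2 / real j * G j) + 2 / real k * G k"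
    using Suc by simp
  moreover have "Q k + (\<Sum>j=m..<k. 2 / real j * G j) \<le> Q m + 1 / real m - 1 / real k"
    using Suc by simp
  moreover have "real (Suc k) - 1 = real k" "real (Suc k) - 2 = real k - 1" by auto
  ultimately show ?case unfolding Q_def by (simp only:)
qed simp

text \<open>The weights must fit where the phases meet. \<open>N\<close> makes the weight of
  \<open>lin\<close> at \<open>K\<close> equal to 2 / (K + 1), as \<open>dual_last\<close> wants it;
  \<open>B\<close> makes the ratio of the weights of \<open>lin\<close> and \<open>rho\<close> at
  \<open>m\<close> the same in the second and third phase; \<open>s\<close> scales the first phase
  so that it dominates the second at \<open>q\<close>.\<close>

lemma three_phases:
  assumes q: "2 \<le> q" "q \<le> m" and m: "6 \<le> m" "m \<le> K"
    and N: "N = real K * (real K + 1)"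
    and B: "B = real m + (1 - real m * (real m - 1) / N) * (real m - 1) * (real m - 2)"
    and Bq: "B \<le> (real q)\<^sup>2 + 1"
    and s1: "real q * (real q - 1) \<le> s"
    and s2: "real q * (real q - 1) * (B - real q) \<le> s * ((real q - 1)\<^sup>2 + 1)"
  shows "(\<Sum>j=m..<K. 2 / real j * G j)
      + (2 / (real K + 1) + (real K - 2) / (real K * (real K - 1))) * G K
    \<le> (s * real q + ((real m - 1) * real m * (real m + 1)
            - (real q - 1) * real q * (real q + 1)) / 3)
          / ((real m - 2) * (real m - 1)\<^sup>2 * real m)
      + 1 / real m - 1 / real K + 2 / (real K + 1)\<^sup>2 - 1 / (real K * (real K - 1))"
proof -
  have r: "2 \<le> real q" "real q \<le> real m" "6 \<le> real m" "real m \<le> real K" using q m by auto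
  have nn: "0 \<le> rho j" "0 \<le> lin j" "0 \<le> x j" "0 \<le> G j" if "j \<in> {q, m, K}" for j
    using that q m rho_nonneg[of j] lin_nonneg[of j] x_nonneg[of j] G_nonneg[of j] by auto
  have s0: "0 \<le> s" using s1 r by (meson mult_nonneg_nonneg order_trans diff_ge_0_iff_ge one_le_numeral zero_le_numeral)
  let ?Q2 = "\<lambda>k. (real k - 2) * (real k - 1)\<^sup>2 * real k * rho k
    + real k * (real k - 1) * (B - real k) * lin k
    + real k * (real k - 1) * (x k + (real k - 2) * G k)"
  let ?Q3 = "\<lambda>k. rho k + (1 - real k * (real k - 1) / N) * lin k
    + 1 / (real k * (real k - 1)) * (x k + (real k - 2) * G k)"
  define P where "P = ((real q - 1)\<^sup>2 + 1) * (rho q + lin q) + x q + (real q - 2) * G q"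
  have "P \<le> real q" unfolding P_def by (rule phase_one) (use q m in auto)
  then have P: "s * P \<le> s * real q" using s0 by (rule mult_left_mono)
  have "?Q2 q \<le> s * P"
  proof -
    have "(real q - 2) * (real q - 1)\<^sup>2 * real q
        = real q * (real q - 1) * ((real q - 2) * (real q - 1))"
      by (simp add: power2_eq_square)
    also have "\<dots> \<le> real q * (real q - 1) * ((real q - 1)\<^sup>2 + 1)"
      using r by (intro mult_left_mono) (auto simp: power2_eq_square algebra_simps)
    also have "\<dots> \<le> s * ((real q - 1)\<^sup>2 + 1)"
      using s1 by (intro mult_right_mono) auto
    finally have "(real q - 2) * (real q - 1)\<^sup>2 * real q * rho q
        \<le> s * ((real q - 1)\<^sup>2 + 1) * rho q"
      using nn by (intro mult_right_mono) auto
    moreover have "real q * (real q - 1) * (B - real q) * lin q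
        \<le> s * ((real q - 1)\<^sup>2 + 1) * lin q"
      using nn s2 by (intro mult_right_mono) auto
    moreover have "real q * (real q - 1) * (x q + (real q - 2) * G q)
        \<le> s * (x q + (real q - 2) * G q)"
      using nn s1 r by (intro mult_right_mono add_nonneg_nonneg mult_nonneg_nonneg) auto
    ultimately show ?thesis unfolding P_def by (simp add: algebra_simps)
  qed
  moreover have "?Q2 m \<le> ?Q2 q + ((real m - 1) * real m * (real m + 1)
      - (real q - 1) * real q * (real q + 1)) / 3"
    by (rule phase_two) (use q m Bq in auto)
  ultimately have Q2m: "?Q2 m \<le> s * real q + ((real m - 1) * real m * (real m + 1)
      - (real q - 1) * real q * (real q + 1)) / 3" using P by linarith
  define d where "d = (real m - 2) * (real m - 1)\<^sup>2 * real m"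
  have d: "d > 0" unfolding d_def using r by auto
  have "?Q3 m \<le> ?Q2 m / d"
  proof -
    have "real m * (real m - 1) * (B - real m) = d * (1 - real m * (real m - 1) / N)"
      unfolding B d_def by (simp add: power2_eq_square)
    moreover have "d * (1 / (real m * (real m - 1))) = (real m - 2) * (real m - 1)"
      unfolding d_def using r by (simp add: field_simps power2_eq_square)
    moreover have "(real m - 2) * (real m - 1) \<le> real m * (real m - 1)"
      using r by (intro mult_right_mono) auto
    then have "(real m - 2) * (real m - 1) * (x m + (real m - 2) * G m)
        \<le> real m * (real m - 1) * (x m + (real m - 2) * G m)"
      using nn r by (intro mult_right_mono add_nonneg_nonneg mult_nonneg_nonneg) auto
    ultimately have "d * ?Q3 m \<le> ?Q2 m"
      unfolding d_def[symmetric] distrib_left mult.assoc[symmetric] by simp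
    then show ?thesis using d by (simp add: pos_le_divide_eq mult.commute)
  qed
  also have "\<dots> \<le> (s * real q + ((real m - 1) * real m * (real m + 1)
      - (real q - 1) * real q * (real q + 1)) / 3) / d"
    using Q2m d by (intro divide_right_mono) auto
  finally have Q3m: "?Q3 m \<le> \<dots>" .
  have Q3K: "?Q3 K + (\<Sum>j=m..<K. 2 / real j * G j) \<le> ?Q3 m + 1 / real m - 1 / real K"
    by (rule phase_three) (use m N in auto)
  have b: "1 - real K * (real K - 1) / N = 2 / (real K + 1)"
    unfolding N using r by (simp add: divide_simps)
  have "(2 / (real K + 1) + (real K - 2) / (real K * (real K - 1))) * G K
    \<le> 1 * rho K + 2 / (real K + 1) * lin K
      + 1 / (real K * (real K - 1)) * (x K + (real K - 2) * G K)
      + (2 / (real K + 1)\<^sup>2 - 1 / (real K * (real K - 1)))"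
  proof (rule dual_last[where a' = 1])
    have "2 / (real K + 1)\<^sup>2 - 1 / (real K * (real K - 1))
      = ((real K)\<^sup>2 - 4 * real K - 1) / ((real K + 1)\<^sup>2 * (real K * (real K - 1)))"
      using r by (simp add: divide_simps power2_eq_square) (simp add: algebra_simps)
    moreover have "6 * real K \<le> (real K)\<^sup>2"
      unfolding power2_eq_square using r by (intro mult_right_mono) auto
    ultimately show "0 \<le> 2 / (real K + 1)\<^sup>2 - 1 / (real K * (real K - 1))"
      using r by (auto intro!: divide_nonneg_nonneg)
  qed (use m in \<open>auto simp: power2_eq_square\<close>)
  with Q3m Q3K show ?thesis unfolding d_def b by linarith
qed

text \<open>The multipliers for the small cases are numerical solutions of the dual linear program,
  rounded to integers.\<close>

lemma gap_sum_3:
  assumes "K = 3"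
  shows "12 * G 2 + 17 * G 3 \<le> 9 + 10"
proof -
  have "18 * rho 2 + 18 * lin 2 + 6 * x 2 \<le> 18 / 2 + 6"
    by (rule dual_first) (use assms in auto)
  moreover have "26 * rho (Suc 2) + 13 * lin (Suc 2) + 4 * (x (Suc 2) + (real 2 - 1) * G (Suc 2))
    \<le> 18 * rho 2 + 18 * lin 2 + 6 * (x 2 + (real 2 - 2) * G 2) + 4 - 12 * G 2"
    by (rule dual_step[where t = "40/3"]) (use assms in \<open>auto simp: power2_eq_square\<close>)
  moreover have "17 * G K \<le> 26 * rho K + 13 * lin K + 4 * (x K + (real K - 2) * G K) + 0"
    by (rule dual_last[where a' = 27]) (use assms in \<open>auto simp: power2_eq_square\<close>)
  ultimately show ?thesis
    using assms by (simp add: eval_nat_numeral)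
qed

lemma gap_sum_4:
  assumes "K = 4"
  shows "14 * G 3 + 35 * G 4 \<le> 5 + 1 / 2 + 18"
proof -
  have "11 * rho 2 + 11 * lin 2 + 5 * x 2 \<le> 11 / 2 + 5"
    by (rule dual_first) (use assms in auto)
  moreover have "26 * rho (Suc 2) + 25 * lin (Suc 2) + 7 * (x (Suc 2) + (real 2 - 1) * G (Suc 2))
    \<le> 11 * rho 2 + 11 * lin 2 + 5 * (x 2 + (real 2 - 2) * G 2) + 7 - 0 * G 2"
    by (rule dual_step[where t = "7/3"]) (use assms in \<open>auto simp: power2_eq_square\<close>)
  moreover have "59 * rho (Suc 3) + 23 * lin (Suc 3) + 6 * (x (Suc 3) + (real 3 - 1) * G (Suc 3))
    \<le> 26 * rho 3 + 25 * lin 3 + 7 * (x 3 + (real 3 - 2) * G 3) + 6 - 14 * G 3"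
    by (rule dual_step[where t = "13"]) (use assms in \<open>auto simp: power2_eq_square\<close>)
  moreover have "35 * G K \<le> 59 * rho K + 23 * lin K + 6 * (x K + (real K - 2) * G K) + 0"
    by (rule dual_last[where a' = 63]) (use assms in \<open>auto simp: power2_eq_square\<close>)
  ultimately show ?thesis
    using assms by (simp add: eval_nat_numeral)
qed

lemma gap_sum_5:
  assumes "K = 5"
  shows "1 * G 4 + 48 * G 5 \<le> 2 + 1 / 2 + 17"
proof -
  have "5 * rho 2 + 5 * lin 2 + 4 * x 2 \<le> 5 / 2 + 4"
    by (rule dual_first) (use assms in auto)
  moreover have "14 * rho (Suc 2) + 14 * lin (Suc 2) + 1 * (x (Suc 2) + (real 2 - 1) * G (Suc 2))
    \<le> 5 * rho 2 + 5 * lin 2 + 4 * (x 2 + (real 2 - 2) * G 2) + 1 - 0 * G 2"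
    by (rule dual_step[where t = "1/3"]) (use assms in \<open>auto simp: power2_eq_square\<close>)
  moreover have "18 * rho (Suc 3) + 18 * lin (Suc 3) + 6 * (x (Suc 3) + (real 3 - 1) * G (Suc 3))
    \<le> 14 * rho 3 + 14 * lin 3 + 1 * (x 3 + (real 3 - 2) * G 3) + 6 - 0 * G 3"
    by (rule dual_step[where t = "5"]) (use assms in \<open>auto simp: power2_eq_square\<close>)
  moreover have "92 * rho (Suc 4) + 30 * lin (Suc 4) + 6 * (x (Suc 4) + (real 4 - 1) * G (Suc 4))
    \<le> 18 * rho 4 + 18 * lin 4 + 6 * (x 4 + (real 4 - 2) * G 4) + 6 - 1 * G 4"
    by (rule dual_step[where t = "- 1/5"]) (use assms in \<open>auto simp: power2_eq_square\<close>)
  moreover have "48 * G K \<le> 92 * rho K + 30 * lin K + 6 * (x K + (real K - 2) * G K) + 0"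
    by (rule dual_last[where a' = 96]) (use assms in \<open>auto simp: power2_eq_square\<close>)
  ultimately show ?thesis
    using assms by (simp add: eval_nat_numeral)
qed

lemma gap_sum_6:
  assumes "K = 6"
  shows "18 * G 4 + 31 * G 5 + 46 * G 6 \<le> 5 + 26"
proof -
  have "10 * rho 2 + 10 * lin 2 + 6 * x 2 \<le> 10 / 2 + 6"
    by (rule dual_first) (use assms in auto)
  moreover have "24 * rho (Suc 2) + 24 * lin (Suc 2) + 4 * (x (Suc 2) + (real 2 - 1) * G (Suc 2))
    \<le> 10 * rho 2 + 10 * lin 2 + 6 * (x 2 + (real 2 - 2) * G 2) + 4 - 0 * G 2"
    by (rule dual_step[where t = "4/3"]) (use assms in \<open>auto simp: power2_eq_square\<close>)
  moreover have "42 * rho (Suc 3) + 42 * lin (Suc 3) + 7 * (x (Suc 3) + (real 3 - 1) * G (Suc 3))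
    \<le> 24 * rho 3 + 24 * lin 3 + 4 * (x 3 + (real 3 - 2) * G 3) + 7 - 0 * G 3"
    by (rule dual_step[where t = "3"]) (use assms in \<open>auto simp: power2_eq_square\<close>)
  moreover have "97 * rho (Suc 4) + 50 * lin (Suc 4) + 4 * (x (Suc 4) + (real 4 - 1) * G (Suc 4))
    \<le> 42 * rho 4 + 42 * lin 4 + 7 * (x 4 + (real 4 - 2) * G 4) + 4 - 18 * G 4"
    by (rule dual_step[where t = "56/5"]) (use assms in \<open>auto simp: power2_eq_square\<close>)
  moreover have "97 * rho (Suc 5) + 26 * lin (Suc 5) + 5 * (x (Suc 5) + (real 5 - 1) * G (Suc 5))
    \<le> 97 * rho 5 + 50 * lin 5 + 4 * (x 5 + (real 5 - 2) * G 5) + 5 - 31 * G 5"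
    by (rule dual_step[where t = "97/3"]) (use assms in \<open>auto simp: power2_eq_square\<close>)
  moreover have "46 * G K \<le> 97 * rho K + 26 * lin K + 5 * (x K + (real K - 2) * G K) + 0"
    by (rule dual_last[where a' = 103]) (use assms in \<open>auto simp: power2_eq_square\<close>)
  ultimately show ?thesis
    using assms by (simp add: eval_nat_numeral)
qed

lemma gap_sum_7:
  assumes "K = 7"
  shows "29 * G 5 + 189 * G 6 + 280 * G 7 \<le> 14 + 1 / 2 + 109"
proof -
  have "29 * rho 2 + 29 * lin 2 + 13 * x 2 \<le> 29 / 2 + 13"
    by (rule dual_first) (use assms in auto)
  moreover have "67 * rho (Suc 2) + 67 * lin (Suc 2) + 20 * (x (Suc 2) + (real 2 - 1) * G (Suc 2))
    \<le> 29 * rho 2 + 29 * lin 2 + 13 * (x 2 + (real 2 - 2) * G 2) + 20 - 0 * G 2"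
    by (rule dual_step[where t = "20/3"]) (use assms in \<open>auto simp: power2_eq_square\<close>)
  moreover have "164 * rho (Suc 3) + 164 * lin (Suc 3) + 5 * (x (Suc 3) + (real 3 - 1) * G (Suc 3))
    \<le> 67 * rho 3 + 67 * lin 3 + 20 * (x 3 + (real 3 - 2) * G 3) + 5 - 0 * G 3"
    by (rule dual_step[where t = "- 15"]) (use assms in \<open>auto simp: power2_eq_square\<close>)
  moreover have "197 * rho (Suc 4) + 196 * lin (Suc 4) + 31 * (x (Suc 4) + (real 4 - 1) * G (Suc 4))
    \<le> 164 * rho 4 + 164 * lin 4 + 5 * (x 4 + (real 4 - 2) * G 4) + 31 - 0 * G 4"
    by (rule dual_step[where t = "229/5"]) (use assms in \<open>auto simp: power2_eq_square\<close>)
  moreover have "686 * rho (Suc 5) + 317 * lin (Suc 5) + 18 * (x (Suc 5) + (real 5 - 1) * G (Suc 5))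
    \<le> 197 * rho 5 + 196 * lin 5 + 31 * (x 5 + (real 5 - 2) * G 5) + 18 - 29 * G 5"
    by (rule dual_step[where t = "- 16"]) (use assms in \<open>auto simp: power2_eq_square\<close>)
  moreover have "686 * rho (Suc 6) + 170 * lin (Suc 6) + 22 * (x (Suc 6) + (real 6 - 1) * G (Suc 6))
    \<le> 686 * rho 6 + 317 * lin 6 + 18 * (x 6 + (real 6 - 2) * G 6) + 22 - 189 * G 6"
    by (rule dual_step[where t = "1369/7"]) (use assms in \<open>auto simp: power2_eq_square\<close>)
  moreover have "280 * G K \<le> 686 * rho K + 170 * lin K + 22 * (x K + (real K - 2) * G K) + 0"
    by (rule dual_last[where a' = 691]) (use assms in \<open>auto simp: power2_eq_square\<close>)
  ultimately show ?thesis
    using assms by (simp add: eval_nat_numeral)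
qed


lemma three_phases_contradiction:
  assumes G: "\<And>k. \<lbrakk>1 \<le> k; k \<le> K\<rbrakk> \<Longrightarrow> d < G k"
    and N: "N = real K * (real K + 1)"
    and B: "B = real m + (1 - real m * (real m - 1) / N) * (real m - 1) * (real m - 2)"
    and q: "2 \<le> q" "q \<le> m" and m: "6 \<le> m" "m \<le> K"
    and "B \<le> (real q)\<^sup>2 + 1"
    and "real q * (real q - 1) \<le> s"
    and "real q * (real q - 1) * (B - real q) \<le> s * ((real q - 1)\<^sup>2 + 1)"
    and bound: "(s * real q + ((real m - 1) * real m * (real m + 1)
            - (real q - 1) * real q * (real q + 1)) / 3)
          / ((real m - 2) * (real m - 1)\<^sup>2 * real m)
      + 1 / real m - 1 / real K + 2 / (real K + 1)\<^sup>2 - 1 / (real K * (real K - 1))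
      \<le> d * ((\<Sum>j=m..<K. 2 / real j) + (2 / (real K + 1) + (real K - 2) / (real K * (real K - 1))))"
  shows False
proof -
  define w where "w = 2 / (real K + 1) + (real K - 2) / (real K * (real K - 1))"
  have w: "0 < w" unfolding w_def using m by (intro add_pos_nonneg divide_nonneg_nonneg) auto
  have "(\<Sum>j=m..<K. 2 / real j) * d + w * d = d * ((\<Sum>j=m..<K. 2 / real j) + w)"
    by (simp add: algebra_simps)
  moreover have "(\<Sum>j=m..<K. 2 / real j) * d \<le> (\<Sum>j=m..<K. 2 / real j * G j)"
    unfolding sum_distrib_right using G m by (intro sum_mono mult_left_mono less_imp_le) auto
  moreover have "w * d < w * G K" using G[of K] m w by (intro mult_strict_left_mono) auto
  moreover have "(\<Sum>j=m..<K. 2 / real j * G j) + w * G K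
      \<le> d * ((\<Sum>j=m..<K. 2 / real j) + w)"
    unfolding w_def by (rule order_trans[OF three_phases[OF q m N B assms(8-10)] bound])
  ultimately show False by linarith
qed

end

section \<open>The open-loop bound for all run lengths\<close>

lemma open_loop_recursion_mono:
  assumes "open_loop_recursion K rho lin slack off x G" "K' \<le> K"
  shows "open_loop_recursion K' rho lin slack off x G"
  using assms unfolding open_loop_recursion_def by auto

text \<open>By convexity 2 / j lies above its tangent at the midpoint 5 n of the range, and the
  tangent is summed exactly. The sum tends to 2 ln(3/2), about 0.811, so little is lost.\<close>

lemma sum_inverse_ge:
  assumes "0 < n"
  shows "4 / 5 \<le> (\<Sum>j=4*n..<6*n. 2 / real j)"
proof -
  have "(\<Sum>j=a..<a+c. real j) = real c * real a + real c * (real c - 1) / 2" for a c :: nat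
    by (induction c) (auto simp: field_simps)
  from this[of "4*n" "2*n"] have s: "(\<Sum>j=4*n..<6*n. real j) = real n * (10 * real n - 1)"
    by (simp add: field_simps)
  have n: "0 < real n" using assms by simp
  have "4 / 5 \<le> 8 / 5 - 2 * (real n * (10 * real n - 1)) / (25 * (real n)\<^sup>2)"
    using n by (simp add: divide_simps power2_eq_square)
  also have "\<dots> = (\<Sum>j=4*n..<6*n. 4 / (5 * real n) - 2 * real j / (25 * (real n)\<^sup>2))"
    using n by (simp add: sum_subtractf s sum_divide_distrib[symmetric] sum_distrib_left[symmetric])
  also have "\<dots> \<le> (\<Sum>j=4*n..<6*n. 2 / real j)"
  proof (rule sum_mono)
    fix j assume "j \<in> {4*n..<6*n}"
    then have j: "0 < real j" using assms by auto
    have "2 / real j - (4 / (5 * real n) - 2 * real j / (25 * (real n)\<^sup>2))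
      = 2 * (5 * real n - real j)\<^sup>2 / (25 * (real n)\<^sup>2 * real j)"
      using n j by (simp add: divide_simps power2_eq_square) (simp add: algebra_simps)
    also have "\<dots> \<ge> 0" using j by simp
    finally show "4 / (5 * real n) - 2 * real j / (25 * (real n)\<^sup>2) \<le> 2 / real j" by simp
  qed
  finally show ?thesis .
qed

text \<open>The minimum over the first \<open>K'\<close> gaps bounds that over the first \<open>K\<close>, and the constant obtained for
  \<open>K'\<close> is below 2, so each \<open>K'\<close> also serves some \<open>K > K'\<close>. The ends \<open>q\<close> and \<open>m\<close> of the first two
  phases are optimized numerically.\<close>

lemma open_loop_medium:
  assumes rec: "open_loop_recursion K rho lin slack off x G" and K: "9 \<le> K" "K < 60"
    and G: "\<And>k. \<lbrakk>1 \<le> k; k \<le> K\<rbrakk> \<Longrightarrow> 2 / real K < G k"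
  shows False
proof -
  have reduce: "open_loop_recursion K' rho lin slack off x G"
    "\<And>k. \<lbrakk>1 \<le> k; k \<le> K'\<rbrakk> \<Longrightarrow> 2 / real M < G k" if "K' \<le> K" "K \<le> M" for K' M
  proof -
    show "open_loop_recursion K' rho lin slack off x G"
      by (rule open_loop_recursion_mono[OF rec that(1)])
    fix k assume "1 \<le> k" "k \<le> K'"
    then have "2 / real K < G k" using G that by auto
    moreover have "2 / real M \<le> 2 / real K" using that K by (simp add: frac_le)
    ultimately show "2 / real M < G k" by simp
  qed
  note eval = atLeastLessThan_upt sum.distinct_set_conv_list power2_eq_square
  \<comment> \<open>Here and below, \<open>s\<close> is the smallest value that its two conditions
    allow for the chosen \<open>q\<close> and \<open>m\<close>.\<close>
  have 9: "9 < K"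
  proof (rule ccontr)
    assume "\<not> 9 < K"
    then have le: "9 \<le> K" "K \<le> 9" using K by auto
    show False
      by (rule open_loop_recursion.three_phases_contradiction[OF reduce(1)[OF le] reduce(2)[OF le]
            refl refl, where q = 5 and m = 7 and s = "360/17"]) (simp_all add: eval)
  qed
  have 10: "10 < K"
  proof (rule ccontr)
    assume "\<not> 10 < K"
    then have le: "10 \<le> K" "K \<le> 10" using 9 by auto
    show False
      by (rule open_loop_recursion.three_phases_contradiction[OF reduce(1)[OF le] reduce(2)[OF le]
            refl refl, where q = 5 and m = 7 and s = "4520/187"]) (simp_all add: eval)
  qed
  have 11: "11 < K"
  proof (rule ccontr)
    assume "\<not> 11 < K"
    then have le: "11 \<le> K" "K \<le> 11" using 10 by auto
    show False
      by (rule open_loop_recursion.three_phases_contradiction[OF reduce(1)[OF le] reduce(2)[OF le]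
            refl refl, where q = 6 and m = 8 and s = "4320/143"]) (simp_all add: eval)
  qed
  have 12: "12 < K"
  proof (rule ccontr)
    assume "\<not> 12 < K"
    then have le: "12 \<le> K" "K \<le> 12" using 11 by auto
    show False
      by (rule open_loop_recursion.three_phases_contradiction[OF reduce(1)[OF le] reduce(2)[OF le]
            refl refl, where q = 6 and m = 8 and s = "5640/169"]) (simp_all add: eval)
  qed
  have 14: "14 < K"
  proof (rule ccontr)
    assume "\<not> 14 < K"
    then have le: "13 \<le> K" "K \<le> 14" using 12 by auto
    show False
      by (rule open_loop_recursion.three_phases_contradiction[OF reduce(1)[OF le] reduce(2)[OF le]
            refl refl, where q = 7 and m = 10 and s = "21510/481"]) (simp_all add: eval)
  qed
  have 16: "16 < K"
  proof (rule ccontr)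
    assume "\<not> 16 < K"
    then have le: "15 \<le> K" "K \<le> 16" using 14 by auto
    show False
      by (rule open_loop_recursion.three_phases_contradiction[OF reduce(1)[OF le] reduce(2)[OF le]
            refl refl, where q = 8 and m = 11 and s = "1449/25"]) (simp_all add: eval)
  qed
  have 18: "18 < K"
  proof (rule ccontr)
    assume "\<not> 18 < K"
    then have le: "17 \<le> K" "K \<le> 18" using 16 by auto
    show False
      by (rule open_loop_recursion.three_phases_contradiction[OF reduce(1)[OF le] reduce(2)[OF le]
            refl refl, where q = 9 and m = 12 and s = "80232/1105"]) (simp_all add: eval)
  qed
  have 20: "20 < K"
  proof (rule ccontr)
    assume "\<not> 20 < K"
    then have le: "19 \<le> K" "K \<le> 20" using 18 by auto
    show False
      by (rule open_loop_recursion.three_phases_contradiction[OF reduce(1)[OF le] reduce(2)[OF le]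
            refl refl, where q = 10 and m = 14 and s = "72918/779"]) (simp_all add: eval)
  qed
  have 23: "23 < K"
  proof (rule ccontr)
    assume "\<not> 23 < K"
    then have le: "21 \<le> K" "K \<le> 23" using 20 by auto
    show False
      by (rule open_loop_recursion.three_phases_contradiction[OF reduce(1)[OF le] reduce(2)[OF le]
            refl refl, where q = 11 and m = 15 and s = "11360/101"]) (simp_all add: eval)
  qed
  have 26: "26 < K"
  proof (rule ccontr)
    assume "\<not> 26 < K"
    then have le: "24 \<le> K" "K \<le> 26" using 23 by auto
    show False
      by (rule open_loop_recursion.three_phases_contradiction[OF reduce(1)[OF le] reduce(2)[OF le]
            refl refl, where q = 12 and m = 16 and s = "8580/61"]) (simp_all add: eval)
  qed
  have 30: "30 < K"
  proof (rule ccontr)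
    assume "\<not> 30 < K"
    then have le: "27 \<le> K" "K \<le> 30" using 26 by auto
    show False
      by (rule open_loop_recursion.three_phases_contradiction[OF reduce(1)[OF le] reduce(2)[OF le]
            refl refl, where q = 14 and m = 19 and s = "15704/85"]) (simp_all add: eval)
  qed
  have 34: "34 < K"
  proof (rule ccontr)
    assume "\<not> 34 < K"
    then have le: "31 \<le> K" "K \<le> 34" using 30 by auto
    show False
      by (rule open_loop_recursion.three_phases_contradiction[OF reduce(1)[OF le] reduce(2)[OF le]
            refl refl, where q = 16 and m = 22 and s = "857070/3503"]) (simp_all add: eval)
  qed
  have 39: "39 < K"
  proof (rule ccontr)
    assume "\<not> 39 < K"
    then have le: "35 \<le> K" "K \<le> 39" using 34 by auto
    show False
      by (rule open_loop_recursion.three_phases_contradiction[OF reduce(1)[OF le] reduce(2)[OF le]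
            refl refl, where q = 18 and m = 24 and s = "1554684/5075"]) (simp_all add: eval)
  qed
  have 45: "45 < K"
  proof (rule ccontr)
    assume "\<not> 45 < K"
    then have le: "40 \<le> K" "K \<le> 45" using 39 by auto
    show False
      by (rule open_loop_recursion.three_phases_contradiction[OF reduce(1)[OF le] reduce(2)[OF le]
            refl refl, where q = 20 and m = 27 and s = "2950605/7421"]) (simp_all add: eval)
  qed
  have 52: "52 < K"
  proof (rule ccontr)
    assume "\<not> 52 < K"
    then have le: "46 \<le> K" "K \<le> 52" using 45 by auto
    show False
      by (rule open_loop_recursion.three_phases_contradiction[OF reduce(1)[OF le] reduce(2)[OF le]
            refl refl, where q = 23 and m = 31 and s = "11980496/22795"]) (simp_all add: eval)
  qed
  have 59: "59 < K"
  proof (rule ccontr)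
    assume "\<not> 59 < K"
    then have le: "53 \<le> K" "K \<le> 59" using 52 by auto
    show False
      by (rule open_loop_recursion.three_phases_contradiction[OF reduce(1)[OF le] reduce(2)[OF le]
            refl refl, where q = 27 and m = 36 and s = "702"]) (simp_all add: eval)
  qed
  then show False using K by simp
qed

text \<open>The run is cut to 6 n iterations with phases ending at 3 n and 4 n, so that all weights
  are rational functions of n. As \<open>K\<close> can be as large as 6 n + 5, only the threshold 2
  / (6 n + 5) is available; n \<ge> 10 makes this loss and the lower-order terms affordable.\<close>

lemma open_loop_large:
  assumes rec: "open_loop_recursion K rho lin slack off x G" and K: "60 \<le> K"
    and G: "\<And>k. \<lbrakk>1 \<le> k; k \<le> K\<rbrakk> \<Longrightarrow> 2 / real K < G k"
  shows False
proof -
  define n where "n = K div 6"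
  define r where "r = real n"
  have n: "10 \<le> n" "6 * n \<le> K" "K \<le> 6 * n + 5" using K unfolding n_def by auto
  have r: "10 \<le> r" using n unfolding r_def by simp
  define u where "u = r - 10"
  have u: "r = u + 10" "0 \<le> u" using r unfolding u_def by auto
  have pos: "0 \<le> u * u" "0 \<le> u * (u * u)" "0 \<le> u * (u * (u * u))" using u by auto
  have cast: "real (6 * n) = 6 * r" "real (4 * n) = 4 * r" "real (3 * n) = 3 * r"
    unfolding r_def by auto
  have d: "2 / (6 * r + 5) \<le> 2 / real K"
  proof -
    have "real K \<le> 6 * r + 5" using n(3) unfolding r_def by linarith
    then show ?thesis using K by (intro divide_left_mono) auto
  qed
  define B where "B = 4 * r + (1 - 4 * r * (4 * r - 1) / (6 * r * (6 * r + 1))) * (4 * r - 1) * (4 * r - 2)"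
  have B: "B \<le> 9 * r\<^sup>2"
  proof -
    have "1 - 4 * r * (4 * r - 1) / (6 * r * (6 * r + 1)) = (10 * r + 5) / (18 * r + 3)"
      using r by (simp add: divide_simps) (simp add: algebra_simps)
    then have "B = (160 * r ^ 3 + 32 * r\<^sup>2 - 28 * r + 10) / (18 * r + 3)"
      unfolding B_def using r
      by (simp add: divide_simps power2_eq_square power3_eq_cube) (simp add: algebra_simps)
    also have "\<dots> \<le> 9 * r\<^sup>2"
      using u(2) pos unfolding u(1)
      by (simp add: pos_divide_le_eq power2_eq_square power3_eq_cube algebra_simps)
    finally show ?thesis .
  qed
  show False
  proof (rule open_loop_recursion.three_phases_contradiction[where q = "3 * n" and m = "4 * n"
        and K = "6 * n" and d = "2 / (6 * r + 5)" and s = "9 * r\<^sup>2" and B = B,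
        OF open_loop_recursion_mono[OF rec n(2)] _ refl])
    show "2 / (6 * r + 5) < G k" if "1 \<le> k" "k \<le> 6 * n" for k
      using G[of k] that n(2) d by auto
    \<comment> \<open>The leading term is 27 r^3 + (64 - 27) r^3 / 3 = (118 / 3) r^3 over about 256
      r^4. The factors 38/10 and 39/10 bound 4 r - 2 and 4 r - 1 from below for
      \<open>r \<ge> 10\<close>.\<close>
    have T1: "(9 * r\<^sup>2 * (3 * r) + ((4 * r - 1) * (4 * r) * (4 * r + 1)
            - (3 * r - 1) * (3 * r) * (3 * r + 1)) / 3)
          / ((4 * r - 2) * (4 * r - 1)\<^sup>2 * (4 * r)) \<le> 1702 / 10000 / r" (is "?n / ?d \<le> _")
    proof -
      have "38 / 10 * r * (39 / 10 * r)\<^sup>2 * (4 * r) \<le> ?d"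
        using r by (intro mult_mono power_mono mult_nonneg_nonneg zero_le_power) auto
      moreover have "?n \<le> 118 / 3 * r ^ 3"
        using r by (simp add: power2_eq_square power3_eq_cube algebra_simps)
      ultimately have "?n / ?d \<le> (118 / 3 * r ^ 3) / (38 / 10 * r * (39 / 10 * r)\<^sup>2 * (4 * r))"
        using r by (intro frac_le mult_pos_pos) auto
      also have "\<dots> \<le> 1702 / 10000 / r"
        using r by (simp add: divide_simps power2_eq_square power3_eq_cube)
      finally show ?thesis .
    qed
    have T3: "2 / (6 * r + 1)\<^sup>2 - 1 / (6 * r * (6 * r - 1)) \<le> 28 / 10000 / r"
    proof -
      have "2 / (6 * r + 1)\<^sup>2 \<le> 2 / (6 * r)\<^sup>2"
        using r by (intro divide_left_mono power_mono) auto
      moreover have "1 / (6 * r)\<^sup>2 \<le> 1 / (6 * r * (6 * r - 1))"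
        using r by (intro divide_left_mono) (auto simp: power2_eq_square algebra_simps)
      moreover have "1 / (6 * r)\<^sup>2 \<le> 28 / 10000 / r"
        using r by (simp add: divide_simps power2_eq_square)
      ultimately show ?thesis by simp
    qed
    have T4: "49 / 100 / r \<le> 2 / (6 * r + 1) + (6 * r - 2) / (6 * r * (6 * r - 1))"
    proof -
      have "327 / 1000 / r \<le> 2 / (6 * r + 1)" using r by (simp add: divide_simps)
      moreover have "163 / 1000 / r \<le> (6 * r - 2) / (6 * r * (6 * r - 1))"
        using r by (simp add: divide_simps)
      ultimately show ?thesis by simp
    qed
    have T5: "1702 / 10000 / r + 1 / (4 * r) - 1 / (6 * r) + 28 / 10000 / r
        \<le> 2 / (6 * r + 5) * (4 / 5 + 49 / 100 / r)"
      using r by (simp add: divide_simps)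
    show "(9 * r\<^sup>2 * real (3 * n) + ((real (4 * n) - 1) * real (4 * n) * (real (4 * n) + 1)
            - (real (3 * n) - 1) * real (3 * n) * (real (3 * n) + 1)) / 3)
          / ((real (4 * n) - 2) * (real (4 * n) - 1)\<^sup>2 * real (4 * n))
      + 1 / real (4 * n) - 1 / real (6 * n) + 2 / (real (6 * n) + 1)\<^sup>2
      - 1 / (real (6 * n) * (real (6 * n) - 1))
      \<le> 2 / (6 * r + 5) * ((\<Sum>j=4*n..<6*n. 2 / real j)
        + (2 / (real (6 * n) + 1) + (real (6 * n) - 2) / (real (6 * n) * (real (6 * n) - 1))))"
    proof -
      have "2 / (6 * r + 5) * (4 / 5 + 49 / 100 / r)
        \<le> 2 / (6 * r + 5) * ((\<Sum>j=4*n..<6*n. 2 / real j)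
          + (2 / (6 * r + 1) + (6 * r - 2) / (6 * r * (6 * r - 1))))"
        using sum_inverse_ge[of n] n T4 r by (intro mult_left_mono add_mono) auto
      then show ?thesis unfolding cast using T1 T3 T5 by linarith
    qed
    show "B \<le> (real (3 * n))\<^sup>2 + 1" unfolding cast using B by (simp add: power2_eq_square)
    have "3 * r * (3 * r - 1) * (B - 3 * r) \<le> 3 * r * (3 * r - 1) * (9 * r\<^sup>2 - 3 * r)"
      using B r by (intro mult_left_mono) auto
    also have "\<dots> = 9 * r\<^sup>2 * (3 * r - 1)\<^sup>2" by (simp add: power2_eq_square algebra_simps)
    also have "\<dots> \<le> 9 * r\<^sup>2 * ((3 * r - 1)\<^sup>2 + 1)" by (intro mult_left_mono) auto
    finally show "real (3 * n) * (real (3 * n) - 1) * (B - real (3 * n))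
        \<le> 9 * r\<^sup>2 * ((real (3 * n) - 1)\<^sup>2 + 1)"
      unfolding cast .
    show "real (3 * n) * (real (3 * n) - 1) \<le> 9 * r\<^sup>2"
      unfolding cast using r by (simp add: power2_eq_square algebra_simps)
    show "B = real (4 * n) + (1 - real (4 * n) * (real (4 * n) - 1) / (real (6 * n) * (real (6 * n) + 1)))
        * (real (4 * n) - 1) * (real (4 * n) - 2)"
      unfolding cast B_def ..
  qed (use n in auto)
qed

theorem open_loop_gap:
  assumes rec: "open_loop_recursion K rho lin slack off x G" and K: "3 \<le> K"
  shows "\<exists>k\<in>{1..K}. G k \<le> 2 / real K"
proof (rule ccontr)
  assume "\<not> ?thesis"
  then have G: "2 / real K < G k" if "1 \<le> k" "k \<le> K" for k
    using that by force
  consider "K = 3" | "K = 4" | "K = 5" | "K = 6" | "K = 7" | "K = 8" | "9 \<le> K" "K < 60" | "60 \<le> K"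
    using K by linarith
  then show False
  proof cases
    case 1
    then show False using open_loop_recursion.gap_sum_3[OF rec] G[of 2] G[of 3] by simp
  next
    case 2
    then show False using open_loop_recursion.gap_sum_4[OF rec] G[of 3] G[of 4] by simp
  next
    case 3
    then show False using open_loop_recursion.gap_sum_5[OF rec] G[of 4] G[of 5] by simp
  next
    case 4
    then show False using open_loop_recursion.gap_sum_6[OF rec] G[of 4] G[of 5] G[of 6] by simp
  next
    case 5
    then show False using open_loop_recursion.gap_sum_7[OF rec] G[of 5] G[of 6] G[of 7] by simp
  next
    case 6
    \<comment> \<open>For eight iterations the combination for seven is enough: 123.5 / 498 lies
      below 1/4.\<close>
    then have "open_loop_recursion 7 rho lin slack off x G"
      by (intro open_loop_recursion_mono[OF rec]) simp
    from open_loop_recursion.gap_sum_7[OF this] 6 show False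
      using G[of 5] G[of 6] G[of 7] by simp
  next
    case 7
    then show False using open_loop_medium[OF rec] G by blast
  next
    case 8
    then show False using open_loop_large[OF rec] G by blast
  qed
qed

section \<open>Short steps and exact line search: a growing potential\<close>

text \<open>The scalars of a run with the short step (equivalently, exact line search), again on a set of
  diameter 1; \<open>h\<close> is the primal gap. A value \<open>x k \<le> G k\<close> means a full step.\<close>

locale short_step_recursion =
  fixes K :: nat and h G x :: "nat \<Rightarrow> real"
  assumes h_nonneg: "\<lbrakk>2 \<le> k; k \<le> Suc K\<rbrakk> \<Longrightarrow> 0 \<le> h k"
    and h_start: "h 2 \<le> 1 / 2"
    and h_le_G: "\<lbrakk>2 \<le> k; k \<le> K\<rbrakk> \<Longrightarrow> h k \<le> G k"
    and x_pos: "\<lbrakk>2 \<le> k; k \<le> K\<rbrakk> \<Longrightarrow> 0 < x k"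
    and x_le_1: "\<lbrakk>2 \<le> k; k \<le> K\<rbrakk> \<Longrightarrow> x k \<le> 1"
    and short: "\<lbrakk>2 \<le> k; k \<le> K; G k < x k\<rbrakk> \<Longrightarrow> h (Suc k) = h k - (G k)\<^sup>2 / (2 * x k)"
    and full: "\<lbrakk>2 \<le> k; k \<le> K; x k \<le> G k\<rbrakk> \<Longrightarrow> h (Suc k) = h k - G k + x k / 2"
    and consecutive: "\<lbrakk>2 \<le> k; k < K; G k < x k; 0 < G k\<rbrakk> \<Longrightarrow>
      x (Suc k) \<le> 1 + x k - 2 * x k * G (Suc k) / G k - 2 * (G k - G (Suc k)) + (G k)\<^sup>2 / x k"

text \<open>The continuation of \<open>1 / t\<close> below \<open>d\<close> by its tangent at \<open>d\<close>.\<close>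

definition tangent_inverse :: "real \<Rightarrow> real \<Rightarrow> real" where
  "tangent_inverse d t = (if d \<le> t then 1 / t else 2 / d - t / d\<^sup>2)"

text \<open>\<open>tangent_inverse d\<close> is an antiderivative of -1 / max(t, d)^2, so the
  right-hand side is the integral of 1 / max(t, d)^2 over [h', h]. It is at least (h - h') / (max(h,
  d) max(h', d)), and \<open>G\<close>, \<open>G'\<close> dominate the two maxima.\<close>

lemma tangent_inverse_diff:
  assumes "0 < d" "0 \<le> h'" "h' \<le> h" "h \<le> G" "d \<le> G" "h' \<le> G'" "d \<le> G'"
  shows "(h - h') / (G * G') \<le> tangent_inverse d h' - tangent_inverse d h"
proof -
  consider "d \<le> h'" | "h' < d" "d \<le> h" | "h < d" using assms by linarith
  then show ?thesis
  proof cases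
    case 1
    then have "tangent_inverse d h' - tangent_inverse d h = (h - h') / (h * h')"
      using assms by (simp add: tangent_inverse_def divide_simps)
    then show ?thesis using 1 assms
      by (auto intro!: divide_left_mono mult_mono mult_pos_pos)
  next
    case 2
    have "tangent_inverse d h' - tangent_inverse d h - (h - h') / (h * d)
      = (h - d) * (d - h') / (h * d\<^sup>2)"
      using 2 assms
      by (simp add: tangent_inverse_def divide_simps power2_eq_square) (simp add: algebra_simps)
    also have "\<dots> \<ge> 0" using 2 assms by auto
    finally have "(h - h') / (h * d) \<le> tangent_inverse d h' - tangent_inverse d h" by simp
    moreover have "(h - h') / (G * G') \<le> (h - h') / (h * d)"
      using 2 assms by (intro divide_left_mono mult_mono mult_pos_pos) auto
    ultimately show ?thesis by linarith
  next
    case 3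
    then have "tangent_inverse d h' - tangent_inverse d h = (h - h') / (d * d)"
      using assms by (simp add: tangent_inverse_def power2_eq_square diff_divide_distrib)
    moreover have "(h - h') / (G * G') \<le> (h - h') / (d * d)"
      using 3 assms by (intro divide_left_mono mult_mono mult_pos_pos) auto
    ultimately show ?thesis by linarith
  qed
qed

text \<open>A full step at least halves h, because \<open>h \<le> G\<close>. If h' stays above d,
  then 1/h' - 1/h \<ge> 1/h \<ge> 2. Otherwise the gain is at least 1 / (2 d), and this is at least
  2 - 2 d by AM-GM.\<close>

lemma tangent_inverse_diff_full:
  assumes "0 < d" "0 \<le> h'" "h' \<le> h - G / 2" "h \<le> G" "d \<le> G" "h \<le> 1 / 2"
  shows "2 - 2 * d \<le> tangent_inverse d h' - tangent_inverse d h"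
proof -
  have "0 \<le> (1 - 2 * d)\<^sup>2 / (2 * d)" using assms by simp
  also have "\<dots> = 1 / (2 * d) - (2 - 2 * d)"
    using assms by (simp add: divide_simps power2_eq_square) (simp add: algebra_simps)
  finally have d: "2 - 2 * d \<le> 1 / (2 * d)" by simp
  have h2: "h' \<le> h / 2" using assms by linarith
  consider "d \<le> h'" | "h' < d" "d \<le> h" "h \<le> 2 * d" | "h' < d" "2 * d < h" | "h < d"
    using assms by linarith
  then show ?thesis
  proof cases
    case 1
    have "1 / (h / 2) \<le> 1 / h'" using 1 h2 assms by (intro divide_left_mono) auto
    moreover have "2 \<le> 1 / h" using 1 h2 assms by (simp add: divide_simps)
    moreover have "d \<le> h" using 1 h2 assms by linarith
    ultimately show ?thesis using 1 assms by (simp add: tangent_inverse_def)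
  next
    case 2
    have "0 \<le> (h - d) * (2 * d - h) / (2 * d\<^sup>2 * h)" using 2 assms by auto
    also have "\<dots> = 2 / d - h / 2 / d\<^sup>2 - 1 / h - 1 / (2 * d)"
      using 2 assms by (simp add: divide_simps power2_eq_square) (simp add: algebra_simps)
    also have "\<dots> \<le> 2 / d - h' / d\<^sup>2 - 1 / h - 1 / (2 * d)"
      using h2 divide_right_mono[of h' "h / 2" "d\<^sup>2"] by simp
    finally show ?thesis using 2 d by (simp add: tangent_inverse_def)
  next
    case 3
    have "h' / d\<^sup>2 \<le> d / d\<^sup>2" using 3 by (intro divide_right_mono) auto
    then have "h' / d\<^sup>2 \<le> 1 / d" using assms by (simp add: power2_eq_square)
    moreover have "1 / h \<le> 1 / (2 * d)" using 3 assms by (intro divide_left_mono) auto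
    moreover have "2 / d - 1 / d - 1 / (2 * d) = 1 / (2 * d)" using assms by (simp add: divide_simps)
    ultimately show ?thesis using 3 d assms by (simp add: tangent_inverse_def)
  next
    case 4
    have "1 / (2 * d) = (d / 2) / d\<^sup>2" using assms by (simp add: power2_eq_square)
    also have "\<dots> \<le> (h - h') / d\<^sup>2" using assms by (intro divide_right_mono) auto
    also have "\<dots> = tangent_inverse d h' - tangent_inverse d h"
      using 4 h2 assms by (simp add: tangent_inverse_def diff_divide_distrib)
    finally show ?thesis using d by simp
  qed
qed

text \<open>The line is the tangent of 1/t at 3/8, close to the extremal value of \<open>h 3\<close>
  in \<open>potential_three\<close>. Below d the function follows its tangent at d, which is steeper
  because \<open>d \<le> 3 / 8\<close>.\<close>

lemma tangent_inverse_ge: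
  assumes "0 < d" "d \<le> 3 / 8" "0 \<le> t"
  shows "16 / 3 - 64 / 9 * t \<le> tangent_inverse d t"
proof -
  have sq: "16 / 3 - 64 / 9 * s \<le> 1 / s" if "0 < s" for s :: real
  proof -
    have "1 / s - (16 / 3 - 64 / 9 * s) = (8 * s - 3)\<^sup>2 / (9 * s)"
      using that by (simp add: divide_simps power2_eq_square) (simp add: algebra_simps)
    also have "\<dots> \<ge> 0" using that by simp
    finally show ?thesis by simp
  qed
  show ?thesis
  proof (cases "d \<le> t")
    case True
    then show ?thesis using sq[of t] assms by (simp add: tangent_inverse_def)
  next
    case False
    have "d\<^sup>2 \<le> (3 / 8)\<^sup>2" using assms by (intro power_mono) auto
    then have "64 / 9 \<le> 1 / d\<^sup>2" using assms by (simp add: divide_simps power2_eq_square)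
    then have "64 / 9 * (d - t) \<le> 1 / d\<^sup>2 * (d - t)" using False by (intro mult_right_mono) auto
    moreover have "1 / d\<^sup>2 * (d - t) = 1 / d - t / d\<^sup>2"
      using assms by (simp add: field_simps power2_eq_square)
    moreover have "2 / d = 1 / d + 1 / d" by simp
    moreover have "tangent_inverse d t = 2 / d - t / d\<^sup>2" using False by (simp add: tangent_inverse_def)
    ultimately show ?thesis using sq[OF assms(1)] by argo
  qed
qed

context short_step_recursion
begin

lemma descent:
  assumes "2 \<le> k" "k \<le> K" "0 < G k"
  shows "h (Suc k) < h k" and "x k \<le> G k \<Longrightarrow> h (Suc k) \<le> h k - G k / 2"
proof -
  show *: "h (Suc k) \<le> h k - G k / 2" if "x k \<le> G k"
    using full[OF assms(1,2) that] that by simp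
  show "h (Suc k) < h k"
    using * short[OF assms(1,2)] x_pos[OF assms(1,2)] assms(3)
    by (cases "x k \<le> G k") (auto intro!: divide_pos_pos)
qed

lemma h_le_half:
  assumes "\<And>k. \<lbrakk>2 \<le> k; k \<le> K\<rbrakk> \<Longrightarrow> 0 < G k" "2 \<le> k" "k \<le> Suc K"
  shows "h k \<le> 1 / 2"
  using assms(2,3)
proof (induction k rule: nat_induct_at_least)
  case base
  then show ?case using h_start by simp
next
  case (Suc k)
  then show ?case using descent(1)[of k] assms(1)[of k] by simp
qed

text \<open>Along short steps the inverse of \<open>h\<close> grows by \<open>1 / (2 a)\<close> with \<open>a = x G' / G\<close>, which is at least
  \<open>2 - 2 a\<close>; the condition on consecutive steps turns \<open>2 a\<close> into a telescoping sum.\<close>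

definition potential :: "real \<Rightarrow> nat \<Rightarrow> real" where
  "potential d k = tangent_inverse d (h k) - x k + 2 * (G k - h k)"

text \<open>The summand 2 (G - h) of \<open>potential\<close> is made for this cancellation: its h
  part absorbs the term G^2 / x of \<open>consecutive\<close>, and its G part makes -2 (G k - G (Suc
  k)) telescope.\<close>

lemma potential_short:
  assumes "2 \<le> k" "k < K" "G k < x k" "0 < G k"
  shows "tangent_inverse d (h (Suc k)) - 1 - x k + 2 * x k * G (Suc k) / G k + 2 * G k - 2 * h k
    \<le> potential d (Suc k)"
proof -
  have "2 * ((G k)\<^sup>2 / (2 * x k)) = (G k)\<^sup>2 / x k" by simp
  then show ?thesis
    using consecutive[OF assms] short[OF assms(1) _ assms(3)] assms(2)
    unfolding potential_def by simp
qed

lemma potential_step: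
  assumes d: "0 < d" and G: "\<And>k. \<lbrakk>2 \<le> k; k \<le> K\<rbrakk> \<Longrightarrow> d \<le> G k" and k: "2 \<le> k" "k < K"
  shows "potential d k + 1 \<le> potential d (Suc k)"
proof -
  have kK: "k \<le> K" "2 \<le> Suc k" "Suc k \<le> K" "Suc k \<le> Suc K" using k by auto
  have pos: "\<And>k. \<lbrakk>2 \<le> k; k \<le> K\<rbrakk> \<Longrightarrow> 0 < G k" using G d by fastforce
  note Gk = G[OF k(1) kK(1)] G[OF kK(2,3)]
  note hk = h_nonneg[OF kK(2,4)] h_le_G[OF k(1) kK(1)] h_le_G[OF kK(2,3)]
  show ?thesis
  proof (cases "G k < x k")
    case True
    define a where "a = x k * G (Suc k) / G k"
    have a: "0 < a" unfolding a_def using pos[OF k(1) kK(1)] pos[OF kK(2,3)] True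
      by (intro divide_pos_pos mult_pos_pos) auto
    have "(h k - h (Suc k)) / (G k * G (Suc k))
        \<le> tangent_inverse d (h (Suc k)) - tangent_inverse d (h k)"
      using descent(1)[OF k(1) kK(1)] pos[OF k(1) kK(1)] Gk hk
      by (intro tangent_inverse_diff) (use d in auto)
    moreover have "(h k - h (Suc k)) / (G k * G (Suc k)) = 1 / (2 * a)"
      unfolding a_def short[OF k(1) kK(1) True] using pos[OF k(1) kK(1)] pos[OF kK(2,3)] True
      by (simp add: divide_simps power2_eq_square)
    moreover have "2 - 2 * a \<le> 1 / (2 * a)"
    proof -
      have "1 / (2 * a) - (2 - 2 * a) = (2 * a - 1)\<^sup>2 / (2 * a)"
        using a by (simp add: divide_simps power2_eq_square) (simp add: algebra_simps)
      also have "\<dots> \<ge> 0" using a by simp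
      finally show ?thesis by simp
    qed
    moreover have "2 * x k * G (Suc k) / G k = 2 * a" unfolding a_def by simp
    ultimately show ?thesis
      using potential_short[OF k True pos[OF k(1) kK(1)], of d] unfolding potential_def[of d k] by simp
  next
    case False
    then have f: "x k \<le> G k" by simp
    \<comment> \<open>In a full step \<open>x k\<close> and both values of h cancel outside
      \<open>tangent_inverse\<close>; what remains is -x (Suc k) + 2 G (Suc k) \<ge> 2 d - 1, so an
      increase by 2 - 2 d suffices.\<close>
    have "2 - 2 * d \<le> tangent_inverse d (h (Suc k)) - tangent_inverse d (h k)"
      using descent(2)[OF k(1) kK(1) pos[OF k(1) kK(1)] f] Gk hk h_le_half[OF pos k(1)] kK(1)
      by (intro tangent_inverse_diff_full[where G = "G k"]) (use d in auto)
    then show ?thesis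
      using full[OF k(1) kK(1) f] x_le_1[OF kK(2,3)] Gk unfolding potential_def by simp
  qed
qed

text \<open>The value 2/d at 0 is not reached, since \<open>h (Suc K) \<ge> 0\<close> keeps
  \<open>h K\<close> away from 0. In a short step h \<ge> G^2 / (2 x); minimizing the resulting loss
  over x gives sqrt(2 (g^2 + 2 G^2)) - 2 G with g = G / d, which is smallest for g = 1 and d = 1/3,
  about 0.897.\<close>

lemma potential_last:
  assumes d: "0 < d" "d \<le> 1 / 3" and G: "d \<le> G K" and K: "2 \<le> K"
  shows "potential d K \<le> 2 / d - 895 / 1000"
proof -
  have x: "0 < x K" "x K \<le> 1" using x_pos x_le_1 K by auto
  have G0: "0 < G K" using G d by simp
  have h': "0 \<le> h (Suc K)" using h_nonneg K by simp
  have d3: "3 \<le> 1 / d" using d by (simp add: divide_simps)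
  have d2: "2 / d = 1 / d + 1 / d" by simp
  show ?thesis
  proof (cases "d \<le> h K")
    case True
    have "1 / h K \<le> 1 / d" using True d by (intro divide_left_mono) auto
    moreover have "- x K + 2 * (G K - h K) \<le> 1"
    proof (cases "G K < x K")
      case True
      then have "- x K + 2 * (G K - h K) \<le> x K - 2 * h K" by simp
      then show ?thesis using \<open>d \<le> h K\<close> d(1) x by linarith
    next
      case False
      then show ?thesis using full[of K] K h' x by simp
    qed
    ultimately show ?thesis using True d3 d2 unfolding potential_def tangent_inverse_def by simp
  next
    case False
    have pot: "potential d K = 2 / d - (h K / d\<^sup>2 + 2 * h K + x K - 2 * G K)"
      using False unfolding potential_def tangent_inverse_def by simp
    have "895 / 1000 \<le> h K / d\<^sup>2 + 2 * h K + x K - 2 * G K"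
    proof (cases "G K < x K")
      case True
      define g where "g = G K / d"
      have Gg: "G K = g * d" unfolding g_def using d by simp
      have g: "1 \<le> g" unfolding g_def using G d by (simp add: divide_simps)
      have h: "(G K)\<^sup>2 / (2 * x K) \<le> h K" using short[OF K _ True] h' by simp
      have "(G K)\<^sup>2 / (2 * x K) / d\<^sup>2 + 2 * ((G K)\<^sup>2 / (2 * x K)) \<le> h K / d\<^sup>2 + 2 * h K"
        using h by (intro add_mono divide_right_mono mult_left_mono) auto
      moreover have "(G K)\<^sup>2 / (2 * x K) / d\<^sup>2 + 2 * ((G K)\<^sup>2 / (2 * x K))
          = (g\<^sup>2 + 2 * (G K)\<^sup>2) / (2 * x K)"
        unfolding g_def using d x by (simp add: divide_simps power2_eq_square)
      \<comment> \<open>After multiplication by 16 x this is a quadratic in x, and the square is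
        completed; 179/100 is twice 895/1000.\<close>
      moreover have "0 \<le> (g\<^sup>2 + 2 * (G K)\<^sup>2) / (2 * x K) + x K - 2 * G K - 895 / 1000"
      proof -
        have "1432 / 100 * G K \<le> 1432 / 300 * g" unfolding Gg using d g by simp
        moreover have "g * 1 \<le> g\<^sup>2" unfolding power2_eq_square using g by (intro mult_left_mono) auto
        ultimately have "0 \<le> 8 * g\<^sup>2 - 1432 / 100 * G K - 32041 / 10000" using g by simp
        also have "\<dots> = 8 * (g\<^sup>2 + 2 * (G K)\<^sup>2) - (4 * G K + 179 / 100)\<^sup>2"
          by (simp add: power2_eq_square algebra_simps)
        finally have "0 \<le> (4 * x K - (4 * G K + 179 / 100))\<^sup>2
            + (8 * (g\<^sup>2 + 2 * (G K)\<^sup>2) - (4 * G K + 179 / 100)\<^sup>2)" by simp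
        also have "\<dots> = 16 * x K * ((g\<^sup>2 + 2 * (G K)\<^sup>2) / (2 * x K) + x K - 2 * G K - 895 / 1000)"
          using x by (simp add: field_simps power2_eq_square)
        finally show ?thesis using x by (simp add: zero_le_mult_iff)
      qed
      ultimately show ?thesis by linarith
    next
      case False
      then have f: "x K \<le> G K" by simp
      have hK: "G K - x K / 2 \<le> h K" using full[OF K _ f] h' by simp
      have "3 / 2 * d\<^sup>2 \<le> d / 2" using d by (simp add: power2_eq_square)
      also have "\<dots> \<le> h K" using hK f G by linarith
      finally have "3 / 2 \<le> h K / d\<^sup>2" using d by (simp add: pos_le_divide_eq)
      then show ?thesis using hK by linarith
    qed
    then show ?thesis unfolding pot by simp
  qed
qed

text \<open>The potential at 2 can be as low as 1, so \<open>potential_step\<close> would give only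
  2 here, which misses the contradiction in \<open>gap_large\<close> by about 0.1. The first step of
  the telescoping sum is therefore estimated more carefully.\<close>

lemma potential_three:
  assumes d: "0 < d" "d \<le> 3 / 8" and G: "\<And>k. \<lbrakk>2 \<le> k; k \<le> K\<rbrakk> \<Longrightarrow> d \<le> G k" and K: "3 \<le> K"
  shows "211 / 100 \<le> potential d 3"
proof -
  have s: "Suc 2 = 3" by simp
  have G2: "0 < G 2" using G[of 2] d K by simp
  have x: "0 < x 2" "x 2 \<le> 1" "x 3 \<le> 1" using x_pos x_le_1 K by auto
  have h3: "0 \<le> h 3" "h 3 \<le> G 3" "h 2 \<le> G 2" using h_nonneg[of 3] h_le_G K by auto
  have t: "16 / 3 - 64 / 9 * h 3 \<le> tangent_inverse d (h 3)"
    by (rule tangent_inverse_ge[OF d h3(1)])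
  show ?thesis
  proof (cases "G 2 < x 2")
    case False
    then have "h 3 \<le> 1 / 4" using descent(2)[of 2] G2 K h3 h_start unfolding s by simp
    then show ?thesis using t x h3 unfolding potential_def by simp
  next
    case True
    define y where "y = x 2 / G 2"
    define g where "g = G 2"
    define w where "w = h 2"
    have xy: "x 2 = y * g" unfolding y_def g_def using G2 by simp
    have g: "0 < g" "w \<le> g" "w \<le> 1 / 2" unfolding g_def w_def using G2 h3 h_start by auto
    have y: "1 < y" unfolding y_def using True G2 by simp
    have yg: "y * g \<le> 1" using xy x by simp
    have h3w: "h 3 = w - g / (2 * y)"
      using short[of 2] True K g y unfolding s w_def[symmetric] xy g_def[symmetric]
      by (simp add: power2_eq_square)
    have "2 * x 2 * h 3 / g \<le> 2 * x 2 * G 3 / g"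
      using h3 x g by (intro divide_right_mono mult_left_mono) auto
    moreover have "2 * x 2 * h 3 / g = 2 * y * w - g"
      unfolding h3w xy using g y by (simp add: field_simps)
    moreover have "tangent_inverse d (h 3) - 1 - y * g + 2 * x 2 * G 3 / g + 2 * g - 2 * w
        \<le> potential d 3"
      using potential_short[of 2 d] True G2 K
      unfolding s xy g_def[symmetric] w_def[symmetric] by simp
    moreover have "64 / 9 * h 3 = 64 / 9 * w - 32 / 9 * (g / y)" unfolding h3w by simp
    moreover have "(y - 1) * (2 * w - g) = 2 * y * w - y * g - 2 * w + g" by (simp add: algebra_simps)
    ultimately have pot: "13 / 3 + (y - 1) * (2 * w - g) - 64 / 9 * w + 32 / 9 * (g / y) \<le> potential d 3"
      using t by argo
    \<comment> \<open>The lower bound is affine in \<open>w\<close>, the value of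
      \<open>h 2\<close>, so only the ends of its range matter: \<open>h 3 \<ge> 0\<close> means w
      \<ge> g / (2 y), and the other end is min(g, 1/2).\<close>
    define F where "F w = 13 / 3 + (y - 1) * (2 * w - g) - 64 / 9 * w + 32 / 9 * (g / y)" for w
    have F_diff: "F u - F v = (2 * y - 2 - 64 / 9) * (u - v)" for u v
      unfolding F_def by (simp add: field_simps)
    have lower: "g / (2 * y) \<le> w" using h3(1) h3w by simp
    have "211 / 100 \<le> F w"
    proof (cases "0 \<le> 2 * y - 2 - 64 / 9")
      case True
      then have "0 \<le> (2 * y - 2 - 64 / 9) * (w - g / (2 * y))"
        using lower by (intro mult_nonneg_nonneg) auto
      then have "F (g / (2 * y)) \<le> F w" unfolding F_diff[symmetric] by simp
      moreover have "F (g / (2 * y)) = 13 / 3 - (y * g) * ((y - 1) / y)\<^sup>2"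
        unfolding F_def using y by (simp add: divide_simps power2_eq_square) (simp add: algebra_simps)
      moreover have "(y * g) * ((y - 1) / y)\<^sup>2 \<le> 1 * 1\<^sup>2"
        using y g yg by (intro mult_mono power_mono) auto
      ultimately show ?thesis by simp
    next
      case neg: False
      have mono: "F v \<le> F w" if "w \<le> v" for v
      proof -
        have "0 \<le> (2 * y - 2 - 64 / 9) * (w - v)"
          using neg that by (intro mult_nonpos_nonpos) auto
        then show ?thesis unfolding F_diff[symmetric] by simp
      qed
      \<comment> \<open>188/100 is a rational lower bound for 2 sqrt(8/9), the AM-GM minimum of y /
        2 + 16 / (9 y).\<close>
      have amgm: "0 \<le> y\<^sup>2 / 2 - 188 / 100 * y + 16 / 9"
      proof -
        have "y\<^sup>2 / 2 - 188 / 100 * y + 16 / 9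
          = (y - 188 / 100)\<^sup>2 / 2 + (16 / 9 - (188 / 100)\<^sup>2 / 2)"
          by (simp add: power2_eq_square field_simps)
        also have "\<dots> \<ge> 0" by (intro add_nonneg_nonneg) (auto simp: power2_eq_square)
        finally show ?thesis .
      qed
      then have amgm': "188 / 100 \<le> y / 2 + 16 / 9 * (1 / y)"
        using y by (simp add: divide_simps power2_eq_square)
      show ?thesis
      proof (cases "g \<le> 1 / 2")
        case True
        have "F g = 13 / 3 + g * (2 * (y / 2 + 16 / 9 * (1 / y)) - 1 - 64 / 9)"
          unfolding F_def using y by (simp add: field_simps)
        also have "\<dots> \<ge> 13 / 3 + g * (2 * (188 / 100) - 1 - 64 / 9)"
          using amgm' g by (intro add_left_mono mult_left_mono) auto
        finally show ?thesis using mono[OF g(2)] True by simp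
      next
        case False
        have "y * (1 / 2) \<le> y * g" using False y by (intro mult_left_mono) auto
        then have y2: "y \<le> 2" using yg by simp
        have "1 / 2 \<le> 1 / y" using y y2 by (simp add: divide_simps)
        then have "0 \<le> (32 / 9 * (1 / y) - (y - 1)) * (g - 1 / 2)"
          using False y2 by (intro mult_nonneg_nonneg) auto
        also have "\<dots> = F (1 / 2) - (13 / 3 - 32 / 9 + (y - 1) / 2 + 16 / 9 * (1 / y))"
          unfolding F_def using y by (simp add: field_simps)
        finally show ?thesis using mono[OF g(3)] amgm' by argo
      qed
    qed
    then show ?thesis using pot unfolding F_def by linarith
  qed
qed

lemma gap_large:
  assumes K: "6 \<le> K" and G: "\<And>k. \<lbrakk>2 \<le> k; k \<le> K\<rbrakk> \<Longrightarrow> 2 / real K < G k"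
  shows False
proof -
  define d where "d = 2 / real K"
  have d: "0 < d" "d \<le> 1 / 3" unfolding d_def using K by (auto simp: divide_simps)
  have G': "\<And>k. \<lbrakk>2 \<le> k; k \<le> K\<rbrakk> \<Longrightarrow> d \<le> G k" unfolding d_def using G by (simp add: less_imp_le)
  have "211 / 100 + real (k - 3) \<le> potential d k" if "3 \<le> k" "k \<le> K" for k
    using that
  proof (induction k rule: nat_induct_at_least)
    case base
    then show ?case using potential_three[OF d(1) _ G'] d by simp
  next
    case (Suc k)
    then show ?case using potential_step[OF d(1) G', of k] by simp
  qed
  from this[of K] have "211 / 100 + real K - 3 \<le> potential d K" using K by simp
  moreover have "potential d K \<le> 2 / d - 895 / 1000"
    using potential_last[OF d] G'[of K] K by simp
  moreover have "2 / d = real K" unfolding d_def using K by simp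
  \<comment> \<open>The two bounds are K - 0.89 from below and K - 0.895 from above.\<close>
  ultimately show False
    by simp
qed

text \<open>For few iterations the loss at the two ends of the telescoping sum is too large. There the
  normalized reciprocals \<open>X\<close> of the decrements of \<open>h\<close> are estimated one after the other.\<close>

lemma chain:
  assumes d: "1 / 8 \<le> d" "d \<le> 1" and G: "\<And>k. \<lbrakk>2 \<le> k; k \<le> K\<rbrakk> \<Longrightarrow> d \<le> G k"
  defines "X \<equiv> \<lambda>k. d\<^sup>2 / (2 * (h k - h (Suc k)))"
  shows "\<lbrakk>2 \<le> k; k \<le> K\<rbrakk> \<Longrightarrow> 0 < X k" "\<lbrakk>2 \<le> k; k \<le> K\<rbrakk> \<Longrightarrow> X k \<le> 1"
    "\<lbrakk>2 \<le> k; k < K\<rbrakk> \<Longrightarrow> X (Suc k) \<le> 1 - X k + d\<^sup>2 / X k \<or>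
      X (Suc k) \<le> d \<and> 2 / d - (1 - X k + d\<^sup>2 / X k) / d\<^sup>2 \<le> 1 / X (Suc k)"
proof -
  have d0: "0 < d" using d by simp
  have G0: "0 < G k" if "2 \<le> k" "k \<le> K" for k using G[OF that] d0 by simp
  have X_short: "X k = x k * (d / G k)\<^sup>2" if "2 \<le> k" "k \<le> K" "G k < x k" for k
    unfolding X_def short[OF that] using G0[OF that(1,2)] x_pos[OF that(1,2)]
    by (simp add: power_divide)
  have X_full: "X k = d\<^sup>2 / (2 * G k - x k)" if "2 \<le> k" "k \<le> K" "x k \<le> G k" for k
    unfolding X_def full[OF that] by simp
  have dG: "(d / G k)\<^sup>2 \<le> 1" if "2 \<le> k" "k \<le> K" for k
    using G[OF that] G0[OF that] d0 by (simp add: power_le_one)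
  have X_full_le: "X k \<le> d" if "2 \<le> k" "k \<le> K" "x k \<le> G k" for k
  proof -
    have "d\<^sup>2 / (2 * G k - x k) \<le> d\<^sup>2 / d"
      using that G[OF that(1,2)] d0 by (intro divide_left_mono) auto
    then show ?thesis unfolding X_full[OF that] using d0 by (simp add: power2_eq_square)
  qed
  show pos: "0 < X k" if "2 \<le> k" "k \<le> K" for k
    unfolding X_def using descent(1)[OF that G0[OF that]] d0 by simp
  have X_short_le: "X k \<le> x k" if "2 \<le> k" "k \<le> K" "G k < x k" for k
    unfolding X_short[OF that] using dG[OF that(1,2)] x_pos[OF that(1,2)]
    by (simp add: mult_left_le)
  show le_1: "X k \<le> 1" if "2 \<le> k" "k \<le> K" for k
    using X_short_le[OF that] x_le_1[OF that] X_full_le[OF that] d by (cases "G k < x k") auto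
  show "X (Suc k) \<le> 1 - X k + d\<^sup>2 / X k \<or>
      X (Suc k) \<le> d \<and> 2 / d - (1 - X k + d\<^sup>2 / X k) / d\<^sup>2 \<le> 1 / X (Suc k)"
    if k: "2 \<le> k" "k < K" for k
  proof -
    have k': "k \<le> K" "2 \<le> Suc k" "Suc k \<le> K" using k by auto
    \<comment> \<open>\<open>R\<close> is the bound of \<open>consecutive\<close> when both gaps
      equal d and the step is short; larger gaps only lower the bound.\<close>
    define R where "R = 1 - X k + d\<^sup>2 / X k"
    have R: "x (Suc k) \<le> R"
    proof (cases "G k < x k")
      case True
      define g where "g = G k / d"
      have g: "1 \<le> g" unfolding g_def using G[OF k(1) k'(1)] d0 by simp
      have Gk: "G k = g * d" unfolding g_def using d0 by simp
      have xk: "x k = g\<^sup>2 * X k"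
        unfolding X_short[OF k(1) k'(1) True] g_def using G0[OF k(1) k'(1)] d0
        by (simp add: power_divide)
      have "(2 * x k / G k - 2) * d \<le> (2 * x k / G k - 2) * G (Suc k)"
        using True G0[OF k(1) k'(1)] G[OF k'(2,3)]
        by (intro mult_left_mono) (auto simp: divide_simps)
      then have "x (Suc k) \<le> 1 + x k - 2 * x k * d / G k - 2 * (G k - d) + (G k)\<^sup>2 / x k"
        using consecutive[OF k True G0[OF k(1) k'(1)]] by (simp add: algebra_simps)
      also have "\<dots> = R + (g - 1) * (X k * (g - 1) - 2 * d)"
        unfolding R_def Gk xk using g d0 pos[OF k(1) k'(1)]
        by (simp add: divide_simps power2_eq_square) (simp add: algebra_simps)
      also have "\<dots> \<le> R"
      proof -
        \<comment> \<open>Since 4 (g - 1) \<le> g^2 and X g^2 = x \<le> 1, the product X (g - 1) is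
          at most 1/4 \<le> 2 d. This is where \<open>1 / 8 \<le> d\<close> comes from.\<close>
        have "X k * (4 * (g - 1)) \<le> X k * g\<^sup>2"
          using pos[OF k(1) k'(1)] sum_squares_ge_zero[of "g - 2" 0]
          by (intro mult_left_mono) (auto simp: power2_eq_square algebra_simps)
        then have "X k * (g - 1) \<le> 2 * d"
          using xk x_le_1[OF k(1) k'(1)] d by (simp add: algebra_simps)
        then show ?thesis using g by (simp add: mult_nonneg_nonpos)
      qed
      finally show ?thesis .
    next
      case False
      then have "X k \<le> d" using X_full_le[OF k(1) k'(1)] by simp
      then have "d\<^sup>2 / d \<le> d\<^sup>2 / X k"
        using pos[OF k(1) k'(1)] d0 by (intro divide_left_mono) auto
      then have "1 \<le> R" unfolding R_def using \<open>X k \<le> d\<close> d0 by (simp add: power2_eq_square)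
      then show ?thesis using x_le_1[OF k'(2,3)] by simp
    qed
    show ?thesis
    proof (cases "G (Suc k) < x (Suc k)")
      case True
      then show ?thesis using X_short_le[OF k'(2,3) True] R unfolding R_def by simp
    next
      case False
      then have f: "x (Suc k) \<le> G (Suc k)" by simp
      have "2 / d - R / d\<^sup>2 = (2 * d - R) / d\<^sup>2"
        using d0 by (simp add: diff_divide_distrib power2_eq_square)
      also have "\<dots> \<le> (2 * G (Suc k) - x (Suc k)) / d\<^sup>2"
        using G[OF k'(2,3)] R by (intro divide_right_mono) auto
      finally show ?thesis
        using X_full_le[OF k'(2,3) f] unfolding X_full[OF k'(2,3) f] R_def by simp
    qed
  qed
qed


text \<open>The reciprocals 1 / X k telescope, so their sum is at most 2 h 2 / d^2 \<le> K^2 / 4.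
  Two successive ones cannot both be small, and pairing them exceeds this value: 2.3 > 9/4 for K =
  3, and twice 3.126 > 25/4 for K = 5. For K = 4 one reciprocal is left over, which forces a case
  distinction.\<close>

lemma gap_small:
  assumes K: "3 \<le> K" "K \<le> 5" and G: "\<And>k. \<lbrakk>2 \<le> k; k \<le> K\<rbrakk> \<Longrightarrow> 2 / real K < G k"
  shows False
proof -
  define d where "d = 2 / real K"
  have d: "1 / 8 \<le> d" "d \<le> 1" "0 < d" unfolding d_def using K by (auto simp: divide_simps)
  have G': "\<And>k. \<lbrakk>2 \<le> k; k \<le> K\<rbrakk> \<Longrightarrow> d \<le> G k" unfolding d_def using G by (simp add: less_imp_le)
  define X where "X = (\<lambda>k. d\<^sup>2 / (2 * (h k - h (Suc k))))"
  have X_pos: "0 < X k" and X_le: "X k \<le> 1" if "2 \<le> k" "k \<le> K" for k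
    unfolding X_def using chain(1,2)[OF d(1,2) _ that] G' by auto
  have X_next: "X (Suc k) \<le> 1 - X k + d\<^sup>2 / X k \<or>
      X (Suc k) \<le> d \<and> 2 / d - (1 - X k + d\<^sup>2 / X k) / d\<^sup>2 \<le> 1 / X (Suc k)"
    if "2 \<le> k" "k < K" for k
    unfolding X_def by (rule chain(3)[OF d(1,2) _ that]) (rule G')
  have drop: "1 / X k = 2 * (h k - h (Suc k)) / d\<^sup>2" for k unfolding X_def by simp
  have inv: "1 \<le> 1 / X k" if "2 \<le> k" "k \<le> K" for k
    using X_pos[OF that] X_le[OF that] by (simp add: divide_simps)
  \<comment> \<open>The condition \<open>poly\<close> is c \<le> 1/X + 1/R with R = 1 - X + d^2 / X,
    cleared of denominators; \<open>c \<le> 1 + 1 / d\<close> serves the case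
    \<open>X (Suc k) \<le> d\<close>. The certificates below have the form (X - r)^2 (X + 2 r - 1)
    \<ge> 0 with r close to the minimizer of 1/X + 1/R; the shift 2 r - 1 reproduces the leading
    terms X^3 - X^2.\<close>
  have pair: "c \<le> 1 / X k + 1 / X (Suc k)"
    if k: "2 \<le> k" "k < K" and c: "c \<le> 1 + 1 / d" "0 \<le> c"
      and poly: "c * (X k * (X k - (X k)\<^sup>2 + d\<^sup>2)) \<le> X k + d\<^sup>2" for k c
  proof -
    have k': "k \<le> K" "2 \<le> Suc k" "Suc k \<le> K" using k by auto
    note X = X_pos[OF k(1) k'(1)] X_le[OF k(1) k'(1)] X_pos[OF k'(2,3)] X_le[OF k'(2,3)]
    show ?thesis
    proof (cases "X (Suc k) \<le> d")
      case True
      then have "1 / d \<le> 1 / X (Suc k)" using X d by (intro divide_left_mono) auto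
      then show ?thesis using inv[OF k(1) k'(1)] c by linarith
    next
      case False
      define R where "R = 1 - X k + d\<^sup>2 / X k"
      have R: "X (Suc k) \<le> R" "0 < R" using X_next[OF k] False X unfolding R_def by auto
      have XR: "X k * R = X k - (X k)\<^sup>2 + d\<^sup>2"
        unfolding R_def using X by (simp add: field_simps power2_eq_square)
      have "c * (X k * (X k * R)) \<le> X k * (R + X k)"
        using poly unfolding distrib_left XR by (simp add: power2_eq_square)
      then have "c * (X k * R) \<le> R + X k" using X by (simp add: mult.left_commute)
      then have "c \<le> 1 / X k + 1 / R" using X R by (simp add: field_simps)
      moreover have "1 / R \<le> 1 / X (Suc k)" using R X by (intro divide_left_mono) auto
      ultimately show ?thesis by linarith
    qed
  qed
  have h: "0 \<le> h (Suc K)" "h 2 \<le> 1 / 2" using h_nonneg[of "Suc K"] h_start K by auto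
  consider "K = 3" | "K = 4" | "K = 5" using K by linarith
  then show False
  proof cases
    case 1
    have d3: "d = 2 / 3" unfolding d_def 1 by simp
    have X: "0 < X 2" "X 2 \<le> 1" using X_pos[of 2] X_le[of 2] K by auto
    have "0 \<le> (X 2 - 2 / 3)\<^sup>2 * (X 2 + 1 / 3)" using X by simp
    then have "23 / 10 \<le> 1 / X 2 + 1 / X (Suc 2)"
      using X 1 by (intro pair) (auto simp: d3 power2_eq_square field_simps)
    then show False using h unfolding drop d3 1 by (simp add: eval_nat_numeral power2_eq_square field_simps)
  next
    case 2
    have d4: "d = 1 / 2" unfolding d_def 2 by simp
    have X: "0 < X 2" "X 2 \<le> 1" "0 < X 3" "X 3 \<le> 1" using X_pos[of 2] X_le[of 2] X_pos[of 3] X_le[of 3] 2 by auto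
    have sum: "1 / X 2 + 1 / X 3 + 1 / X 4 \<le> 4"
      using h unfolding drop d4 2 by (simp add: eval_nat_numeral power2_eq_square field_simps)
    have "0 \<le> (X 2 - 6139 / 10000)\<^sup>2 * (X 2 + 2278 / 10000)" using X by simp
    then have p: "288 / 100 \<le> 1 / X 2 + 1 / X (Suc 2)"
      using X 2 by (intro pair) (auto simp: d4 power2_eq_square field_simps)
    have i: "1 \<le> 1 / X 2" "1 \<le> 1 / X 3" "1 \<le> 1 / X 4" using inv 2 by auto
    have recip: "1 / r \<le> 1 / X k" if "X k \<le> r" "2 \<le> k" "k \<le> K" for r k
      using that X_pos[of k] by (intro divide_left_mono) auto
    have rX: "d\<^sup>2 / X k \<le> d\<^sup>2 / r" if "r \<le> X k" "0 < r" for r k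
      using that by (intro divide_left_mono) auto
    show False
    proof (cases "X 3 \<le> 56 / 100")
      case b: True
      then have b': "100 / 56 \<le> 1 / X 3" using recip[of 3 "56 / 100"] 2 by simp
      show False
      proof (cases "X 2 \<le> 8 / 10")
        case True
        then have "10 / 8 \<le> 1 / X 2" using recip[of 2 "8 / 10"] 2 by simp
        then show False using b' i sum by simp
      next
        case a: False
        show False
        proof (cases "X 2 \<le> 9 / 10")
          case True
          have "X 3 \<le> 5125 / 10000"
            using X_next[of 2] rX[of "8 / 10" 2] a 2 by (auto simp: d4 power2_eq_square)
          then have "10000 / 5125 \<le> 1 / X 3" using recip[of 3 "5125 / 10000"] 2 by simp
          moreover have "10 / 9 \<le> 1 / X 2" using recip[of 2 "9 / 10"] True 2 by simp
          ultimately show False using i sum by simp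
        next
          case False
          define R where "R = 1 - X 2 + d\<^sup>2 / X 2"
          have R: "R \<le> 38 / 100"
            using rX[of "9 / 10" 2] False unfolding R_def by (simp add: d4 power2_eq_square)
          have "X 3 \<le> R \<or> 4 - 4 * R \<le> 1 / X 3"
            using X_next[of 2] 2 unfolding R_def[symmetric] by (auto simp: d4 power2_eq_square)
          then have "24 / 10 \<le> 1 / X 3"
          proof
            assume "X 3 \<le> R"
            then have "100 / 38 \<le> 1 / X 3" using recip[of 3 "38 / 100"] R 2 by simp
            then show ?thesis by simp
          qed (use R in simp)
          then show False using i sum by simp
        qed
      qed
    next
      case False
      have "X 4 \<le> 89 / 100"
        using X_next[of 3] rX[of "56 / 100" 3] False 2 by (auto simp: d4 power2_eq_square)
      then have "100 / 89 \<le> 1 / X 4" using recip[of 4 "89 / 100"] 2 by simp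
      then show False using p sum by simp
    qed
  next
    case 3
    have d5: "d = 2 / 5" unfolding d_def 3 by simp
    have p: "3126 / 1000 \<le> 1 / X k + 1 / X (Suc k)" if "k = 2 \<or> k = 4" for k
    proof -
      have X: "0 < X k" "X k \<le> 1" using X_pos[of k] X_le[of k] that 3 by auto
      have "0 \<le> (X k - 5737 / 10000)\<^sup>2 * (X k + 1474 / 10000)" using X by simp
      then show ?thesis
        using X 3 that by (intro pair) (auto simp: d5 power2_eq_square field_simps)
    qed
    from p[of 2] p[of 4] show False
      using h unfolding drop d5 3 by (simp add: eval_nat_numeral power2_eq_square field_simps)
  qed
qed

end

theorem short_step_gap:
  assumes "short_step_recursion K h G x" and "3 \<le> K"
  shows "\<exists>k\<in>{2..K}. G k \<le> 2 / real K"
proof (rule ccontr)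
  assume "\<not> ?thesis"
  then have "\<And>k. \<lbrakk>2 \<le> k; k \<le> K\<rbrakk> \<Longrightarrow> 2 / real K < G k" by force
  then show False
    using short_step_recursion.gap_small[OF assms(1,2)] short_step_recursion.gap_large[OF assms(1)]
    by (cases "K \<le> 5") auto
qed

section \<open>Geometry of Frank-Wolfe runs on a squared distance\<close>

lemma closest_point_dot_nonneg:
  fixes D :: "'a::euclidean_space set"
  assumes "convex D" "closed D" "z \<in> D"
  shows "0 \<le> (closest_point D c - c) \<bullet> (z - closest_point D c)"
  using closest_point_dot[OF assms, of c] by (simp add: inner_diff_left)

locale frank_wolfe_run =
  fixes D :: "'a::euclidean_space set" and c :: 'a and M :: real and K :: nat
    and X S :: "nat \<Rightarrow> 'a" and e :: "nat \<Rightarrow> real"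
  assumes convex_D: "convex D" and closed_D: "closed D"
    and M: "\<lbrakk>u \<in> D; v \<in> D\<rbrakk> \<Longrightarrow> norm (u - v) \<le> M"
    and start: "X 1 \<in> D"
    and oracle_in: "\<lbrakk>1 \<le> k; k \<le> K\<rbrakk> \<Longrightarrow> S k \<in> D"
    and oracle_min: "\<lbrakk>1 \<le> k; k \<le> K; z \<in> D\<rbrakk> \<Longrightarrow> (X k - c) \<bullet> S k \<le> (X k - c) \<bullet> z"
    and update: "\<lbrakk>1 \<le> k; k \<le> K\<rbrakk> \<Longrightarrow> X (Suc k) = X k + e k *\<^sub>R (S k - X k)"
    and step_range: "\<lbrakk>1 \<le> k; k \<le> K\<rbrakk> \<Longrightarrow> 0 \<le> e k \<and> e k \<le> 1"
begin

definition fw_gap :: "nat \<Rightarrow> real" where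
  "fw_gap k = (X k - c) \<bullet> (X k - S k)"

definition len2 :: "nat \<Rightarrow> real" where
  "len2 k = (norm (S k - X k))\<^sup>2"

abbreviation "opt \<equiv> closest_point D c"

definition primal_gap :: "nat \<Rightarrow> real" where
  "primal_gap k = ((norm (X k - c))\<^sup>2 - (norm (opt - c))\<^sup>2) / 2"

definition dist_part :: "nat \<Rightarrow> real" where
  "dist_part k = (norm (X k - opt))\<^sup>2 / 2"

definition linear_part :: "nat \<Rightarrow> real" where
  "linear_part k = (opt - c) \<bullet> (X k - opt)"

definition oracle_part :: "nat \<Rightarrow> real" where
  "oracle_part k = (opt - c) \<bullet> (S k - opt)"

lemma iterate_in: "\<lbrakk>1 \<le> k; k \<le> Suc K\<rbrakk> \<Longrightarrow> X k \<in> D"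
proof (induction k rule: nat_induct_at_least)
  case base
  show ?case by (rule start)
next
  case (Suc k)
  then have "(1 - e k) *\<^sub>R X k + e k *\<^sub>R S k \<in> D"
    using step_range[of k] oracle_in[of k] by (intro convexD_alt[OF convex_D]) auto
  moreover have "X (Suc k) = (1 - e k) *\<^sub>R X k + e k *\<^sub>R S k"
    using update[of k] Suc by (simp add: algebra_simps)
  ultimately show ?case by simp
qed

lemma opt_in: "opt \<in> D"
  using start closed_D closest_point_in_set by blast

lemma primal_gap_eq: "primal_gap k = dist_part k + linear_part k"
  unfolding primal_gap_def dist_part_def linear_part_def power2_norm_eq_inner
  by (simp add: inner_diff_left inner_diff_right inner_commute field_simps)

lemma dist_part_nonneg: "0 \<le> dist_part k"
  unfolding dist_part_def by simp

lemma linear_part_nonneg: "\<lbrakk>1 \<le> k; k \<le> Suc K\<rbrakk> \<Longrightarrow> 0 \<le> linear_part k"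
  unfolding linear_part_def by (rule closest_point_dot_nonneg[OF convex_D closed_D iterate_in])

lemma oracle_part_nonneg: "\<lbrakk>1 \<le> k; k \<le> K\<rbrakk> \<Longrightarrow> 0 \<le> oracle_part k"
  unfolding oracle_part_def by (rule closest_point_dot_nonneg[OF convex_D closed_D oracle_in])

lemma primal_gap_nonneg: "\<lbrakk>1 \<le> k; k \<le> Suc K\<rbrakk> \<Longrightarrow> 0 \<le> primal_gap k"
  unfolding primal_gap_eq using dist_part_nonneg linear_part_nonneg by simp

text \<open>The oracle answer is compared with \<open>opt\<close>: the left-hand side equals the
  inner product of X - c and X - \<open>opt\<close>. The difference of the two sides becomes the
  \<open>slack\<close> of the open-loop recursion.\<close>

lemma fw_gap_ge:
  assumes "1 \<le> k" "k \<le> K"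
  shows "linear_part k + 2 * dist_part k \<le> fw_gap k"
proof -
  have "(X k - c) \<bullet> S k \<le> (X k - c) \<bullet> opt" by (rule oracle_min[OF assms opt_in])
  then show ?thesis
    unfolding linear_part_def dist_part_def fw_gap_def power2_norm_eq_inner
    by (simp add: inner_diff_left inner_diff_right inner_commute field_simps)
qed

lemma primal_gap_le_fw_gap: "\<lbrakk>1 \<le> k; k \<le> K\<rbrakk> \<Longrightarrow> primal_gap k \<le> fw_gap k"
  using fw_gap_ge[of k] dist_part_nonneg[of k] unfolding primal_gap_eq by linarith

lemma dist_part_step:
  assumes "1 \<le> k" "k \<le> K"
  shows "dist_part (Suc k) = (1 - 2 * e k) * dist_part k
    - e k * ((fw_gap k - linear_part k - 2 * dist_part k) + oracle_part k) + (e k)\<^sup>2 / 2 * len2 k"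
  unfolding update[OF assms] dist_part_def linear_part_def fw_gap_def oracle_part_def len2_def
    power2_norm_eq_inner
  by (simp add: inner_diff_left inner_diff_right inner_add_left inner_add_right inner_commute
      power2_eq_square field_simps)

lemma linear_part_step:
  assumes "1 \<le> k" "k \<le> K"
  shows "linear_part (Suc k) = (1 - e k) * linear_part k + e k * oracle_part k"
  unfolding update[OF assms] linear_part_def oracle_part_def
  by (simp add: inner_diff_left inner_diff_right inner_add_left inner_add_right algebra_simps)

lemma primal_gap_step:
  assumes "1 \<le> k" "k \<le> K"
  shows "primal_gap (Suc k) = primal_gap k - e k * fw_gap k + (e k)\<^sup>2 / 2 * len2 k"
  unfolding primal_gap_eq dist_part_step[OF assms] linear_part_step[OF assms]
  by (simp add: algebra_simps)

lemma len2_le: "\<lbrakk>1 \<le> k; k \<le> K\<rbrakk> \<Longrightarrow> len2 k \<le> M\<^sup>2"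
  unfolding len2_def using M[OF oracle_in iterate_in] by (intro power_mono) auto

lemma fw_gap_pos_len2: "0 < fw_gap k \<Longrightarrow> 0 < len2 k"
  unfolding fw_gap_def len2_def by (cases "S k = X k") auto

text \<open>\<open>S k\<close> is optimal for the gradient at \<open>X k\<close>, in particular
  against \<open>S (Suc k)\<close>, and the gradient changes by exactly
  \<open>e k *\<^sub>R (S k - X k)\<close>. A positive gap that does not shrink thus forces
  successive directions to have a negative inner product.\<close>

lemma consecutive_gap:
  assumes k: "1 \<le> k" "k < K"
  shows "fw_gap (Suc k) \<le> (1 - e k) * fw_gap k - e k * ((S k - X k) \<bullet> (S (Suc k) - X (Suc k)))"
proof -
  have kK: "k \<le> K" "1 \<le> Suc k" "Suc k \<le> K" using k by auto
  have "(X k - c) \<bullet> S k \<le> (X k - c) \<bullet> S (Suc k)"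
    by (rule oracle_min[OF k(1) kK(1) oracle_in[OF kK(2,3)]])
  then show ?thesis
    unfolding fw_gap_def update[OF k(1) kK(1)]
    by (simp add: inner_diff_left inner_diff_right inner_add_left inner_add_right inner_commute
        algebra_simps)
qed

text \<open>With d and d' the two directions, d' - (1 - e) d is the difference of two oracle answers
  and has norm at most M. Together with a negative inner product of d and d' this limits the sum of
  the squared lengths.\<close>

lemma consecutive_len2:
  assumes k: "1 \<le> k" "k < K"
  shows "len2 (Suc k) + (1 - e k)\<^sup>2 * len2 k - M\<^sup>2
    \<le> 2 * (1 - e k) * ((S k - X k) \<bullet> (S (Suc k) - X (Suc k)))"
proof -
  have kK: "k \<le> K" "1 \<le> Suc k" "Suc k \<le> K" using k by auto
  have eq: "(S (Suc k) - X (Suc k)) - (1 - e k) *\<^sub>R (S k - X k) = S (Suc k) - S k"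
    unfolding update[OF k(1) kK(1)] by (simp add: algebra_simps)
  have "(norm ((S (Suc k) - X (Suc k)) - (1 - e k) *\<^sub>R (S k - X k)))\<^sup>2 \<le> M\<^sup>2"
    unfolding eq using M[OF oracle_in oracle_in, OF kK(2,3) k(1) kK(1)] by (intro power_mono) auto
  moreover have "(norm (u - r *\<^sub>R v))\<^sup>2 = (norm u)\<^sup>2 + r\<^sup>2 * (norm v)\<^sup>2 - 2 * r * (v \<bullet> u)"
    for u v :: 'a and r :: real
    unfolding power2_norm_eq_inner
    by (simp add: inner_diff_left inner_diff_right inner_commute power2_eq_square algebra_simps)
  ultimately show ?thesis unfolding len2_def by simp
qed

lemma consecutive_combined:
  assumes k: "1 \<le> k" "k < K"
  shows "e k * (len2 (Suc k) + (1 - e k)\<^sup>2 * len2 k - M\<^sup>2)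
    \<le> 2 * (1 - e k) * ((1 - e k) * fw_gap k - fw_gap (Suc k))"
proof -
  define p where "p = (S k - X k) \<bullet> (S (Suc k) - X (Suc k))"
  have e: "0 \<le> e k" "0 \<le> 1 - e k" using step_range[of k] k by auto
  have "e k * (len2 (Suc k) + (1 - e k)\<^sup>2 * len2 k - M\<^sup>2) \<le> e k * (2 * (1 - e k) * p)"
    using consecutive_len2[OF k] e unfolding p_def by (intro mult_left_mono) auto
  also have "\<dots> = 2 * (1 - e k) * (e k * p)" by simp
  also have "\<dots> \<le> 2 * (1 - e k) * ((1 - e k) * fw_gap k - fw_gap (Suc k))"
    using consecutive_gap[OF k] e unfolding p_def by (intro mult_left_mono) auto
  finally show ?thesis .
qed

text \<open>This serves \<open>K = 2\<close>, where the required bound 2 M^2 / K is M^2; the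
  theorems on the two recursions start at \<open>K = 3\<close>.\<close>

lemma gap_after_full_step:
  assumes "1 < K" "e 1 = 1"
  shows "fw_gap 2 \<le> M\<^sup>2"
proof -
  have s: "Suc 1 = 2" by simp
  have "fw_gap 2 \<le> - ((S 1 - X 1) \<bullet> (S 2 - X 2))"
    using consecutive_gap[of 1] assms unfolding s by simp
  also have "\<dots> \<le> norm (S 1 - X 1) * norm (S 2 - X 2)"
    using Cauchy_Schwarz_ineq2[of "S 1 - X 1" "S 2 - X 2"] by linarith
  also have "\<dots> \<le> M * M"
    using assms by (intro mult_mono M oracle_in iterate_in order_trans[OF norm_ge_zero M[OF start start]]) auto
  finally show ?thesis by (simp add: power2_eq_square)
qed

lemma open_loop_gap_bound:
  assumes K: "2 \<le> K" and M0: "0 < M"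
    and e: "\<And>k. \<lbrakk>1 \<le> k; k \<le> K\<rbrakk> \<Longrightarrow> e k = 2 / (real k + 1)"
  shows "\<exists>k\<in>{1..K}. fw_gap k \<le> 2 * M\<^sup>2 / real K"
proof (cases "K = 2")
  case True
  then show ?thesis using gap_after_full_step e[of 1] by (intro bexI[of _ 2]) auto
next
  case False
  have M2: "0 < M\<^sup>2" using M0 by simp
  interpret r: open_loop_recursion K "\<lambda>k. dist_part k / M\<^sup>2" "\<lambda>k. linear_part k / M\<^sup>2"
    "\<lambda>k. (fw_gap k - linear_part k - 2 * dist_part k) / M\<^sup>2" "\<lambda>k. oracle_part k / M\<^sup>2"
    "\<lambda>k. len2 k / M\<^sup>2" "\<lambda>k. fw_gap k / M\<^sup>2"
  proof
    fix k
    show "0 \<le> dist_part k / M\<^sup>2" using dist_part_nonneg by simp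
    show "0 \<le> linear_part k / M\<^sup>2" if "1 \<le> k" "k \<le> Suc K" using linear_part_nonneg[OF that] by simp
    assume k: "1 \<le> k" "k \<le> K"
    show "0 \<le> (fw_gap k - linear_part k - 2 * dist_part k) / M\<^sup>2" using fw_gap_ge[OF k] by simp
    show "0 \<le> oracle_part k / M\<^sup>2" using oracle_part_nonneg[OF k] by simp
    show "0 \<le> len2 k / M\<^sup>2" unfolding len2_def by simp
    show "len2 k / M\<^sup>2 \<le> 1" using len2_le[OF k] M2 by simp
    show "fw_gap k / M\<^sup>2 = linear_part k / M\<^sup>2 + 2 * (dist_part k / M\<^sup>2)
        + (fw_gap k - linear_part k - 2 * dist_part k) / M\<^sup>2"
      by (simp add: diff_divide_distrib)
    show "dist_part (Suc k) / M\<^sup>2 = (1 - 2 * (2 / (real k + 1))) * (dist_part k / M\<^sup>2)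
        - 2 / (real k + 1) * ((fw_gap k - linear_part k - 2 * dist_part k) / M\<^sup>2 + oracle_part k / M\<^sup>2)
        + (2 / (real k + 1))\<^sup>2 / 2 * (len2 k / M\<^sup>2)"
      unfolding dist_part_step[OF k] e[OF k, symmetric]
      by (simp add: diff_divide_distrib add_divide_distrib algebra_simps)
    show "linear_part (Suc k) / M\<^sup>2 = (1 - 2 / (real k + 1)) * (linear_part k / M\<^sup>2)
        + 2 / (real k + 1) * (oracle_part k / M\<^sup>2)"
      unfolding linear_part_step[OF k] e[OF k, symmetric] by (simp add: add_divide_distrib)
  next
    fix k assume k: "2 \<le> k" "k < K"
    define q where "q = (real k - 1) / (real k + 1)"
    have ek: "e k = 2 / (real k + 1)" "1 - e k = q" "2 * q = (real k - 1) * e k"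
      using e[of k] k unfolding q_def by (auto simp: field_simps)
    have e0: "0 < e k" unfolding ek(1) by simp
    have "e k * (len2 (Suc k) + q\<^sup>2 * len2 k - M\<^sup>2)
        \<le> e k * ((real k - 1) * (q * fw_gap k - fw_gap (Suc k)))"
      using consecutive_combined[of k] k unfolding ek(2,3) by (simp add: mult.commute mult.left_commute)
    then have "len2 (Suc k) + q\<^sup>2 * len2 k - M\<^sup>2 \<le> (real k - 1) * (q * fw_gap k - fw_gap (Suc k))"
      using e0 by simp
    then have "((real k - 1) * (fw_gap (Suc k) - q * fw_gap k) + len2 (Suc k) + q\<^sup>2 * len2 k) / M\<^sup>2 \<le> 1"
      using M2 by (simp add: algebra_simps)
    then show "(real k - 1) * (fw_gap (Suc k) / M\<^sup>2 - (real k - 1) / (real k + 1) * (fw_gap k / M\<^sup>2))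
        + len2 (Suc k) / M\<^sup>2 + ((real k - 1) / (real k + 1))\<^sup>2 * (len2 k / M\<^sup>2) \<le> 1"
      unfolding q_def[symmetric] by (simp add: add_divide_distrib diff_divide_distrib algebra_simps)
  qed
  have "\<exists>k\<in>{1..K}. fw_gap k / M\<^sup>2 \<le> 2 / real K"
    by (rule open_loop_gap[OF r.open_loop_recursion_axioms]) (use K False in auto)
  then show ?thesis using M2 by (simp add: pos_divide_le_eq mult.commute)
qed

lemma short_step_progress:
  assumes k: "1 \<le> k" "k \<le> K" and gap: "0 < fw_gap k" and e: "e k = min (fw_gap k / len2 k) 1"
  shows "fw_gap k < len2 k \<Longrightarrow> primal_gap (Suc k) = primal_gap k - (fw_gap k)\<^sup>2 / (2 * len2 k)"
    and "len2 k \<le> fw_gap k \<Longrightarrow> primal_gap (Suc k) = primal_gap k - fw_gap k + len2 k / 2"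
proof -
  have l: "0 < len2 k" by (rule fw_gap_pos_len2[OF gap])
  show "primal_gap (Suc k) = primal_gap k - (fw_gap k)\<^sup>2 / (2 * len2 k)" if "fw_gap k < len2 k"
  proof -
    have ek: "e k = fw_gap k / len2 k" using that l e by simp
    show ?thesis unfolding primal_gap_step[OF k] ek using l
      by (simp add: divide_simps power2_eq_square)
  qed
  show "primal_gap (Suc k) = primal_gap k - fw_gap k + len2 k / 2" if "len2 k \<le> fw_gap k"
  proof -
    have ek: "e k = 1" using that l e by simp
    show ?thesis unfolding primal_gap_step[OF k] ek by simp
  qed
qed

lemma short_step_gap_bound:
  assumes K: "2 \<le> K" and M0: "0 < M"
    and e: "\<And>k. \<lbrakk>1 \<le> k; k \<le> K\<rbrakk> \<Longrightarrow> e k = min (fw_gap k / len2 k) 1"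
    and pos: "\<And>k. \<lbrakk>1 \<le> k; k \<le> K\<rbrakk> \<Longrightarrow> 0 < fw_gap k"
  shows "\<exists>k\<in>{1..K}. fw_gap k \<le> 2 * M\<^sup>2 / real K"
proof (cases "K = 2")
  case True
  show ?thesis
  proof (cases "fw_gap 1 < len2 1")
    case True
    then have "fw_gap 1 \<le> M\<^sup>2" using len2_le[of 1] K by simp
    then show ?thesis using \<open>K = 2\<close> by (intro bexI[of _ 1]) auto
  next
    case False
    then have "e 1 = 1" using e[of 1] fw_gap_pos_len2[OF pos[of 1]] K by (simp add: min_def divide_simps)
    then show ?thesis using gap_after_full_step \<open>K = 2\<close> by (intro bexI[of _ 2]) auto
  qed
next
  case False
  have M2: "0 < M\<^sup>2" using M0 by simp
  interpret r: short_step_recursion K "\<lambda>k. primal_gap k / M\<^sup>2" "\<lambda>k. fw_gap k / M\<^sup>2" "\<lambda>k. len2 k / M\<^sup>2"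
  proof
    show "primal_gap 2 / M\<^sup>2 \<le> 1 / 2"
    proof -
      have k: "1 \<le> (1::nat)" "1 \<le> K" using K by auto
      have l: "0 < len2 1" using fw_gap_pos_len2[OF pos[OF k]] .
      \<comment> \<open>The start drops out here as well: the primal gap is at most G, and G - G^2 /
        (2 x) \<le> x / 2 for every G.\<close>
      have "primal_gap (Suc 1) \<le> len2 1 / 2"
      proof (cases "fw_gap 1 < len2 1")
        case True
        have "fw_gap 1 - (fw_gap 1)\<^sup>2 / (2 * len2 1) - len2 1 / 2
          = - ((len2 1 - fw_gap 1)\<^sup>2 / (2 * len2 1))"
          using l by (simp add: field_simps power2_eq_square)
        also have "\<dots> \<le> 0" using l by simp
        finally show ?thesis
          using short_step_progress(1)[OF k pos[OF k] e[OF k] True] primal_gap_le_fw_gap[OF k] by simp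
      next
        case False
        then show ?thesis
          using short_step_progress(2)[OF k pos[OF k] e[OF k]] primal_gap_le_fw_gap[OF k] by simp
      qed
      also have "\<dots> \<le> M\<^sup>2 / 2" using len2_le[OF k] by simp
      finally show ?thesis using M2 by (simp add: numeral_2_eq_2 divide_simps)
    qed
  next
    fix k assume "2 \<le> k" "k \<le> Suc K"
    then show "0 \<le> primal_gap k / M\<^sup>2" using primal_gap_nonneg[of k] by simp
  next
    fix k assume k': "2 \<le> k" "k \<le> K"
    then have k: "1 \<le> k" "k \<le> K" by auto
    note l = fw_gap_pos_len2[OF pos[OF k]]
    show "primal_gap k / M\<^sup>2 \<le> fw_gap k / M\<^sup>2"
      using primal_gap_le_fw_gap[OF k] by (intro divide_right_mono) auto
    show "0 < len2 k / M\<^sup>2" using l M2 by simp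
    show "len2 k / M\<^sup>2 \<le> 1" using len2_le[OF k] M2 by simp
    show "primal_gap (Suc k) / M\<^sup>2 = primal_gap k / M\<^sup>2 - (fw_gap k / M\<^sup>2)\<^sup>2 / (2 * (len2 k / M\<^sup>2))"
      if "fw_gap k / M\<^sup>2 < len2 k / M\<^sup>2"
    proof -
      have "fw_gap k < len2 k" using that M2 by (simp add: divide_less_cancel)
      then show ?thesis
        using short_step_progress(1)[OF k pos[OF k] e[OF k]] l M0
        by (simp add: field_simps power2_eq_square)
    qed
    show "primal_gap (Suc k) / M\<^sup>2 = primal_gap k / M\<^sup>2 - fw_gap k / M\<^sup>2 + len2 k / M\<^sup>2 / 2"
      if "len2 k / M\<^sup>2 \<le> fw_gap k / M\<^sup>2"
    proof -
      have "len2 k \<le> fw_gap k" using that M2 by (simp add: divide_le_cancel)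
      then show ?thesis
        using short_step_progress(2)[OF k pos[OF k] e[OF k]]
        by (simp add: add_divide_distrib diff_divide_distrib)
    qed
  next
    fix k assume k': "2 \<le> k" "k < K" and "fw_gap k / M\<^sup>2 < len2 k / M\<^sup>2" "0 < fw_gap k / M\<^sup>2"
    then have s: "fw_gap k < len2 k" "0 < fw_gap k" using M2 by (auto simp: divide_less_cancel zero_less_divide_iff)
    have k: "1 \<le> k" "k \<le> K" using k' by auto
    define l l' g g' where "l = len2 k" and "l' = len2 (Suc k)" and "g = fw_gap k" and "g' = fw_gap (Suc k)"
    have lg: "0 < g" "g < l" using s unfolding l_def g_def by auto
    have ek: "e k = g / l" using e[OF k] lg unfolding l_def[symmetric] g_def[symmetric] by simp
    have "g / l * (l' + (1 - g / l)\<^sup>2 * l - M\<^sup>2) \<le> 2 * (1 - g / l) * ((1 - g / l) * g - g')"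
      using consecutive_combined[OF k(1) k'(2)]
      unfolding ek l_def[symmetric] l'_def[symmetric] g_def[symmetric] g'_def[symmetric] .
    then have "l / g * (g / l * (l' + (1 - g / l)\<^sup>2 * l - M\<^sup>2))
        \<le> l / g * (2 * (1 - g / l) * ((1 - g / l) * g - g'))"
      using lg by (intro mult_left_mono) auto
    moreover have "l / g * (g / l * y) = y" for y using lg by simp
    ultimately have "l' + (1 - g / l)\<^sup>2 * l - M\<^sup>2 \<le> l / g * (2 * (1 - g / l) * ((1 - g / l) * g - g'))"
      by simp
    moreover have "l / g * (2 * (1 - g / l) * ((1 - g / l) * g - g')) - (1 - g / l)\<^sup>2 * l
        = l - 2 * l * g' / g - 2 * (g - g') + g\<^sup>2 / l"
      using lg by (simp add: divide_simps power2_eq_square) (simp add: algebra_simps)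
    ultimately have "l' \<le> M\<^sup>2 + l - 2 * l * g' / g - 2 * (g - g') + g\<^sup>2 / l" by linarith
    then have "l' / M\<^sup>2 \<le> (M\<^sup>2 + l - 2 * l * g' / g - 2 * (g - g') + g\<^sup>2 / l) / M\<^sup>2"
      by (rule divide_right_mono) simp
    also have "\<dots> = 1 + l / M\<^sup>2 - 2 * (l / M\<^sup>2) * (g' / M\<^sup>2) / (g / M\<^sup>2) - 2 * (g / M\<^sup>2 - g' / M\<^sup>2)
        + (g / M\<^sup>2)\<^sup>2 / (l / M\<^sup>2)"
      using lg M0 by (simp add: divide_simps power2_eq_square)
    finally show "len2 (Suc k) / M\<^sup>2 \<le> 1 + len2 k / M\<^sup>2
        - 2 * (len2 k / M\<^sup>2) * (fw_gap (Suc k) / M\<^sup>2) / (fw_gap k / M\<^sup>2)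
        - 2 * (fw_gap k / M\<^sup>2 - fw_gap (Suc k) / M\<^sup>2) + (fw_gap k / M\<^sup>2)\<^sup>2 / (len2 k / M\<^sup>2)"
      unfolding l_def l'_def g_def g'_def .
  qed
  have "\<exists>k\<in>{2..K}. fw_gap k / M\<^sup>2 \<le> 2 / real K"
    by (rule short_step_gap[OF r.short_step_recursion_axioms]) (use K False in auto)
  then obtain k where "k \<in> {2..K}" "fw_gap k / M\<^sup>2 \<le> 2 / real K" by blast
  then show ?thesis using M2 by (intro bexI[of _ k]) (auto simp: pos_divide_le_eq mult.commute)
qed

section \<open>Faster decrease on strongly convex sets\<close>

text \<open>The test point is the midpoint of \<open>X\<close> and \<open>S\<close>, shifted against the gradient.\<close>

lemma strongly_convex_fw_gap:
  assumes D: "strongly_convex_set_with \<alpha> D" and k: "1 \<le> k" "k \<le> K"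
  shows "\<alpha> / 4 * len2 k * norm (X k - c) \<le> fw_gap k"
proof (cases "X k = c")
  case True
  then show ?thesis unfolding fw_gap_def by simp
next
  case False
  define w where "w = X k - c"
  define z where "z = - (1 / norm w) *\<^sub>R w"
  have w: "0 < norm w" unfolding w_def using False by simp
  have z: "norm z \<le> 1" "w \<bullet> z = - norm w"
    unfolding z_def using w by (auto simp: power2_norm_eq_inner[symmetric] power2_eq_square)
  have "X k + (1 / 2) *\<^sub>R (S k - X k) + (1 / 2 * (1 - 1 / 2) * (\<alpha> / 2) * (norm (X k - S k))\<^sup>2) *\<^sub>R z \<in> D"
    by (rule D[unfolded strongly_convex_set_with_def, rule_format])
      (use iterate_in[of k] oracle_in[OF k] k z(1) in auto)
  from oracle_min[OF k this]
  have "w \<bullet> S k \<le> w \<bullet> X k + 1 / 2 * (w \<bullet> (S k - X k)) - \<alpha> / 8 * len2 k * norm w"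
    using z(2) unfolding w_def[symmetric] len2_def by (simp add: inner_add_right norm_minus_commute)
  then show ?thesis
    unfolding fw_gap_def w_def[symmetric] by (simp add: inner_diff_right field_simps)
qed

text \<open>By \<open>strongly_convex_fw_gap\<close> and sqrt h \<le> |X - c|, the size of a short
  step is at least \<alpha>/4 sqrt h, and the decrease is half of it times the gap; hence \<alpha> /
  8. A full step decreases h by at least half the gap, which \<open>\<kappa> * A \<le> 1 / 2\<close>
  brings into the same form.\<close>

lemma strongly_convex_progress:
  assumes D: "strongly_convex_set_with \<alpha> D" and k: "1 \<le> k" "k \<le> K"
    and e: "e k = min (fw_gap k / len2 k) 1" and gap: "0 < fw_gap k"
    and A: "norm (X k - c) \<le> A" and \<kappa>: "0 \<le> \<kappa>" "\<kappa> \<le> \<alpha> / 8" "\<kappa> * A \<le> 1 / 2"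
  shows "primal_gap (Suc k) \<le> primal_gap k - \<kappa> * fw_gap k * sqrt (primal_gap k)"
proof -
  have l: "0 < len2 k" by (rule fw_gap_pos_len2[OF gap])
  have "primal_gap k \<le> (norm (X k - c))\<^sup>2"
    unfolding primal_gap_def by simp
  then have s: "sqrt (primal_gap k) \<le> norm (X k - c)"
    by (rule real_le_lsqrt[rotated 1]) simp
  have s0: "0 \<le> sqrt (primal_gap k)" using primal_gap_nonneg[of k] k by simp
  show ?thesis
  proof (cases "fw_gap k < len2 k")
    case True
    have "\<kappa> * sqrt (primal_gap k) * (2 * len2 k) \<le> \<alpha> / 8 * norm (X k - c) * (2 * len2 k)"
      using \<kappa> s s0 l by (intro mult_right_mono mult_mono) auto
    also have "\<dots> \<le> fw_gap k" using strongly_convex_fw_gap[OF D k] by (simp add: mult_ac)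
    finally have "\<kappa> * sqrt (primal_gap k) \<le> fw_gap k / (2 * len2 k)"
      using l by (simp add: pos_le_divide_eq)
    then have "fw_gap k * (\<kappa> * sqrt (primal_gap k)) \<le> fw_gap k * (fw_gap k / (2 * len2 k))"
      using gap by (intro mult_left_mono) auto
    then show ?thesis
      using short_step_progress(1)[OF k gap e True] by (simp add: power2_eq_square mult_ac)
  next
    case False
    have "\<kappa> * sqrt (primal_gap k) \<le> \<kappa> * A" using \<kappa> s A by (intro mult_left_mono) auto
    then have "fw_gap k * (\<kappa> * sqrt (primal_gap k)) \<le> fw_gap k * (1 / 2)"
      using gap \<kappa> by (intro mult_left_mono) auto
    then show ?thesis
      using short_step_progress(2)[OF k gap e] False by (simp add: mult_ac)
  qed
qed

text \<open>For u = sqrt h, dividing the decrease of h by u + u' \<le> 2 u shows that u loses at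
  least \<kappa>/2 times the gap, and the gap dominates max(u, sqrt \<delta>)^2. So
  \<open>tangent_inverse (sqrt \<delta>)\<close> gains \<kappa>/2 per step along u, while it never
  exceeds its value 2 / sqrt \<delta> at 0.\<close>

lemma strongly_convex_iteration_bound:
  assumes D: "strongly_convex_set_with \<alpha> D"
    and e: "\<And>k. \<lbrakk>1 \<le> k; k \<le> K\<rbrakk> \<Longrightarrow> e k = min (fw_gap k / len2 k) 1"
    and \<delta>: "0 < \<delta>" "\<And>k. \<lbrakk>1 \<le> k; k \<le> K\<rbrakk> \<Longrightarrow> \<delta> \<le> fw_gap k"
    and A: "\<And>k. \<lbrakk>1 \<le> k; k \<le> K\<rbrakk> \<Longrightarrow> norm (X k - c) \<le> A"
    and \<kappa>: "0 < \<kappa>" "\<kappa> \<le> \<alpha> / 8" "\<kappa> * A \<le> 1 / 2"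
  shows "real K \<le> 4 / (\<kappa> * sqrt \<delta>)"
proof -
  define r where "r = sqrt \<delta>"
  define u where "u k = sqrt (primal_gap k)" for k
  have r: "0 < r" "r\<^sup>2 = \<delta>" unfolding r_def using \<delta>(1) by auto
  have u: "0 \<le> u k" "(u k)\<^sup>2 = primal_gap k" if "1 \<le> k" "k \<le> Suc K" for k
    unfolding u_def using primal_gap_nonneg[OF that] by auto
  have step: "tangent_inverse r (u k) + \<kappa> / 2 \<le> tangent_inverse r (u (Suc k))" if k: "1 \<le> k" "k \<le> K" for k
  proof -
    have k': "k \<le> Suc K" "1 \<le> Suc k" "Suc k \<le> Suc K" using k by auto
    have gap: "0 < fw_gap k" using \<delta>(2)[OF k] \<delta>(1) by simp
    have "primal_gap (Suc k) < primal_gap k"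
      using short_step_progress[OF k gap e[OF k]] gap fw_gap_pos_len2[OF gap]
      by (cases "fw_gap k < len2 k") auto
    then have lt: "u (Suc k) < u k" unfolding u_def by simp
    define m where "m = max (u k) r"
    have m: "m\<^sup>2 \<le> fw_gap k" "u k \<le> m" "r \<le> m" "0 < m"
      using u(2)[OF k(1) k'(1)] r \<delta>(2)[OF k] primal_gap_le_fw_gap[OF k] unfolding m_def
      by (auto simp: max_def)
    have u0: "0 < u k" "0 \<le> u (Suc k)" using lt u(1)[OF k'(2,3)] by auto
    have "\<kappa> * m\<^sup>2 * u k \<le> \<kappa> * fw_gap k * u k"
      using m u0 \<kappa> by (intro mult_right_mono mult_left_mono) auto
    also have "\<dots> \<le> primal_gap k - primal_gap (Suc k)"
      using strongly_convex_progress[OF D k e[OF k] gap A[OF k] _ \<kappa>(2,3)] \<kappa>(1) unfolding u_def by simp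
    also have "\<dots> = (u k - u (Suc k)) * (u k + u (Suc k))"
      unfolding u(2)[OF k(1) k'(1), symmetric] u(2)[OF k'(2,3), symmetric]
      by (simp add: power2_eq_square algebra_simps)
    also have "\<dots> \<le> (u k - u (Suc k)) * (2 * u k)"
      using lt by (intro mult_left_mono) auto
    finally have "(\<kappa> * m\<^sup>2) * u k \<le> (2 * (u k - u (Suc k))) * u k" by (simp add: mult_ac)
    then have "\<kappa> * m\<^sup>2 \<le> 2 * (u k - u (Suc k))" using u0 by simp
    then have "\<kappa> / 2 \<le> (u k - u (Suc k)) / (m * m)"
      using m by (simp add: pos_le_divide_eq power2_eq_square)
    also have "\<dots> \<le> tangent_inverse r (u (Suc k)) - tangent_inverse r (u k)"
      using r u0 lt m by (intro tangent_inverse_diff) auto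
    finally show ?thesis by simp
  qed
  have nn: "0 \<le> tangent_inverse r t" if "0 \<le> t" for t
  proof (cases "r \<le> t")
    case False
    then have "t / r\<^sup>2 \<le> r / r\<^sup>2" by (intro divide_right_mono) auto
    also have "\<dots> \<le> 2 / r" using r by (simp add: power2_eq_square divide_simps)
    finally show ?thesis using False by (simp add: tangent_inverse_def)
  qed (use that in \<open>simp add: tangent_inverse_def\<close>)
  have "real k * (\<kappa> / 2) \<le> tangent_inverse r (u (Suc k))" if "k \<le> K" for k
    using that
  proof (induction k)
    case 0
    then show ?case using nn u(1)[of 1] by simp
  next
    case (Suc k)
    then show ?case using step[of "Suc k"] by (simp add: algebra_simps)
  qed
  from this[of K] have "real K * (\<kappa> / 2) \<le> tangent_inverse r (u (Suc K))" by simp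
  also have "\<dots> \<le> 2 / r"
  proof (cases "r \<le> u (Suc K)")
    case True
    then have "1 / u (Suc K) \<le> 1 / r" using r by (intro divide_left_mono) auto
    also have "\<dots> \<le> 2 / r" using r by (simp add: divide_simps)
    finally show ?thesis using True by (simp add: tangent_inverse_def)
  qed (use u(1)[of "Suc K"] in \<open>simp add: tangent_inverse_def\<close>)
  finally show ?thesis
    using r \<kappa> unfolding r_def by (simp add: field_simps)
qed

end

section \<open>Gradients and the descent inequality\<close>

lemma gradient_eq:
  assumes "GDERIV f x :> v"
  shows "gradient f x = v"
  unfolding gradient_def
proof (rule the_equality[where P = "\<lambda>v. GDERIV f x :> v", OF assms])
  fix w assume "GDERIV f x :> w"
  then have "(\<lambda>h. h \<bullet> w) = (\<lambda>h. h \<bullet> v)"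
    using assms unfolding gderiv_def by (rule has_derivative_unique)
  then have "(w - v) \<bullet> w = (w - v) \<bullet> v" by (rule fun_cong)
  then have "(w - v) \<bullet> (w - v) = 0" unfolding inner_diff_right[of "w - v"] by simp
  then show "w = v" by simp
qed

lemma differentiable_gradient:
  fixes f :: "'a::euclidean_space \<Rightarrow> real"
  assumes "f differentiable (at x)"
  shows "GDERIV f x :> gradient f x"
proof -
  obtain f' where f': "(f has_derivative f') (at x)" using assms unfolding differentiable_def by blast
  then have lin: "linear f'" by (rule has_derivative_linear)
  have "f' h = h \<bullet> (\<Sum>b\<in>Basis. f' b *\<^sub>R b)" for h
  proof -
    have "f' h = f' (\<Sum>b\<in>Basis. (h \<bullet> b) *\<^sub>R b)" by (simp add: euclidean_representation)
    also have "\<dots> = (\<Sum>b\<in>Basis. (h \<bullet> b) * f' b)"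
      by (simp add: linear_sum[OF lin] linear_scale[OF lin])
    finally show ?thesis by (simp add: inner_sum_right mult.commute)
  qed
  then have "f' = (\<lambda>h. h \<bullet> (\<Sum>b\<in>Basis. f' b *\<^sub>R b))" by (rule ext)
  with f' have grad: "GDERIV f x :> (\<Sum>b\<in>Basis. f' b *\<^sub>R b)" unfolding gderiv_def by simp
  show ?thesis unfolding gradient_eq[OF grad] by (rule grad)
qed

lemma GDERIV_half_norm_squared: "GDERIV (\<lambda>x. L / 2 * (norm x)\<^sup>2) x :> L *\<^sub>R x"
  unfolding gderiv_def power2_norm_eq_inner
  by (auto intro!: derivative_eq_intros simp: inner_commute algebra_simps)

text \<open>\<open>F\<close> is \<phi> minus the terms of the bound that vary along the segment from
  x to y. Its derivative is nonpositive by Cauchy-Schwarz and the Lipschitz condition, which is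
  available there because \<open>D\<close> is convex.\<close>

lemma smooth_upper_bound:
  fixes D :: "'a::euclidean_space set"
  assumes smooth: "L_smooth_on L D \<phi>" and D: "convex D" "x \<in> D" "y \<in> D"
  shows "\<phi> y \<le> \<phi> x + gradient \<phi> x \<bullet> (y - x) + L / 2 * (norm (y - x))\<^sup>2"
proof -
  define p where "p s = x + s *\<^sub>R (y - x)" for s :: real
  define F where "F s = \<phi> (p s) - s * (gradient \<phi> x \<bullet> (y - x)) - L / 2 * s\<^sup>2 * (norm (y - x))\<^sup>2" for s
  have "F 1 \<le> F 0"
  proof (rule DERIV_nonpos_imp_nonincreasing[where f = F and a = 0 and b = 1])
    fix s :: real assume s: "0 \<le> s" "s \<le> 1"
    have "(1 - s) *\<^sub>R x + s *\<^sub>R y \<in> D" using s D by (intro convexD_alt) auto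
    then have pD: "p s \<in> D" unfolding p_def by (simp add: algebra_simps)
    then have "GDERIV \<phi> (p s) :> gradient \<phi> (p s)"
      using smooth differentiable_gradient unfolding L_smooth_on_def by blast
    then have d: "(\<phi> has_derivative (\<lambda>h. h \<bullet> gradient \<phi> (p s))) (at (p s))" unfolding gderiv_def .
    have "(p has_derivative (\<lambda>h. h *\<^sub>R (y - x))) (at s)"
      unfolding p_def by (auto intro!: derivative_eq_intros)
    from diff_chain_at[OF this d]
    have "((\<lambda>s. \<phi> (p s)) has_derivative (\<lambda>h. (h *\<^sub>R (y - x)) \<bullet> gradient \<phi> (p s))) (at s)"
      by (simp add: o_def)
    then have "((\<lambda>s. \<phi> (p s)) has_real_derivative (y - x) \<bullet> gradient \<phi> (p s)) (at s)"
      by (rule has_derivative_imp_has_field_derivative) simp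
    then have F': "(F has_real_derivative (y - x) \<bullet> gradient \<phi> (p s) - gradient \<phi> x \<bullet> (y - x)
        - L * s * (norm (y - x))\<^sup>2) (at s)"
      unfolding F_def by (auto intro!: derivative_eq_intros)
    have "(y - x) \<bullet> gradient \<phi> (p s) - gradient \<phi> x \<bullet> (y - x)
        = (y - x) \<bullet> (gradient \<phi> (p s) - gradient \<phi> x)"
      by (simp add: inner_diff_right inner_commute)
    also have "\<dots> \<le> norm (y - x) * norm (gradient \<phi> (p s) - gradient \<phi> x)"
      by (rule norm_cauchy_schwarz)
    also have "\<dots> \<le> norm (y - x) * (L * norm (p s - x))"
      using smooth pD D unfolding L_smooth_on_def
      by (intro mult_left_mono) (auto simp: dist_norm dest: lipschitz_onD)
    also have "\<dots> = L * s * (norm (y - x))\<^sup>2"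
      unfolding p_def using s by (simp add: power2_eq_square)
    finally show "\<exists>z. (F has_real_derivative z) (at s) \<and> z \<le> 0" using F' by force
  qed simp
  then show ?thesis unfolding F_def p_def by simp
qed

section \<open>The quadratic difference-of-convex decomposition\<close>

locale dc_quadratic =
  fixes D :: "'a::euclidean_space set" and \<phi> f g :: "'a \<Rightarrow> real" and L :: real
  assumes D_ne: "D \<noteq> {}" and convex_D: "convex D" and compact_D: "compact D"
    and L_pos: "0 < L"
    and smooth: "L_smooth_on L D \<phi>"
    and f_eq: "f = (\<lambda>x. L / 2 * (norm x)\<^sup>2)"
    and g_eq: "g = (\<lambda>x. L / 2 * (norm x)\<^sup>2 - \<phi> x)"
begin

lemma gradient_f: "gradient f x = L *\<^sub>R x"
  unfolding f_eq by (rule gradient_eq[OF GDERIV_half_norm_squared])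

lemma gradient_g: "x \<in> D \<Longrightarrow> gradient g x = L *\<^sub>R x - gradient \<phi> x"
  unfolding g_eq
  by (intro gradient_eq GDERIV_diff GDERIV_half_norm_squared differentiable_gradient)
    (use smooth in \<open>auto simp: L_smooth_on_def\<close>)

lemma gradient_surrogate: "gradient (surrogate f g y) x = L *\<^sub>R x - gradient g y"
proof (rule gradient_eq)
  have "GDERIV (\<lambda>x. gradient g y \<bullet> (x - y)) x :> gradient g y"
    unfolding gderiv_def by (auto intro!: derivative_eq_intros simp: inner_commute)
  then have "GDERIV (\<lambda>x. f x - g y - gradient g y \<bullet> (x - y)) x :> L *\<^sub>R x - 0 - gradient g y"
    unfolding f_eq by (intro GDERIV_diff GDERIV_half_norm_squared GDERIV_const)
  then show "GDERIV (surrogate f g y) x :> L *\<^sub>R x - gradient g y"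
    unfolding surrogate_def by simp
qed

lemma surrogate_diff:
  "surrogate f g y (x + s *\<^sub>R d) = surrogate f g y x + s * ((L *\<^sub>R x - gradient g y) \<bullet> d)
    + L / 2 * s\<^sup>2 * (norm d)\<^sup>2"
  unfolding surrogate_def f_eq power2_norm_eq_inner
  by (simp add: inner_diff_left inner_diff_right inner_add_left inner_add_right inner_commute
      power2_eq_square algebra_simps)

lemma surrogate_self: "surrogate f g y y = \<phi> y"
  unfolding surrogate_def f_eq g_eq by simp

lemma surrogate_ge:
  assumes "y \<in> D" "x \<in> D"
  shows "\<phi> x \<le> surrogate f g y x"
proof -
  have "surrogate f g y x = \<phi> y + gradient \<phi> y \<bullet> (x - y) + L / 2 * (norm (x - y))\<^sup>2"
    using surrogate_diff[of y y 1 "x - y"] gradient_g[OF assms(1)] surrogate_self by simp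
  then show ?thesis using smooth_upper_bound[OF smooth convex_D assms] by simp
qed

lemma gap_DC_le:
  assumes "\<And>x. x \<in> D \<Longrightarrow> surrogate f g y y - surrogate f g y x \<le> B"
  shows "gap_DC f g D y \<le> B"
  unfolding gap_DC_def
proof (rule cSUP_least[OF D_ne])
  fix x assume "x \<in> D"
  from assms[OF this] show "f y - f x - gradient g y \<bullet> (y - x) \<le> B"
    unfolding surrogate_def by (simp add: inner_diff_right algebra_simps)
qed

lemma diameter_bound: "\<lbrakk>u \<in> D; v \<in> D\<rbrakk> \<Longrightarrow> norm (u - v) \<le> diameter D"
  using diameter_bounded_bound[OF compact_imp_bounded[OF compact_D]] by (simp add: dist_norm)

end

section \<open>Runs of the algorithm\<close>

locale dcfw = dc_quadratic D \<phi> f g L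
  for D :: "'a::euclidean_space set" and \<phi> f g L +
  fixes \<epsilon> :: real and rule :: step_rule and x0 :: 'a and R :: "'a dcfw_trace"
  assumes \<epsilon>_pos: "0 < \<epsilon>" and x0: "x0 \<in> D" and run: "dcfw_run f g L D rule \<epsilon> x0 R"
begin

abbreviation "stop \<equiv> inner_stop f g \<epsilon> R"

text \<open>The inner problem is the projection of this point onto \<open>D\<close>, scaled by \<open>L\<close>.\<close>

definition center :: "nat \<Rightarrow> 'a" where
  "center t = gradient g (outer R t) /\<^sub>R L"

lemma lin_grad_eq: "lin_grad f g R t k = L *\<^sub>R (inner_it R t k - center t)"
  unfolding lin_grad_def gradient_f center_def using L_pos by (simp add: scaleR_diff_right)

lemma
  assumes "1 \<le> k" "\<forall>j\<in>{1..<k}. \<not> stop t j"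
  shows run_argmin: "is_arg_min (\<lambda>x. lin_grad f g R t k \<bullet> x) (\<lambda>x. x \<in> D) (oracle_ans R t k)"
    and run_stop: "stop t k \<Longrightarrow> outer R (Suc t) = inner_it R t k"
    and run_step: "\<not> stop t k \<Longrightarrow> admissible_step rule L f g (outer R t) k (inner_it R t k)
        (direction R t k) (step_size R t k)"
    and run_update: "\<not> stop t k \<Longrightarrow>
        inner_it R t (Suc k) = inner_it R t k + step_size R t k *\<^sub>R direction R t k"
  using run assms unfolding dcfw_run_def by (auto split: if_splits)

lemma stop_iff: "stop t k \<longleftrightarrow>
    (inner_it R t k - center t) \<bullet> (inner_it R t k - oracle_ans R t k) \<le> \<epsilon> / (2 * L)"
proof -
  have "- (lin_grad f g R t k \<bullet> direction R t k)
      = L * ((inner_it R t k - center t) \<bullet> (inner_it R t k - oracle_ans R t k))"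
    unfolding lin_grad_eq direction_def inner_scaleR_left inner_diff_right
    by (simp add: right_diff_distrib)
  then show ?thesis unfolding inner_stop_def using L_pos by (simp add: field_simps)
qed

text \<open>Along a nonzero direction the surrogate is a strictly convex quadratic in the step, so
  its minimizer over [0, 1] is unique: the unconstrained minimizer cut off at 1. Hence exact line
  search has no freedom and agrees with the Demyanov-Rubinov step.\<close>

lemma step_size_cases:
  assumes k: "1 \<le> k" and go: "\<forall>j\<in>{1..k}. \<not> stop t j"
  defines "d \<equiv> oracle_ans R t k - inner_it R t k"
  defines "G \<equiv> (inner_it R t k - center t) \<bullet> (inner_it R t k - oracle_ans R t k)"
  shows "rule = Open_Loop \<Longrightarrow> step_size R t k = 2 / (real k + 1)"
    and "rule \<noteq> Open_Loop \<Longrightarrow> step_size R t k = min (G / (norm d)\<^sup>2) 1"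
    and "0 \<le> step_size R t k \<and> step_size R t k \<le> 1"
proof -
  have go': "\<forall>j\<in>{1..<k}. \<not> stop t j" "\<not> stop t k" using go k by auto
  have d: "direction R t k = d" unfolding direction_def d_def ..
  note adm = run_step[OF k go'(1) go'(2), unfolded d]
  have G: "0 < G"
    using go'(2) \<epsilon>_pos L_pos unfolding stop_iff G_def[symmetric]
    by (smt (verit) divide_pos_pos)
  then have "d \<noteq> 0" unfolding G_def d_def by auto
  then have n: "0 < (norm d)\<^sup>2" by simp
  have grad: "(L *\<^sub>R inner_it R t k - gradient g (outer R t)) \<bullet> d = - (L * G)"
    unfolding lin_grad_eq[of t k, unfolded lin_grad_def gradient_f] G_def d_def
      inner_scaleR_left inner_diff_right by (simp add: right_diff_distrib)
  define E where "E = min (G / (norm d)\<^sup>2) 1"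
  have E: "0 \<le> E" "E \<le> 1" unfolding E_def using G n by auto
  show 1: "step_size R t k = 2 / (real k + 1)" if "rule = Open_Loop" using adm that by simp
  show 2: "step_size R t k = min (G / (norm d)\<^sup>2) 1" if "rule \<noteq> Open_Loop"
  proof (cases "rule")
    case Exact_Line_Search
    define s where "s = step_size R t k"
    have amin: "is_arg_min (\<lambda>s. surrogate f g (outer R t) (inner_it R t k + s *\<^sub>R d)) (\<lambda>s. s \<in> {0..1}) s"
      using adm Exact_Line_Search unfolding s_def by simp
    then have s: "0 \<le> s" "s \<le> 1" unfolding is_arg_min_def by auto
    have "\<not> surrogate f g (outer R t) (inner_it R t k + E *\<^sub>R d)
        < surrogate f g (outer R t) (inner_it R t k + s *\<^sub>R d)"
      using amin E unfolding is_arg_min_def by auto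
    then have "L * (- s * G + s\<^sup>2 / 2 * (norm d)\<^sup>2) \<le> L * (- E * G + E\<^sup>2 / 2 * (norm d)\<^sup>2)"
      unfolding surrogate_diff grad by (simp add: algebra_simps)
    then have le: "- s * G + s\<^sup>2 / 2 * (norm d)\<^sup>2 \<le> - E * G + E\<^sup>2 / 2 * (norm d)\<^sup>2"
      using L_pos by simp
    \<comment> \<open>The first-order optimality condition of \<open>E\<close> on [0, 1], tested
      with \<open>s\<close>.\<close>
    have "0 \<le> (E * (norm d)\<^sup>2 - G) * (s - E)"
    proof (cases "G / (norm d)\<^sup>2 \<le> 1")
      case True
      then show ?thesis unfolding E_def using n by simp
    next
      case False
      then have "E = 1" "(norm d)\<^sup>2 < G" unfolding E_def using n by (auto simp: divide_simps)
      then show ?thesis using s by (auto intro: mult_nonpos_nonpos)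
    qed
    moreover have "(- s * G + s\<^sup>2 / 2 * (norm d)\<^sup>2) - (- E * G + E\<^sup>2 / 2 * (norm d)\<^sup>2)
        = (E * (norm d)\<^sup>2 - G) * (s - E) + (norm d)\<^sup>2 / 2 * (s - E)\<^sup>2"
      by (simp add: power2_eq_square field_simps)
    ultimately have "(norm d)\<^sup>2 / 2 * (s - E)\<^sup>2 \<le> 0" using le by linarith
    then have "s = E" using n by (simp add: mult_le_0_iff)
    then show ?thesis unfolding s_def E_def .
  next
    case Demyanov_Rubinov
    have "step_size R t k = min (- ((L *\<^sub>R inner_it R t k - gradient g (outer R t)) \<bullet> d) / (L * (norm d)\<^sup>2)) 1"
      using adm Demyanov_Rubinov by (simp add: gradient_surrogate)
    then show ?thesis unfolding grad using L_pos by simp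
  qed (use that in simp)
  show "0 \<le> step_size R t k \<and> step_size R t k \<le> 1"
    using 1 2 E k unfolding E_def by (cases "rule = Open_Loop") auto
qed

lemma frank_wolfe:
  assumes t: "outer R t \<in> D" and go: "\<forall>j\<in>{1..K}. \<not> stop t j"
  shows "frank_wolfe_run D (center t) (diameter D) K (inner_it R t) (oracle_ans R t) (step_size R t)"
proof
  show "convex D" "closed D" using convex_D compact_D compact_imp_closed by auto
  show "norm (u - v) \<le> diameter D" if "u \<in> D" "v \<in> D" for u v using diameter_bound that .
  show "inner_it R t 1 \<in> D" using run t unfolding dcfw_run_def by simp
next
  fix k assume k: "1 \<le> k" "k \<le> K"
  then have go': "\<forall>j\<in>{1..<k}. \<not> stop t j" "\<not> stop t k" "\<forall>j\<in>{1..k}. \<not> stop t j" using go by auto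
  note argmin = run_argmin[OF k(1) go'(1)]
  show "oracle_ans R t k \<in> D" using argmin unfolding is_arg_min_def by simp
  show "(inner_it R t k - center t) \<bullet> oracle_ans R t k \<le> (inner_it R t k - center t) \<bullet> z" if "z \<in> D" for z
    using argmin that L_pos unfolding is_arg_min_def lin_grad_eq by (auto simp: not_less)
  show "inner_it R t (Suc k) = inner_it R t k + step_size R t k *\<^sub>R (oracle_ans R t k - inner_it R t k)"
    using run_update[OF k(1) go'(1,2)] unfolding direction_def .
  show "0 \<le> step_size R t k \<and> step_size R t k \<le> 1"
    by (rule step_size_cases(3)[OF k(1) go'(3)])
qed

text \<open>Stated for any prefix without a stop, so that it first yields termination and afterwards
  bounds the length of the terminated loop.\<close>

lemma iteration_bound:
  assumes t: "outer R t \<in> D" and go: "\<forall>j\<in>{1..K}. \<not> stop t j"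
  shows "real K \<le> max 1 (4 * L * (diameter D)\<^sup>2 / \<epsilon>)"
proof (cases "2 \<le> K")
  case True
  interpret fw: frank_wolfe_run D "center t" "diameter D" K "inner_it R t" "oracle_ans R t" "step_size R t"
    by (rule frank_wolfe[OF assms])
  have gap: "\<epsilon> / (2 * L) < fw.fw_gap k" if "1 \<le> k" "k \<le> K" for k
    using go that stop_iff[of t k] unfolding fw.fw_gap_def by auto
  have pos: "0 < \<epsilon> / (2 * L)" using \<epsilon>_pos L_pos by simp
  have M: "0 < diameter D"
  proof -
    have "0 < fw.len2 1" using gap[of 1] pos True by (intro fw.fw_gap_pos_len2) auto
    then show ?thesis using fw.len2_le[of 1] diameter_ge_0[OF compact_imp_bounded[OF compact_D]] True
      by (cases "diameter D = 0") auto
  qed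
  have "\<exists>k\<in>{1..K}. fw.fw_gap k \<le> 2 * (diameter D)\<^sup>2 / real K"
  proof (cases "rule = Open_Loop")
    case True
    then show ?thesis
      using \<open>2 \<le> K\<close> M go by (intro fw.open_loop_gap_bound step_size_cases(1)) auto
  next
    case False
    have "step_size R t k = min (fw.fw_gap k / fw.len2 k) 1" if "1 \<le> k" "k \<le> K" for k
      using step_size_cases(2)[of k t] False go that unfolding fw.fw_gap_def fw.len2_def by auto
    then show ?thesis
      using \<open>2 \<le> K\<close> M gap pos by (intro fw.short_step_gap_bound) (auto intro: less_trans)
  qed
  then obtain k where k: "1 \<le> k" "k \<le> K" "fw.fw_gap k \<le> 2 * (diameter D)\<^sup>2 / real K" by auto
  then have "\<epsilon> / (2 * L) < 2 * (diameter D)\<^sup>2 / real K" using gap[of k] by simp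
  then have "real K * \<epsilon> < 4 * L * (diameter D)\<^sup>2" using L_pos True by (simp add: field_simps)
  then show ?thesis using \<epsilon>_pos by (simp add: le_max_iff_disj field_simps)
qed simp

lemma terminates:
  assumes "outer R t \<in> D"
  shows "inner_terminates f g \<epsilon> R t"
proof (rule ccontr)
  assume "\<not> ?thesis"
  then have "\<forall>j\<in>{1..K}. \<not> stop t j" for K unfolding inner_terminates_def by auto
  then have "real K \<le> max 1 (4 * L * (diameter D)\<^sup>2 / \<epsilon>)" for K
    using iteration_bound[OF assms] by blast
  then show False using reals_Archimedean2 not_less by blast
qed

lemma
  assumes "outer R t \<in> D"
  shows calls_ge: "1 \<le> inner_oracle_calls f g \<epsilon> R t"
    and calls_stop: "stop t (inner_oracle_calls f g \<epsilon> R t)"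
    and calls_least: "\<forall>j\<in>{1..<inner_oracle_calls f g \<epsilon> R t}. \<not> stop t j"
proof -
  obtain k where k: "1 \<le> k \<and> stop t k"
    using terminates[OF assms] unfolding inner_terminates_def by blast
  from LeastI[of "\<lambda>k. 1 \<le> k \<and> stop t k", OF k]
  show "1 \<le> inner_oracle_calls f g \<epsilon> R t" "stop t (inner_oracle_calls f g \<epsilon> R t)"
    unfolding inner_oracle_calls_def by auto
  show "\<forall>j\<in>{1..<inner_oracle_calls f g \<epsilon> R t}. \<not> stop t j"
  proof
    fix j assume "j \<in> {1..<inner_oracle_calls f g \<epsilon> R t}"
    then have "1 \<le> j" "j < (LEAST k. 1 \<le> k \<and> stop t k)" unfolding inner_oracle_calls_def by auto
    then show "\<not> stop t j" using not_less_Least[of j "\<lambda>k. 1 \<le> k \<and> stop t k"] by blast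
  qed
qed

lemma iterations_go:
  assumes "outer R t \<in> D"
  shows "\<forall>j\<in>{1..inner_iterations f g \<epsilon> R t}. \<not> stop t j"
  using calls_least[OF assms] calls_ge[OF assms] unfolding inner_iterations_def by auto

text \<open>The surrogate lies above its linearization at the final inner iterate, and over
  \<open>D\<close> the linearization decreases most at the oracle answer, where the stopping test
  allows only \<epsilon> / 2.\<close>

lemma outer_Suc:
  assumes t: "outer R t \<in> D"
  shows "outer R (Suc t) \<in> D"
    and "z \<in> D \<Longrightarrow> surrogate f g (outer R t) (outer R (Suc t)) \<le> surrogate f g (outer R t) z + \<epsilon> / 2"
proof -
  define N where "N = inner_oracle_calls f g \<epsilon> R t"
  note N = calls_ge[OF t, folded N_def] calls_stop[OF t, folded N_def] calls_least[OF t, folded N_def]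
  have NK: "Suc (inner_iterations f g \<epsilon> R t) = N" unfolding inner_iterations_def using N(1) N_def by simp
  have X: "outer R (Suc t) = inner_it R t N" by (rule run_stop[OF N(1,3,2)])
  interpret fw: frank_wolfe_run D "center t" "diameter D" "inner_iterations f g \<epsilon> R t"
    "inner_it R t" "oracle_ans R t" "step_size R t"
    by (rule frank_wolfe[OF t iterations_go[OF t]])
  show "outer R (Suc t) \<in> D" unfolding X using fw.iterate_in[of N] NK N(1) by simp
  assume z: "z \<in> D"
  define w where "w = L *\<^sub>R inner_it R t N - gradient g (outer R t)"
  have w: "w = lin_grad f g R t N" unfolding w_def lin_grad_def gradient_f ..
  have "w \<bullet> oracle_ans R t N \<le> w \<bullet> z"
    using run_argmin[OF N(1,3)] z unfolding is_arg_min_def w by (auto simp: not_less)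
  then have "- (w \<bullet> (z - inner_it R t N)) \<le> - (w \<bullet> (oracle_ans R t N - inner_it R t N))"
    by (simp add: inner_diff_right)
  also have "\<dots> \<le> \<epsilon> / 2" using N(2) unfolding inner_stop_def w direction_def .
  finally have "- (w \<bullet> (z - inner_it R t N)) \<le> \<epsilon> / 2" .
  moreover have "surrogate f g (outer R t) z = surrogate f g (outer R t) (inner_it R t N)
      + w \<bullet> (z - inner_it R t N) + L / 2 * (norm (z - inner_it R t N))\<^sup>2"
    using surrogate_diff[of "outer R t" "inner_it R t N" 1 "z - inner_it R t N"] unfolding w_def by simp
  moreover have "0 \<le> L / 2 * (norm (z - inner_it R t N))\<^sup>2" using L_pos by simp
  ultimately show "surrogate f g (outer R t) (outer R (Suc t)) \<le> surrogate f g (outer R t) z + \<epsilon> / 2"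
    unfolding X by linarith
qed

lemma outer_in: "outer R t \<in> D"
proof (induction t)
  case 0
  then show ?case using run x0 unfolding dcfw_run_def by simp
qed (rule outer_Suc)

lemma gap_le: "gap_DC f g D (outer R t) \<le> \<phi> (outer R t) - \<phi> (outer R (Suc t)) + \<epsilon> / 2"
proof (rule gap_DC_le)
  fix x assume "x \<in> D"
  then show "surrogate f g (outer R t) (outer R t) - surrogate f g (outer R t) x
      \<le> \<phi> (outer R t) - \<phi> (outer R (Suc t)) + \<epsilon> / 2"
    using outer_Suc(2)[OF outer_in, of x t] surrogate_ge[OF outer_in outer_in, of "Suc t" t]
      surrogate_self[of "outer R t"] by linarith
qed

lemma min_gap_le:
  assumes "is_arg_min \<phi> (\<lambda>x. x \<in> D) xs"
  shows "(MIN \<tau>\<in>{0..t}. gap_DC f g D (outer R \<tau>)) \<le> (\<phi> x0 - \<phi> xs) / (real t + 1) + \<epsilon> / 2"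
proof -
  define m where "m = (MIN \<tau>\<in>{0..t}. gap_DC f g D (outer R \<tau>))"
  have m: "m \<le> gap_DC f g D (outer R \<tau>)" if "\<tau> \<le> t" for \<tau>
    unfolding m_def using that by (intro Min_le) auto
  have "(real s) * m \<le> \<phi> (outer R 0) - \<phi> (outer R s) + real s * (\<epsilon> / 2)" if "s \<le> Suc t" for s
    using that
  proof (induction s)
    case (Suc s)
    then show ?case using m[of s] gap_le[of s] by (simp add: field_simps)
  qed simp
  from this[of "Suc t"] have "(real t + 1) * m
      \<le> \<phi> (outer R 0) - \<phi> (outer R (Suc t)) + (real t + 1) * (\<epsilon> / 2)" by (simp add: add.commute)
  moreover have "outer R 0 = x0" using run unfolding dcfw_run_def by simp
  moreover have "\<phi> xs \<le> \<phi> (outer R (Suc t))"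
    using assms outer_in unfolding is_arg_min_def by (auto simp: not_less)
  ultimately have "(real t + 1) * m \<le> (\<phi> x0 - \<phi> xs) + (real t + 1) * (\<epsilon> / 2)"
    by simp
  also have "\<dots> = (real t + 1) * ((\<phi> x0 - \<phi> xs) / (real t + 1) + \<epsilon> / 2)"
    using nonzero_mult_div_cancel_left[of "real t + 1" "\<phi> x0 - \<phi> xs"]
    unfolding distrib_left[of "real t + 1"] times_divide_eq_right by simp
  finally show ?thesis unfolding m_def[symmetric] by (rule mult_left_le_imp_le) simp
qed

lemma first_stationary_le:
  assumes xs: "is_arg_min \<phi> (\<lambda>x. x \<in> D) xs"
  shows "\<exists>\<tau>. gap_DC f g D (outer R \<tau>) \<le> \<epsilon>"
    and "real (first_stationary f g D \<epsilon> R) \<le> 2 * (\<phi> x0 - \<phi> xs) / \<epsilon> + 1"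
proof -
  define \<Delta> where "\<Delta> = \<phi> x0 - \<phi> xs"
  have \<Delta>: "0 \<le> \<Delta>" using xs x0 unfolding \<Delta>_def is_arg_min_def by (auto simp: not_less)
  define t where "t = nat \<lceil>2 * \<Delta> / \<epsilon>\<rceil>"
  have t: "2 * \<Delta> / \<epsilon> \<le> real t" "real t \<le> 2 * \<Delta> / \<epsilon> + 1"
    unfolding t_def using \<Delta> \<epsilon>_pos by (auto simp: of_nat_nat)
  have "2 * \<Delta> \<le> real t * \<epsilon>" using t(1) \<epsilon>_pos by (simp add: pos_divide_le_eq)
  also have "\<dots> \<le> (real t + 1) * \<epsilon>" using \<epsilon>_pos by simp
  finally have "\<Delta> / (real t + 1) \<le> \<epsilon> / 2" by (simp add: pos_divide_le_eq mult.commute)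
  then have "(MIN \<tau>\<in>{0..t}. gap_DC f g D (outer R \<tau>)) \<le> \<epsilon>"
    using min_gap_le[OF xs, of t] unfolding \<Delta>_def by linarith
  then obtain \<tau> where \<tau>: "\<tau> \<le> t" "gap_DC f g D (outer R \<tau>) \<le> \<epsilon>"
    by (subst (asm) Min_le_iff) auto
  then show "\<exists>\<tau>. gap_DC f g D (outer R \<tau>) \<le> \<epsilon>" by blast
  have "first_stationary f g D \<epsilon> R \<le> \<tau>" unfolding first_stationary_def using \<tau>(2) by (rule Least_le)
  then show "real (first_stationary f g D \<epsilon> R) \<le> 2 * (\<phi> x0 - \<phi> xs) / \<epsilon> + 1"
    using \<tau>(1) t(2) unfolding \<Delta>_def by linarith
qed

lemma inner_iterations_le: "real (inner_iterations f g \<epsilon> R t) \<le> max 1 (4 * L * (diameter D)\<^sup>2 / \<epsilon>)"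
  by (rule iteration_bound[OF outer_in iterations_go[OF outer_in]])

lemma oracle_calls_le:
  assumes "\<And>t. real (inner_iterations f g \<epsilon> R t) \<le> B"
  shows "real (oracle_calls f g D \<epsilon> R) \<le> (real (first_stationary f g D \<epsilon> R) + 1) * (B + 1)"
proof -
  have "real (inner_oracle_calls f g \<epsilon> R t) \<le> B + 1" for t
    using assms[of t] calls_ge[OF outer_in, of t] unfolding inner_iterations_def by linarith
  then have "(\<Sum>t\<le>n. real (inner_oracle_calls f g \<epsilon> R t)) \<le> (real n + 1) * (B + 1)" for n
    using sum_bounded_above[of "{..n}" "\<lambda>t. real (inner_oracle_calls f g \<epsilon> R t)" "B + 1"]
    by (simp add: add.commute)
  then show ?thesis unfolding oracle_calls_def by simp
qed

text \<open>The distance of an inner iterate to \<open>center t\<close> is at most |X - x_t| +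
  |gradient \<phi> x_t| / L, and the Lipschitz condition moves the gradient to \<open>x0\<close> at
  the cost of one more diameter. So \<open>\<kappa>\<close> is the same for all outer iterations and
  all \<epsilon>; the summand 1 keeps the denominator positive.\<close>

lemma strongly_convex_inner_iterations_le:
  assumes D: "strongly_convex_set_with \<alpha> D" "0 < \<alpha>" and rule: "rule = Demyanov_Rubinov"
  defines "\<kappa> \<equiv> min (\<alpha> / 8) (1 / (2 * (2 * diameter D + norm (gradient \<phi> x0) / L + 1)))"
  shows "real (inner_iterations f g \<epsilon> R t) \<le> 4 / (\<kappa> * sqrt (\<epsilon> / (2 * L)))"
proof -
  define A where "A = 2 * diameter D + norm (gradient \<phi> x0) / L"
  define K where "K = inner_iterations f g \<epsilon> R t"
  have A: "0 \<le> A"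
    unfolding A_def using diameter_ge_0[OF compact_imp_bounded[OF compact_D]] L_pos by simp
  note go = iterations_go[OF outer_in, of t, folded K_def]
  interpret fw: frank_wolfe_run D "center t" "diameter D" K
    "inner_it R t" "oracle_ans R t" "step_size R t"
    by (rule frank_wolfe[OF outer_in go])
  show ?thesis
    unfolding K_def[symmetric]
  proof (rule fw.strongly_convex_iteration_bound[OF D(1), where A = A])
    show "0 < \<epsilon> / (2 * L)" using \<epsilon>_pos L_pos by simp
    show "0 < \<kappa>" unfolding \<kappa>_def A_def[symmetric] using A D(2) by simp
    show "\<kappa> \<le> \<alpha> / 8" unfolding \<kappa>_def by simp
    have "\<kappa> * A \<le> 1 / (2 * (A + 1)) * A"
      unfolding \<kappa>_def A_def[symmetric] using A by (intro mult_right_mono) auto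
    also have "\<dots> \<le> 1 / 2" using A by (simp add: divide_simps)
    finally show "\<kappa> * A \<le> 1 / 2" .
  next
    fix k assume k: "1 \<le> k" "k \<le> K"
    show "step_size R t k = min (fw.fw_gap k / fw.len2 k) 1"
      using step_size_cases(2)[of k t] rule go k unfolding fw.fw_gap_def fw.len2_def by auto
    show "\<epsilon> / (2 * L) \<le> fw.fw_gap k"
      using go k stop_iff[of t k] unfolding fw.fw_gap_def by auto
    have Xk: "inner_it R t k \<in> D" using fw.iterate_in[of k] k by simp
    have "center t = outer R t - gradient \<phi> (outer R t) /\<^sub>R L"
      unfolding center_def gradient_g[OF outer_in] using L_pos by (simp add: scaleR_diff_right)
    then have "inner_it R t k - center t = (inner_it R t k - outer R t) + gradient \<phi> (outer R t) /\<^sub>R L"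
      by simp
    then have "norm (inner_it R t k - center t)
        \<le> norm (inner_it R t k - outer R t) + norm (gradient \<phi> (outer R t) /\<^sub>R L)"
      by (simp only: norm_triangle_ineq)
    moreover have "norm (gradient \<phi> (outer R t) /\<^sub>R L) = norm (gradient \<phi> (outer R t)) / L"
      using L_pos by (simp add: divide_inverse mult.commute)
    moreover have "norm (gradient \<phi> (outer R t)) \<le> norm (gradient \<phi> x0) + L * diameter D"
    proof -
      have "norm (gradient \<phi> (outer R t) - gradient \<phi> x0) \<le> L * norm (outer R t - x0)"
        using smooth lipschitz_onD[of L D "gradient \<phi>", OF _ outer_in x0, of t]
        unfolding L_smooth_on_def by (simp add: dist_norm)
      also have "\<dots> \<le> L * diameter D"
        using L_pos diameter_bound[OF outer_in x0] by (intro mult_left_mono) auto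
      finally show ?thesis using norm_triangle_sub[of "gradient \<phi> (outer R t)" "gradient \<phi> x0"] by simp
    qed
    then have "norm (gradient \<phi> (outer R t)) / L \<le> (norm (gradient \<phi> x0) + L * diameter D) / L"
      using L_pos by (intro divide_right_mono) auto
    then have "norm (gradient \<phi> (outer R t)) / L \<le> norm (gradient \<phi> x0) / L + diameter D"
      using L_pos by (simp add: add_divide_distrib)
    ultimately show "norm (inner_it R t k - center t) \<le> A"
      using diameter_bound[OF Xk outer_in, of t] unfolding A_def by linarith
  qed
qed

end

text \<open>In the asymptotic part \<open>R\<close> is a function of \<epsilon>: one arbitrary run
  for each accuracy, and runs for different accuracies need not be related.\<close>

theorem theorem9:
  fixes D :: "(real ^ 'n) set"
    and \<phi> f g :: "real ^ 'n \<Rightarrow> real"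
    and L :: real
    and x0 xstar :: "real ^ 'n"
  assumes D: "D \<noteq> {}" "convex D" "compact D"
    and L: "L > 0"
    and smooth: "L_smooth_on L D \<phi>"
    and xstar: "is_arg_min \<phi> (\<lambda>x. x \<in> D) xstar"
    and x0: "x0 \<in> D"
    and f: "f = (\<lambda>x. L / 2 * (norm x)\<^sup>2)"
    and g: "g = (\<lambda>x. L / 2 * (norm x)\<^sup>2 - \<phi> x)"
  shows
    "(\<forall>\<epsilon>>0. \<forall>rule R. dcfw_run f g L D rule \<epsilon> x0 R \<longrightarrow>
        (\<forall>t. (MIN \<tau>\<in>{0..t}. gap_DC f g D (outer R \<tau>))
               \<le> (\<phi> x0 - \<phi> xstar) / (real t + 1) + \<epsilon> / 2) \<and>
        (\<forall>t. inner_terminates f g \<epsilon> R t \<and>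
             real (inner_iterations f g \<epsilon> R t) \<le> max 1 (4 * L * (diameter D)\<^sup>2 / \<epsilon>))) \<and>
     (\<forall>rule R. (\<forall>\<epsilon>>0. dcfw_run f g L D rule \<epsilon> x0 (R \<epsilon>)) \<longrightarrow>
        (\<forall>\<epsilon>>0. \<exists>\<tau>. gap_DC f g D (outer (R \<epsilon>) \<tau>) \<le> \<epsilon>) \<and>
        (\<lambda>\<epsilon>. real (gradient_evaluations f g D \<epsilon> (R \<epsilon>))) \<in> O[at_right 0](\<lambda>\<epsilon>. 1 / \<epsilon>) \<and>
        (\<lambda>\<epsilon>. real (oracle_calls f g D \<epsilon> (R \<epsilon>))) \<in> O[at_right 0](\<lambda>\<epsilon>. 1 / \<epsilon>\<^sup>2) \<and>
        (strongly_convex_set D \<and> rule = Demyanov_Rubinov \<longrightarrow>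
           (\<lambda>\<epsilon>. real (oracle_calls f g D \<epsilon> (R \<epsilon>)))
             \<in> O[at_right 0](\<lambda>\<epsilon>. 1 / \<epsilon> powr (3 / 2))))"
proof -
  have dc: "dc_quadratic D \<phi> f g L"
    using D L smooth f g by unfold_locales
  have dcfw: "dcfw D \<phi> f g L \<epsilon> rule x0 R" if "0 < \<epsilon>" "dcfw_run f g L D rule \<epsilon> x0 R" for \<epsilon> rule R
    using dc that x0 by (intro dcfw.intro dcfw_axioms.intro)
  define \<Delta> where "\<Delta> = \<phi> x0 - \<phi> xstar"
  define M where "M = diameter D"
  have \<Delta>: "0 \<le> \<Delta>" using xstar x0 unfolding \<Delta>_def is_arg_min_def by (auto simp: not_less)
  have complexity: "(\<forall>\<epsilon>>0. \<exists>\<tau>. gap_DC f g D (outer (R \<epsilon>) \<tau>) \<le> \<epsilon>) \<and>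
        (\<lambda>\<epsilon>. real (gradient_evaluations f g D \<epsilon> (R \<epsilon>))) \<in> O[at_right 0](\<lambda>\<epsilon>. 1 / \<epsilon>) \<and>
        (\<lambda>\<epsilon>. real (oracle_calls f g D \<epsilon> (R \<epsilon>))) \<in> O[at_right 0](\<lambda>\<epsilon>. 1 / \<epsilon>\<^sup>2) \<and>
        (strongly_convex_set D \<and> rule = Demyanov_Rubinov \<longrightarrow>
           (\<lambda>\<epsilon>. real (oracle_calls f g D \<epsilon> (R \<epsilon>)))
             \<in> O[at_right 0](\<lambda>\<epsilon>. 1 / \<epsilon> powr (3 / 2)))"
    if runs: "\<forall>\<epsilon>>0. dcfw_run f g L D rule \<epsilon> x0 (R \<epsilon>)" for rule R
  proof -
    have d: "dcfw D \<phi> f g L \<epsilon> rule x0 (R \<epsilon>)" if "0 < \<epsilon>" for \<epsilon> using dcfw runs that by blast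
    \<comment> \<open>For \<epsilon> < 1 the additive constants are absorbed into multiples of 1 /
      \<epsilon> and 1 / sqrt \<epsilon>.\<close>
    have small: "\<forall>\<^sub>F \<epsilon> in at_right 0. \<epsilon> \<in> {0<..<1::real}" by (rule eventually_at_right_real) simp
    have first: "real (first_stationary f g D \<epsilon> (R \<epsilon>)) + 1 \<le> (2 * \<Delta> + 2) / \<epsilon>"
      if "\<epsilon> \<in> {0<..<1}" for \<epsilon>
    proof -
      have "real (first_stationary f g D \<epsilon> (R \<epsilon>)) + 1 \<le> 2 * \<Delta> / \<epsilon> + 2"
        using dcfw.first_stationary_le(2)[OF d xstar, of \<epsilon>] that unfolding \<Delta>_def by simp
      also have "\<dots> \<le> (2 * \<Delta> + 2) / \<epsilon>" using that by (simp add: field_simps)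
      finally show ?thesis .
    qed
    have calls: "real (oracle_calls f g D \<epsilon> (R \<epsilon>)) \<le> (2 * \<Delta> + 2) / \<epsilon> * (B + 1)"
      if "\<epsilon> \<in> {0<..<1}" "\<And>t. real (inner_iterations f g \<epsilon> (R \<epsilon>) t) \<le> B" for \<epsilon> B
    proof -
      have "0 \<le> B + 1" using that(2)[of 0] by simp
      then have "(real (first_stationary f g D \<epsilon> (R \<epsilon>)) + 1) * (B + 1) \<le> (2 * \<Delta> + 2) / \<epsilon> * (B + 1)"
        using first[OF that(1)] by (intro mult_right_mono)
      then show ?thesis using dcfw.oracle_calls_le[OF d that(2)] that(1) by force
    qed
    have "(\<lambda>\<epsilon>. real (gradient_evaluations f g D \<epsilon> (R \<epsilon>))) \<in> O[at_right 0](\<lambda>\<epsilon>. 1 / \<epsilon>)"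
    proof (rule bigoI[where c = "2 * \<Delta> + 2"])
      show "\<forall>\<^sub>F \<epsilon> in at_right 0. norm (real (gradient_evaluations f g D \<epsilon> (R \<epsilon>)))
          \<le> (2 * \<Delta> + 2) * norm (1 / \<epsilon>)"
        using small by eventually_elim (use first in \<open>simp add: gradient_evaluations_def add.commute\<close>)
    qed
    moreover have "(\<lambda>\<epsilon>. real (oracle_calls f g D \<epsilon> (R \<epsilon>))) \<in> O[at_right 0](\<lambda>\<epsilon>. 1 / \<epsilon>\<^sup>2)"
    proof (rule bigoI[where c = "(2 * \<Delta> + 2) * (2 + 4 * L * M\<^sup>2)"])
      show "\<forall>\<^sub>F \<epsilon> in at_right 0. norm (real (oracle_calls f g D \<epsilon> (R \<epsilon>)))
          \<le> (2 * \<Delta> + 2) * (2 + 4 * L * M\<^sup>2) * norm (1 / \<epsilon>\<^sup>2)"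
        using small
      proof eventually_elim
        case (elim \<epsilon>)
        then have \<epsilon>: "0 < \<epsilon>" "\<epsilon> < 1" by auto
        have "0 \<le> 4 * L * M\<^sup>2" using L by simp
        then have "max 1 (4 * L * M\<^sup>2 / \<epsilon>) + 1 \<le> (2 + 4 * L * M\<^sup>2) / \<epsilon>"
          using \<epsilon> by (simp add: max_def field_simps)
        then have "(2 * \<Delta> + 2) / \<epsilon> * (max 1 (4 * L * M\<^sup>2 / \<epsilon>) + 1)
            \<le> (2 * \<Delta> + 2) / \<epsilon> * ((2 + 4 * L * M\<^sup>2) / \<epsilon>)"
          using \<epsilon> \<Delta> by (intro mult_left_mono) auto
        also have "\<dots> = (2 * \<Delta> + 2) * (2 + 4 * L * M\<^sup>2) * (1 / \<epsilon>\<^sup>2)"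
          by (simp add: power2_eq_square)
        finally show ?case
          using calls[OF elim dcfw.inner_iterations_le[OF d[OF \<epsilon>(1)]]] \<epsilon> unfolding M_def by simp
      qed
    qed
    moreover have "(\<lambda>\<epsilon>. real (oracle_calls f g D \<epsilon> (R \<epsilon>))) \<in> O[at_right 0](\<lambda>\<epsilon>. 1 / \<epsilon> powr (3 / 2))"
      if strong: "strongly_convex_set D" "rule = Demyanov_Rubinov"
    proof -
      obtain \<alpha> where \<alpha>: "0 < \<alpha>" "strongly_convex_set_with \<alpha> D"
        using strong(1) unfolding strongly_convex_set_def by blast
      define \<kappa> where "\<kappa> = min (\<alpha> / 8) (1 / (2 * (2 * diameter D + norm (gradient \<phi> x0) / L + 1)))"
      have "0 \<le> diameter D" using D by (simp add: diameter_ge_0 compact_imp_bounded)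
      then have "0 < 2 * diameter D + norm (gradient \<phi> x0) / L + 1"
        using L by (intro add_nonneg_pos add_nonneg_nonneg) auto
      then have \<kappa>: "0 < \<kappa>" unfolding \<kappa>_def using \<alpha> by simp
      define C where "C = 4 * sqrt (2 * L) / \<kappa>"
      have C: "0 \<le> C" unfolding C_def using \<kappa> L by simp
      show ?thesis
      proof (rule bigoI[where c = "(2 * \<Delta> + 2) * (C + 1)"])
        show "\<forall>\<^sub>F \<epsilon> in at_right 0. norm (real (oracle_calls f g D \<epsilon> (R \<epsilon>)))
            \<le> (2 * \<Delta> + 2) * (C + 1) * norm (1 / \<epsilon> powr (3 / 2))"
          using small
        proof eventually_elim
          case (elim \<epsilon>)
          then have \<epsilon>: "0 < \<epsilon>" "\<epsilon> < 1" by auto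
          have s: "0 < sqrt \<epsilon>" "sqrt \<epsilon> \<le> 1" using \<epsilon> by auto
          have "real (inner_iterations f g \<epsilon> (R \<epsilon>) t) \<le> C / sqrt \<epsilon>" for t
            using dcfw.strongly_convex_inner_iterations_le[OF d[OF \<epsilon>(1)] \<alpha>(2,1) strong(2), of t]
            unfolding \<kappa>_def[symmetric] C_def by (simp add: real_sqrt_divide)
          from calls[OF elim this]
          have "real (oracle_calls f g D \<epsilon> (R \<epsilon>)) \<le> (2 * \<Delta> + 2) / \<epsilon> * (C / sqrt \<epsilon> + 1)" .
          also have "\<dots> \<le> (2 * \<Delta> + 2) / \<epsilon> * ((C + 1) / sqrt \<epsilon>)"
          proof (rule mult_left_mono)
            have "1 \<le> 1 / sqrt \<epsilon>" using s by (simp add: pos_le_divide_eq del: real_sqrt_le_1_iff)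
            then show "C / sqrt \<epsilon> + 1 \<le> (C + 1) / sqrt \<epsilon>" by (simp add: add_divide_distrib)
          qed (use \<epsilon> \<Delta> in auto)
          also have "\<dots> = (2 * \<Delta> + 2) * (C + 1) * (1 / (\<epsilon> * sqrt \<epsilon>))" by simp
          also have "\<epsilon> * sqrt \<epsilon> = \<epsilon> powr (3 / 2)"
            using \<epsilon> powr_add[of \<epsilon> 1 "1 / 2"] by (simp add: powr_half_sqrt)
          finally show ?case using \<epsilon> by simp
        qed
      qed
    qed
    ultimately show ?thesis using dcfw.first_stationary_le(1)[OF d xstar] by blast
  qed
  show ?thesis
  proof (intro conjI allI impI)
    fix \<epsilon> :: real and rule and R :: "(real ^ 'n) dcfw_trace" and t
    assume "0 < \<epsilon>" "dcfw_run f g L D rule \<epsilon> x0 R"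
    note d = dcfw[OF this]
    show "(MIN \<tau>\<in>{0..t}. gap_DC f g D (outer R \<tau>)) \<le> (\<phi> x0 - \<phi> xstar) / (real t + 1) + \<epsilon> / 2"
      by (rule dcfw.min_gap_le[OF d xstar])
    show "inner_terminates f g \<epsilon> R t"
      by (rule dcfw.terminates[OF d dcfw.outer_in[OF d]])
    show "real (inner_iterations f g \<epsilon> R t) \<le> max 1 (4 * L * (diameter D)\<^sup>2 / \<epsilon>)"
      by (rule dcfw.inner_iterations_le[OF d])
  qed (use complexity in blast)+
qed

end
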